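(* Let $k$ be an algebraically closed field of characteristic zero and $i=\sqrt{-1}\in k$. Let $X\subset\mathbb{P}^4$ be a cubic threefold with exactly eight nodes given by $$(ax_1+x_2+bx_3)x_4x_5+x_4(x_3^2-x_1^2)+x_5(x_3^2-x_2^2)=0$$ with $a,b\in k$, $a\neq0$, and let $G=\mathrm{Aut}(X)$. Then one of the following holds: • $b\ne0$ and $a\ne\pm1$, and $G=\langle\iota_1,\iota_2\rangle\simeq C_2^2$, where $\iota_1\colon(x_1,x_2,x_3,x_4,x_5)\mapsto(ax_5-x_1,x_2,x_3,x_4,x_5)$ and $\iota_2\colon(x_1,x_2,x_3,x_4,x_5)\mapsto(x_1,x_4-x_2,x_3,x_4,x_5)$; • $b\ne0$ and $a=\pm1$, and $G\simeq\mathfrak{D}_4$ (dihedral of order $8$), generated by $\iota_2$ and $\sigma_1\colon(x_1,x_2,x_3,x_4,x_5)\mapsto(\pm x_2,x_5\mp x_1,x_3,x_5,x_4)$; • $b=0$, $a\ne\pm i$, and $G\simeq C_2^3$, generated by $\iota_1$, $\iota_2$ and $\tau\colon(x_1,x_2,x_3,x_4,x_5)\mapsto(x_1-ax_5,x_2-x_4,x_3,-x_4,-x_5)$; • $b=0$, $a=\pm i$, and $G\simeq C_2.\mathfrak{D}_4\simeq C_2^2\rtimes C_4$, generated by $\tau$, $\iota_2$ and $\sigma_2\colon(x_1,x_2,x_3,x_4,x_5)\mapsto(\mp x_2,\pm x_1,x_3,ix_5,ix_4)$. (In the second and fourth cases upper and lower signs correspond to those of $a$.)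
   Context: A node is an ordinary double point. $C_2.\mathfrak{D}_4$ denotes an extension of $\mathfrak{D}_4$ by $C_2$. *)

theory Defs
  imports
    "HOL-Analysis.Cartesian_Space"
    "HOL-Library.Poly_Mapping"
    "HOL-Computational_Algebra.Polynomial"
    "HOL-Algebra.Generated_Groups"
    "HOL-Algebra.Elementary_Groups"
    "HOL-Algebra.Bij"
begin

section \<open>Polynomials in the variables \<open>x\<^sub>i\<close>, \<open>i :: 'n\<close>\<close>

text \<open>A polynomial is a finitely supported map from exponent vectors to coefficients; the ring
  structure is the convolution product of \<^theory>\<open>HOL-Library.Poly_Mapping\<close>.\<close>

type_synonym ('n, 'k) polyn = "('n \<Rightarrow>\<^sub>0 nat) \<Rightarrow>\<^sub>0 'k"

definition Var :: "'n \<Rightarrow> ('n, 'k::comm_ring_1) polyn" where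
  "Var i = Poly_Mapping.single (Poly_Mapping.single i 1) 1"

definition Const :: "'k \<Rightarrow> ('n, 'k::comm_ring_1) polyn" where
  "Const c = Poly_Mapping.single 0 c"

definition eval_polyn :: "('n::finite, 'k::comm_ring_1) polyn \<Rightarrow> 'k ^ 'n \<Rightarrow> 'k" where
  "eval_polyn P v =
     (\<Sum>m \<in> Poly_Mapping.keys P. Poly_Mapping.lookup P m * (\<Prod>i\<in>UNIV. (v $ i) ^ Poly_Mapping.lookup m i))"

definition partial_deriv :: "'n \<Rightarrow> ('n, 'k::comm_ring_1) polyn \<Rightarrow> ('n, 'k) polyn" where
  "partial_deriv i P =
     (\<Sum>m \<in> Poly_Mapping.keys P.
        Poly_Mapping.single (m - Poly_Mapping.single i 1)
          (of_nat (Poly_Mapping.lookup m i) * Poly_Mapping.lookup P m))"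

definition homogeneous :: "nat \<Rightarrow> ('n::finite, 'k::comm_ring_1) polyn \<Rightarrow> bool" where
  "homogeneous d P \<longleftrightarrow>
     (\<forall>m \<in> Poly_Mapping.keys P. (\<Sum>i\<in>UNIV. Poly_Mapping.lookup m i) = d)"


section \<open>Projective space, hypersurfaces and nodes\<close>

text \<open>A point of projective space is the set of all its vectors of homogeneous coordinates, i.e. a
  line through the origin with the origin removed. Thus \<open>v \<in> p\<close> says that \<open>v\<close> is a vector of
  homogeneous coordinates of \<open>p\<close>.\<close>

definition proj_pt :: "'k::field ^ 'n \<Rightarrow> ('k ^ 'n) set" where
  "proj_pt v = {c *s v |c. c \<noteq> 0}"

definition proj_space :: "('k::field ^ 'n) set set" where
  "proj_space = {proj_pt v |v. v \<noteq> 0}"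

definition hypersurface :: "('n::finite, 'k::field) polyn \<Rightarrow> ('k ^ 'n) set set" where
  "hypersurface F = {p \<in> proj_space. \<forall>v\<in>p. eval_polyn F v = 0}"

definition singular_points :: "('n::finite, 'k::field) polyn \<Rightarrow> ('k ^ 'n) set set" where
  "singular_points F =
     {p \<in> hypersurface F. \<forall>v\<in>p. \<forall>i. eval_polyn (partial_deriv i F) v = 0}"

text \<open>A node (ordinary double point) is a singular point at which the local equation in an affine
  chart has nondegenerate Hessian. In the chart \<open>x\<^sub>j \<noteq> 0\<close> the Hessian of the dehomogenised
  equation is obtained from the matrix of second partial derivatives of \<open>F\<close> by deleting the row
  and the column with index \<open>j\<close>; the condition below says that this minor has trivial kernel.
  (The full matrix is always degenerate at a singular point, by Euler's formula.)\<close>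

definition is_node :: "('n::finite, 'k::field) polyn \<Rightarrow> ('k ^ 'n) set \<Rightarrow> bool" where
  "is_node F p \<longleftrightarrow> p \<in> singular_points F \<and>
     (\<exists>v\<in>p. \<exists>j. v $ j \<noteq> 0 \<and>
        (\<forall>w :: 'k ^ 'n. w $ j = 0 \<longrightarrow>
           (\<forall>l. l \<noteq> j \<longrightarrow> (\<Sum>i\<in>UNIV. eval_polyn (partial_deriv l (partial_deriv i F)) v * w $ i) = 0)
           \<longrightarrow> w = 0))"

definition nodal_with :: "('n::finite, 'k::field) polyn \<Rightarrow> nat \<Rightarrow> bool" where
  "nodal_with F n \<longleftrightarrow>
     finite (singular_points F) \<and> card (singular_points F) = n \<and> (\<forall>p \<in> singular_points F. is_node F p)"


section \<open>Regular maps and the automorphism group of a projective variety\<close>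

text \<open>A map is regular if, locally in the Zariski topology, it is given by homogeneous polynomials
  of one common degree without common zero. The neighbourhoods are taken among the basic open sets
  \<open>g \<noteq> 0\<close>. The base field is meant to be algebraically closed, so that varieties are identified
  with their sets of closed points.\<close>

definition regular_map ::
    "('k::field ^ 'n::finite) set set \<Rightarrow> ('k ^ 'm::finite) set set \<Rightarrow>
     (('k ^ 'n) set \<Rightarrow> ('k ^ 'm) set) \<Rightarrow> bool" where
  "regular_map X Y f \<longleftrightarrow> f \<in> X \<rightarrow> Y \<and>
     (\<forall>p\<in>X. \<exists>(g :: ('n, 'k) polyn) e (Q :: 'm \<Rightarrow> ('n, 'k) polyn) d.
        homogeneous e g \<and> (\<forall>i. homogeneous d (Q i)) \<and> (\<forall>v\<in>p. eval_polyn g v \<noteq> 0) \<and>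
        (\<forall>q\<in>X. \<forall>v\<in>q. eval_polyn g v \<noteq> 0 \<longrightarrow>
           (\<chi> i. eval_polyn (Q i) v) \<noteq> 0 \<and> f q = proj_pt (\<chi> i. eval_polyn (Q i) v)))"

definition aut_group ::
    "('k::field ^ 'n::finite) set set \<Rightarrow> (('k ^ 'n) set \<Rightarrow> ('k ^ 'n) set) monoid" where
  "aut_group X =
     BijGroup X \<lparr>carrier := {f \<in> Bij X. regular_map X X f \<and> regular_map X X (inv_into X f)}\<rparr>"

text \<open>The self-map of \<open>X\<close> induced by a map on homogeneous coordinates, extensional as required by
  \<^const>\<open>Bij\<close>. For linear \<open>A\<close> the image of a line under \<open>A\<close> is the set \<open>A ` p\<close>.\<close>

definition proj_map ::
    "('k::field ^ 'n) set set \<Rightarrow> ('k ^ 'n \<Rightarrow> 'k ^ 'n) \<Rightarrow> ('k ^ 'n) set \<Rightarrow> ('k ^ 'n) set" where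
  "proj_map X A = (\<lambda>p\<in>X. A ` p)"


section \<open>Some groups\<close>

abbreviation cyclic_grp :: "nat \<Rightarrow> int monoid" where
  "cyclic_grp n \<equiv> integer_mod_group n"

text \<open>The dihedral group of order \<open>2n\<close>: the pair \<open>(x, s)\<close> stands for the rotation \<open>r\<^sup>x\<close> if
  \<open>s\<close> is false, and for the reflection \<open>r\<^sup>x t\<close> otherwise, where \<open>t r = r\<^sup>-\<^sup>1 t\<close>.\<close>

definition dihedral_grp :: "nat \<Rightarrow> (int \<times> bool) monoid" where
  "dihedral_grp n =
     \<lparr>carrier = {0..<int n} \<times> UNIV,
      mult = (\<lambda>(x, s) (y, t). ((if s then x - y else x + y) mod int n, s \<noteq> t)),
      one = (0, False)\<rparr>"

text \<open>\<open>G\<close> is an extension of \<open>Q\<close> by \<open>N\<close>, written \<open>N.Q\<close>.\<close>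

definition is_extension ::
    "('a, 'x) monoid_scheme \<Rightarrow> ('b, 'y) monoid_scheme \<Rightarrow> ('c, 'z) monoid_scheme \<Rightarrow> bool" where
  "is_extension G N Q \<longleftrightarrow>
     (\<exists>K. K \<lhd> G \<and> G\<lparr>carrier := K\<rparr> \<cong> N \<and> G Mod K \<cong> Q)"

text \<open>\<open>G\<close> is a semidirect product of \<open>N\<close> (normal) and \<open>H\<close>, for some action of \<open>H\<close> on \<open>N\<close>.\<close>

definition is_semidirect_product ::
    "('a, 'x) monoid_scheme \<Rightarrow> ('b, 'y) monoid_scheme \<Rightarrow> ('c, 'z) monoid_scheme \<Rightarrow> bool" where
  "is_semidirect_product G N H \<longleftrightarrow>
     (\<exists>K L. K \<lhd> G \<and> subgroup L G \<and> K \<inter> L = {\<one>\<^bsub>G\<^esub>} \<and> K <#>\<^bsub>G\<^esub> L = carrier G \<and>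
        G\<lparr>carrier := K\<rparr> \<cong> N \<and> G\<lparr>carrier := L\<rparr> \<cong> H)"


section \<open>The cubic threefold and its automorphisms\<close>

text \<open>In the index type \<open>5\<close> the numeral \<open>5\<close> denotes the same index as \<open>0\<close>, and
  \<open>1, 2, 3, 4, 5\<close> are its five distinct elements. Accordingly
  \<open>vector [x\<^sub>1, \<dots>, x\<^sub>5] $ i = x\<^sub>i\<close> for \<open>i = 1, \<dots>, 5\<close>.\<close>

definition cubic_form :: "'k::field \<Rightarrow> 'k \<Rightarrow> (5, 'k) polyn" where
  "cubic_form a b =
     (Const a * Var 1 + Var 2 + Const b * Var 3) * Var 4 * Var 5
     + Var 4 * ((Var 3)\<^sup>2 - (Var 1)\<^sup>2) + Var 5 * ((Var 3)\<^sup>2 - (Var 2)\<^sup>2)"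

definition iota1 :: "'k::field \<Rightarrow> 'k ^ 5 \<Rightarrow> 'k ^ 5" where
  "iota1 a x = vector [a * x$5 - x$1, x$2, x$3, x$4, x$5]"

definition iota2 :: "'k::field ^ 5 \<Rightarrow> 'k ^ 5" where
  "iota2 x = vector [x$1, x$4 - x$2, x$3, x$4, x$5]"

definition tau :: "'k::field \<Rightarrow> 'k ^ 5 \<Rightarrow> 'k ^ 5" where
  "tau a x = vector [x$1 - a * x$5, x$2 - x$4, x$3, - x$4, - x$5]"

text \<open>In the next two maps \<open>s = 1\<close> gives the upper and \<open>s = -1\<close> the lower signs.\<close>

definition sigma1 :: "'k::field \<Rightarrow> 'k ^ 5 \<Rightarrow> 'k ^ 5" where
  "sigma1 s x = vector [s * x$2, x$5 - s * x$1, x$3, x$5, x$4]"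

definition sigma2 :: "'k::field \<Rightarrow> 'k \<Rightarrow> 'k ^ 5 \<Rightarrow> 'k ^ 5" where
  "sigma2 i s x = vector [- s * x$2, s * x$1, x$3, i * x$5, i * x$4]"

end

theory Submission
  imports Defs "HOL-Analysis.Determinants"
begin

text \<open>Let \<open>F\<close> be the cubic form. Automorphisms of \<open>X\<close> are shown to be linear without divisor theory. Near every point an automorphism has
  a polynomial lift \<open>Q\<close> to \<open>k\<^sup>5\<close> with \<open>F \<circ> Q = F G\<close>, which can be chosen so that \<open>G\<close> and \<open>det DQ\<close> do not vanish
  there. The quotient \<open>det DQ / G\<close> is the factor by which the residue form of \<open>F\<close> gets multiplied, and it
  transforms by \<open>u\<^sup>2\<close> when \<open>Q\<close> is multiplied by \<open>u\<close>; this is adjunction, \<open>f\<^sup>*K = K\<close> with \<open>K = O(-2)\<close>. Counting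
  zeros along a line on \<open>X\<close> shows that its image is again a line, mapped linearly. Hence the automorphism is
  linear on each of the five planes on \<open>X\<close>, and these linear maps glue to one matrix, which agrees with
  the automorphism at a general point because two lines on \<open>X\<close> through that point join points of the planes.
  A linear automorphism permutes the eight nodes, and the triples of nodes whose plane
  lies on \<open>X\<close> restrict this permutation so much that the matrix is monomial in suitable coordinates.\<close>

section \<open>Polynomial functions and their derivatives\<close>

text \<open>A regular map comes only with local formulas, of unrelated degrees and possibly
  vanishing away from the chosen point, so nothing bounds a degree in advance. The quotient
  \<open>det DQ / G\<close> supplies the bound: its transformation rule compares one formula, point
  by point, with others that are good there. At a singular point the identity for F(Q(x)) has to be
  read to second order, because its first-order terms vanish. At a smooth point \<open>G\<close> can
  be made nonzero by adding a multiple of \<open>F\<close> to the lift, and for this lifts are given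
  degree at least three.

  Having exactly eight nodes excludes b = +-(1 +- a), since each of these values creates a ninth
  singular point. The same quantities b +- a +- 1 are, up to factors, the polar form on certain
  triples of nodes; because they do not vanish, four of the 28 pairs of nodes are singled out: no
  third node spans with such a pair a plane on X. That rigidity controls the permutation of the
  nodes. For b = 0 the exclusion also removes a = +-1, so there a swap of coordinates forces a^2 =
  -1.\<close>

inductive poly_deriv ::
    "('k::field_char_0 ^ 'n::finite \<Rightarrow> 'k) \<Rightarrow> ('k ^ 'n \<Rightarrow> 'k ^ 'n \<Rightarrow> 'k) \<Rightarrow> bool" where
  pd_const: "poly_deriv (\<lambda>x. c) (\<lambda>x v. 0)"
| pd_coord: "poly_deriv (\<lambda>x. x $ i) (\<lambda>x v. v $ i)"
| pd_add: "poly_deriv f f' \<Longrightarrow> poly_deriv g g' \<Longrightarrow> poly_deriv (\<lambda>x. f x + g x) (\<lambda>x v. f' x v + g' x v)"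
| pd_mult: "poly_deriv f f' \<Longrightarrow> poly_deriv g g' \<Longrightarrow>
    poly_deriv (\<lambda>x. f x * g x) (\<lambda>x v. f x * g' x v + f' x v * g x)"

text \<open>Having a derivation for \<open>poly_deriv\<close> amounts to being built from constants
  and coordinates by sums and products. Functions can stand in for formal polynomials because the
  field is infinite, and each one brings its differential along.\<close>

definition poly_fun :: "('k::field_char_0 ^ 'n::finite \<Rightarrow> 'k) \<Rightarrow> bool" where
  "poly_fun f \<longleftrightarrow> (\<exists>f'. poly_deriv f f')"

lemma pf_const [simp, intro]: "poly_fun (\<lambda>x. c)"
  and pf_coord [simp, intro]: "poly_fun (\<lambda>x. x $ i)"
  and pf_add [intro]: "poly_fun f \<Longrightarrow> poly_fun g \<Longrightarrow> poly_fun (\<lambda>x. f x + g x)"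
  and pf_mult [intro]: "poly_fun f \<Longrightarrow> poly_fun g \<Longrightarrow> poly_fun (\<lambda>x. f x * g x)"
  unfolding poly_fun_def by (blast intro: poly_deriv.intros)+

lemma pf_uminus [intro]: "poly_fun f \<Longrightarrow> poly_fun (\<lambda>x. - f x)"
  using pf_mult[of "\<lambda>x. -1" f] by simp

lemma pf_diff [intro]: "poly_fun f \<Longrightarrow> poly_fun g \<Longrightarrow> poly_fun (\<lambda>x. f x - g x)"
  using pf_add[of f "\<lambda>x. - g x"] by auto

lemma pf_power [intro]: "poly_fun f \<Longrightarrow> poly_fun (\<lambda>x. f x ^ n)"
  by (induction n) auto

lemma pf_sum [intro]: "(\<And>i. i \<in> I \<Longrightarrow> poly_fun (f i)) \<Longrightarrow> poly_fun (\<lambda>x. \<Sum>i\<in>I. f i x)"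
  by (induction I rule: infinite_finite_induct) auto

lemma pf_prod [intro]: "(\<And>i. i \<in> I \<Longrightarrow> poly_fun (f i)) \<Longrightarrow> poly_fun (\<lambda>x. \<Prod>i\<in>I. f i x)"
  by (induction I rule: infinite_finite_induct) auto

lemma pd_poly_fun: "poly_deriv f f' \<Longrightarrow> poly_fun f"
  unfolding poly_fun_def by blast

lemmas pf_intros = pf_const pf_coord pf_sum pf_prod pf_diff pf_uminus pf_power pf_add pf_mult

lemma pf_induct [consumes 1, case_names const coord add mult]:
  assumes "poly_fun f" "\<And>c. P (\<lambda>x. c)" "\<And>i. P (\<lambda>x. x $ i)"
    "\<And>f g. poly_fun f \<Longrightarrow> poly_fun g \<Longrightarrow> P f \<Longrightarrow> P g \<Longrightarrow> P (\<lambda>x. f x + g x)"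
    "\<And>f g. poly_fun f \<Longrightarrow> poly_fun g \<Longrightarrow> P f \<Longrightarrow> P g \<Longrightarrow> P (\<lambda>x. f x * g x)"
  shows "P f"
proof -
  obtain f' where "poly_deriv f f'" using assms(1) unfolding poly_fun_def by blast
  then show ?thesis
    by induction (use assms(2-) in \<open>blast intro: pd_poly_fun\<close>)+
qed

lemma pd_deriv_poly_fun: "poly_deriv f f' \<Longrightarrow> poly_fun (\<lambda>x. f' x v)"
  by (induction rule: poly_deriv.induct) (auto intro!: pf_intros dest: pd_poly_fun)

lemma pd_linear_add: "poly_deriv f f' \<Longrightarrow> f' x (v + w) = f' x v + f' x w"
  by (induction rule: poly_deriv.induct) (auto simp: algebra_simps)

lemma pd_linear_scale: "poly_deriv f f' \<Longrightarrow> f' x (c *s v) = c * f' x v"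
  by (induction rule: poly_deriv.induct) (auto simp: algebra_simps)

lemma pd_linear_zero: "poly_deriv f f' \<Longrightarrow> f' x 0 = 0"
  using pd_linear_scale[of f f' x 0 0] by simp

lemma pd_linear_sum: "poly_deriv f f' \<Longrightarrow> f' x (\<Sum>i\<in>I. g i) = (\<Sum>i\<in>I. f' x (g i))"
  by (induction I rule: infinite_finite_induct) (auto simp: pd_linear_add pd_linear_zero)

lemma pd_linear_axis:
  assumes "poly_deriv f f'"
  shows "f' x v = (\<Sum>i\<in>UNIV. v $ i * f' x (axis i 1))"
proof -
  have "v = (\<Sum>i\<in>UNIV. v $ i *s axis i 1)"
    by (simp add: basis_expansion)
  then have "f' x v = f' x (\<Sum>i\<in>UNIV. v $ i *s axis i 1)" by simp
  then show ?thesis using assms by (simp add: pd_linear_sum pd_linear_scale)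
qed

lemma pd_compose:
  assumes "poly_deriv f f'" and Q: "\<And>i. poly_deriv (\<lambda>x. Q x $ i) (\<lambda>x v. Q' x v $ i)"
  shows "poly_deriv (\<lambda>x. f (Q x)) (\<lambda>x v. f' (Q x) (Q' x v))"
  using assms(1)
proof induction
  case (pd_coord i)
  then show ?case by (rule Q)
qed (auto intro: poly_deriv.intros)

lemma pf_compose:
  assumes "poly_fun f" "\<And>i. poly_fun (\<lambda>x. Q x $ i)"
  shows "poly_fun (\<lambda>x. f (Q x))"
  using assms by (induction rule: pf_induct) auto

lemma pf_linear [intro]: "poly_fun (\<lambda>x. (A *v x) $ i)"
  unfolding matrix_vector_mult_def vec_lambda_beta by (intro pf_intros)

lemma pf_curve:
  assumes "poly_fun f"
  obtains p where "\<And>t. poly p t = f (\<chi> i. poly (\<gamma> i) t)"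
proof -
  have "\<exists>p. \<forall>t. poly p t = f (\<chi> i. poly (\<gamma> i) t)"
    using assms
  proof (induction rule: pf_induct)
    case (const c) then show ?case by (intro exI[of _ "[:c:]"]) auto
  next
    case (coord i) then show ?case by (intro exI[of _ "\<gamma> i"]) auto
  next
    case (add f g)
    then obtain p q where "\<forall>t. poly p t = f (\<chi> i. poly (\<gamma> i) t)" "\<forall>t. poly q t = g (\<chi> i. poly (\<gamma> i) t)" by auto
    then show ?case by (intro exI[of _ "p + q"]) auto
  next
    case (mult f g)
    then obtain p q where "\<forall>t. poly p t = f (\<chi> i. poly (\<gamma> i) t)" "\<forall>t. poly q t = g (\<chi> i. poly (\<gamma> i) t)" by auto
    then show ?case by (intro exI[of _ "p * q"]) auto
  qed
  with that show ?thesis by blast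
qed

lemma pf_line:
  assumes "poly_fun f"
  obtains p where "\<And>t. poly p t = f (u + t *s v)"
proof -
  obtain p where p: "\<And>t. poly p t = f (\<chi> i. poly [:u $ i, v $ i:] t)"
    using pf_curve[OF assms, of "\<lambda>i. [:u $ i, v $ i:]"] by blast
  have "(\<chi> i. poly [:u $ i, v $ i:] t) = u + t *s v" for t
    by (simp add: vec_eq_iff)
  with p that show ?thesis by metis
qed

text \<open>Only the linear term is identified; the rest is packed into a polynomial in t. This
  suffices to recover \<open>f'\<close> as a coefficient, without any notion of limit.\<close>

lemma pd_taylor:
  assumes "poly_deriv f f'"
  obtains r where "\<And>t. f (u + t *s v) = f u + t * f' u v + t\<^sup>2 * poly r t"
proof -
  have "\<exists>r. \<forall>t. f (u + t *s v) = f u + t * f' u v + t\<^sup>2 * poly r t"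
    using assms
  proof induction
    case (pd_const c) then show ?case by (intro exI[of _ 0]) auto
  next
    case (pd_coord i) then show ?case by (intro exI[of _ 0]) auto
  next
    case (pd_add f f' g g')
    then obtain r s where "\<forall>t. f (u + t *s v) = f u + t * f' u v + t\<^sup>2 * poly r t"
      "\<forall>t. g (u + t *s v) = g u + t * g' u v + t\<^sup>2 * poly s t" by auto
    then show ?case by (intro exI[of _ "r + s"]) (auto simp: algebra_simps)
  next
    case (pd_mult f f' g g')
    then obtain r s where "\<forall>t. f (u + t *s v) = f u + t * f' u v + t\<^sup>2 * poly r t"
      "\<forall>t. g (u + t *s v) = g u + t * g' u v + t\<^sup>2 * poly s t" by auto
    then show ?case
      by (intro exI[of _ "[:f u:] * s + [:g u:] * r + [:f' u v * g' u v:] + [:0, f' u v:] * s + [:0, g' u v:] * r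
           + [:0, 0, 1:] * r * s"])
        (auto simp: algebra_simps power2_eq_square)
  qed
  with that show ?thesis by blast
qed

text \<open>The field is infinite, so finitely many parameters may be ignored. The set
  \<open>S\<close> serves to divide an identity by t or to stay away from zeros of auxiliary
  polynomials.\<close>

lemma poly_eqI_nonzero:
  fixes p q :: "'k::field_char_0 poly"
  assumes "finite S" "\<And>t. t \<notin> S \<Longrightarrow> poly p t = poly q t"
  shows "p = q"
proof (rule ccontr)
  assume "p \<noteq> q"
  then have "finite {t. poly (p - q) t = 0}" by (intro poly_roots_finite) auto
  moreover have "- S \<subseteq> {t. poly (p - q) t = 0}" using assms(2) by auto
  ultimately have "finite (- S)" by (rule finite_subset[rotated])
  then show False using assms(1) infinite_UNIV_char_0[where 'a='k]
    by (metis Compl_partition finite_Un)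
qed

text \<open>Equate the two Taylor expansions, cancel t and put t = 0. The main use is to
  differentiate one function by two different rules and compare the results.\<close>

lemma pd_unique:
  assumes "poly_deriv f f'" "poly_deriv f f''"
  shows "f' = f''"
proof (intro ext)
  fix u v
  obtain r where r: "\<And>t. f (u + t *s v) = f u + t * f' u v + t\<^sup>2 * poly r t" using pd_taylor[OF assms(1)] by blast
  obtain s where s: "\<And>t. f (u + t *s v) = f u + t * f'' u v + t\<^sup>2 * poly s t" using pd_taylor[OF assms(2)] by blast
  have "[:f' u v:] + [:0,1:] * r = [:f'' u v:] + [:0,1:] * s"
  proof (rule poly_eqI_nonzero[of "{0}"])
    fix t :: 'a assume t: "t \<notin> {0}"
    have "t * (f' u v + t * poly r t) = t * (f'' u v + t * poly s t)"
      using r[of t] s[of t] by (simp add: algebra_simps power2_eq_square)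
    with t show "poly ([:f' u v:] + [:0,1:] * r) t = poly ([:f'' u v:] + [:0,1:] * s) t" by simp
  qed auto
  then have "poly ([:f' u v:] + [:0,1:] * r) 0 = poly ([:f'' u v:] + [:0,1:] * s) 0" by simp
  then show "f' u v = f'' u v" by simp
qed

text \<open>On the line joining a nonzero of \<open>f\<close> to a nonzero of \<open>g\<close> both
  restrict to nonzero polynomials in t, and polynomials in one variable form a domain.\<close>

lemma pf_no_zero_divisors:
  assumes "poly_fun f" "poly_fun g" "\<And>x. f x * g x = 0"
  shows "(\<forall>x. f x = 0) \<or> (\<forall>x. g x = 0)"
proof (rule ccontr)
  assume "\<not> ?thesis"
  then obtain x y where xy: "f x \<noteq> 0" "g y \<noteq> 0" by blast
  obtain p where p: "\<And>t. poly p t = f (x + t *s (y - x))" using pf_line[OF assms(1)] by blast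
  obtain q where q: "\<And>t. poly q t = g (x + t *s (y - x))" using pf_line[OF assms(2)] by blast
  have "p * q = 0" by (rule poly_eqI_nonzero[of "{}"]) (auto simp: p q assms(3))
  moreover have "p \<noteq> 0" using p[of 0] xy by auto
  moreover have "q \<noteq> 0" using q[of 1] xy by auto
  ultimately show False by simp
qed

section \<open>Division by a polynomial that is linear in one variable\<close>

definition indep :: "'n \<Rightarrow> ('k ^ 'n \<Rightarrow> 'k) \<Rightarrow> bool" where
  "indep i f \<longleftrightarrow> (\<forall>x y. (\<forall>j. j \<noteq> i \<longrightarrow> x $ j = y $ j) \<longrightarrow> f x = f y)"

lemma indepD: "indep i f \<Longrightarrow> (\<And>j. j \<noteq> i \<Longrightarrow> x $ j = y $ j) \<Longrightarrow> f x = f y"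
  unfolding indep_def by blast

text \<open>Modulo \<alpha> x_i + \<beta> the variable x_i equals -\<beta>/\<alpha>; a power of
  \<alpha> clears denominators and the remainder is free of x_i. As the divisor is linear, the
  induction runs over sums and products with no degree to track.\<close>

lemma pf_pseudo_division:
  assumes "poly_fun f" and \<alpha>: "poly_fun \<alpha>" "indep i \<alpha>" and \<beta>: "poly_fun \<beta>" "indep i \<beta>"
  obtains N A B where "poly_fun A" "poly_fun B" "indep i B"
    "\<And>x. \<alpha> x ^ N * f x = A x * (\<alpha> x * x $ i + \<beta> x) + B x"
proof -
  have "\<exists>N A B. poly_fun A \<and> poly_fun B \<and> indep i B \<and>
      (\<forall>x. \<alpha> x ^ N * f x = A x * (\<alpha> x * x $ i + \<beta> x) + B x)"
    using assms(1)
  proof (induction rule: pf_induct)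
    case (const c)
    show ?case by (intro exI[of _ 0] exI[of _ "\<lambda>x. 0"] exI[of _ "\<lambda>x. c"]) (auto simp: indep_def)
  next
    case (coord j)
    show ?case
    proof (cases "j = i")
      case True
      have "poly_fun (\<lambda>x. - \<beta> x)" "indep i (\<lambda>x. - \<beta> x)" using \<beta> by (auto simp: indep_def)
      then show ?thesis
        by (intro exI[of _ 1] exI[of _ "\<lambda>x. 1"] exI[of _ "\<lambda>x. - \<beta> x"]) (auto simp: True)
    next
      case False
      then show ?thesis
        by (intro exI[of _ 0] exI[of _ "\<lambda>x. 0"] exI[of _ "\<lambda>x. x $ j"]) (auto simp: indep_def)
    qed
  next
    case (add f g)
    then obtain N A B M C D where *: "poly_fun A" "poly_fun B" "indep i B" "poly_fun C" "poly_fun D" "indep i D"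
      "\<And>x. \<alpha> x ^ N * f x = A x * (\<alpha> x * x $ i + \<beta> x) + B x"
      "\<And>x. \<alpha> x ^ M * g x = C x * (\<alpha> x * x $ i + \<beta> x) + D x" by metis
    have e: "\<alpha> x ^ (N + M) * (f x + g x) = \<alpha> x ^ M * (\<alpha> x ^ N * f x) + \<alpha> x ^ N * (\<alpha> x ^ M * g x)" for x
      by (simp add: algebra_simps power_add)
    have "poly_fun (\<lambda>x. \<alpha> x ^ M * A x + \<alpha> x ^ N * C x)" "poly_fun (\<lambda>x. \<alpha> x ^ M * B x + \<alpha> x ^ N * D x)"
      using * \<alpha> by (auto intro!: pf_intros)
    moreover have "indep i (\<lambda>x. \<alpha> x ^ M * B x + \<alpha> x ^ N * D x)"
      using *(3,6) \<alpha>(2) unfolding indep_def by (metis (no_types, lifting))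
    moreover have "\<alpha> x ^ (N + M) * (f x + g x) =
      (\<alpha> x ^ M * A x + \<alpha> x ^ N * C x) * (\<alpha> x * x $ i + \<beta> x) + (\<alpha> x ^ M * B x + \<alpha> x ^ N * D x)" for x
      unfolding e * by (simp add: algebra_simps)
    ultimately show ?case by blast
  next
    case (mult f g)
    then obtain N A B M C D where *: "poly_fun A" "poly_fun B" "indep i B" "poly_fun C" "poly_fun D" "indep i D"
      "\<And>x. \<alpha> x ^ N * f x = A x * (\<alpha> x * x $ i + \<beta> x) + B x"
      "\<And>x. \<alpha> x ^ M * g x = C x * (\<alpha> x * x $ i + \<beta> x) + D x" by metis
    have e: "\<alpha> x ^ (N + M) * (f x * g x) = (\<alpha> x ^ N * f x) * (\<alpha> x ^ M * g x)" for x
      by (simp add: algebra_simps power_add)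
    have "poly_fun (\<lambda>x. A x * C x * (\<alpha> x * x $ i + \<beta> x) + A x * D x + B x * C x)"
      using * \<alpha> \<beta> by (intro pf_intros)
    moreover have "poly_fun (\<lambda>x. B x * D x)" "indep i (\<lambda>x. B x * D x)"
      using *(2,3,5,6) by (auto intro!: pf_intros simp: indep_def) metis
    moreover have "\<alpha> x ^ (N + M) * (f x * g x) =
       (A x * C x * (\<alpha> x * x $ i + \<beta> x) + A x * D x + B x * C x) * (\<alpha> x * x $ i + \<beta> x) + B x * D x" for x
      unfolding e * by (simp add: algebra_simps)
    ultimately show ?case by blast
  qed
  with that show ?thesis by metis
qed

lemma pf_coord_division:
  assumes "poly_fun f"
  obtains A B where "poly_fun A" "poly_fun B" "indep i B" "\<And>x. f x = A x * x $ i + B x"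
proof -
  obtain N A B where "poly_fun A" "poly_fun B" "indep i B"
    "\<And>x. 1 ^ N * f x = A x * (1 * x $ i + 0) + B x"
    using pf_pseudo_division[OF assms, of "\<lambda>x. 1" i "\<lambda>x. 0"] by (auto simp: indep_def)
  then show ?thesis using that by simp
qed

section \<open>Homogeneous polynomial functions\<close>

definition homog :: "nat \<Rightarrow> ('k::field ^ 'n \<Rightarrow> 'k) \<Rightarrow> bool" where
  "homog d f \<longleftrightarrow> (\<forall>c x. c \<noteq> 0 \<longrightarrow> f (c *s x) = c ^ d * f x)"

lemma homogD: "homog d f \<Longrightarrow> c \<noteq> 0 \<Longrightarrow> f (c *s x) = c ^ d * f x"
  unfolding homog_def by blast

text \<open>Differentiate f((1 + t) x) = (1 + t)^d f(x) at t = 0. The value t = -1 is excluded since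
  \<open>homog\<close> speaks of nonzero scalars only.\<close>

lemma pd_euler:
  assumes "poly_deriv f f'" "homog d f"
  shows "f' x x = of_nat d * f x"
proof -
  obtain r where r: "\<And>t. f (x + t *s x) = f x + t * f' x x + t\<^sup>2 * poly r t" using pd_taylor[OF assms(1)] by blast
  have "f (x + t *s x) = (1 + t) ^ d * f x" if "t \<noteq> -1" for t
  proof -
    have "x + t *s x = (1 + t) *s x" by (simp add: algebra_simps)
    moreover have "1 + t \<noteq> 0" using that by (metis add.commute add.right_inverse add_left_cancel)
    ultimately show ?thesis using homogD[OF assms(2)] by simp
  qed
  then have "[:1, 1:] ^ d * [:f x:] = [:f x, f' x x:] + [:0,0,1:] * r"
    by (intro poly_eqI_nonzero[of "{-1}"]) (auto simp: r power2_eq_square algebra_simps poly_power)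
  then have "poly (pderiv ([:1, 1:] ^ d * [:f x:])) 0 = poly (pderiv ([:f x, f' x x:] + [:0,0,1:] * r)) 0" by simp
  then show ?thesis
    by (cases d) (simp_all add: pderiv_mult pderiv_smult pderiv_power_Suc pderiv_add pderiv_pCons poly_power mult.commute del: power_Suc)
qed

text \<open>Expand both sides of f(cx + ctv) = c^(d+1) f(x + tv) in t; the coefficients of t agree,
  and one factor c cancels.\<close>

lemma homog_deriv:
  assumes "poly_deriv f f'" "homog (Suc d) f"
  shows "homog d (\<lambda>x. f' x v)"
  unfolding homog_def
proof (intro allI impI)
  fix c :: 'a and x assume c: "c \<noteq> 0"
  obtain r where r: "\<And>t. f (c *s x + t *s v) = f (c *s x) + t * f' (c *s x) v + t\<^sup>2 * poly r t"
    using pd_taylor[OF assms(1)] by blast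
  obtain s where s: "\<And>t. f (x + t *s v) = f x + t * f' x v + t\<^sup>2 * poly s t"
    using pd_taylor[OF assms(1)] by blast
  have "f (c *s x + (c * t) *s v) = c ^ Suc d * f (x + t *s v)" for t
  proof -
    have "c *s x + (c * t) *s v = c *s (x + t *s v)" by (simp add: vec.scale_right_distrib)
    then show ?thesis using homogD[OF assms(2) c] by metis
  qed
  moreover have "f (c *s x) = c ^ Suc d * f x" using homogD[OF assms(2) c] .
  ultimately have *: "c * t * f' (c *s x) v + (c * t)\<^sup>2 * poly r (c * t) = c ^ Suc d * (t * f' x v + t\<^sup>2 * poly s t)" for t
    unfolding r s by (metis (no_types, lifting) add.assoc add_left_cancel distrib_left)
  have "[:f' (c *s x) v:] + [:0, c:] * pcompose r [:0, c:] = [:c ^ d:] * ([:f' x v:] + [:0, 1:] * s)"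
  proof (rule poly_eqI_nonzero[of "{0}"])
    fix t :: 'a assume "t \<notin> {0}"
    then have t: "c * t \<noteq> 0" using c by auto
    have "c * t * (f' (c *s x) v + c * t * poly r (c * t)) = c * t * (c ^ d * (f' x v + t * poly s t))"
      using *[of t] by (simp add: algebra_simps power2_eq_square)
    then have "f' (c *s x) v + c * t * poly r (c * t) = c ^ d * (f' x v + t * poly s t)"
      using t by simp
    then show "poly ([:f' (c *s x) v:] + [:0, c:] * pcompose r [:0, c:]) t = poly ([:c ^ d:] * ([:f' x v:] + [:0, 1:] * s)) t"
      by (simp add: poly_pcompose algebra_simps)
  qed auto
  then have "poly ([:f' (c *s x) v:] + [:0, c:] * pcompose r [:0, c:]) 0 = poly ([:c ^ d:] * ([:f' x v:] + [:0, 1:] * s)) 0" by simp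
  then show "f' (c *s x) v = c ^ d * f' x v" by simp
qed

text \<open>The restriction to \<open>v + s *s u\<close>, with coefficients reversed, gives
  \<open>p\<close>. The coefficient in degree \<open>d\<close> records the value at
  \<open>v\<close>, the point at infinity of the line, so zeros on the whole projective line can be
  counted by degrees.\<close>

lemma homog_line_degree:
  assumes "poly_fun f" "homog d f" and p: "\<And>t. poly p t = f (u + t *s v)"
  shows "degree p \<le> d" "coeff p d = f v"
proof -
  obtain q where q: "\<And>s. poly q s = f (v + s *s u)" using pf_line[OF assms(1)] by blast
  have *: "poly p t = t ^ d * poly q (inverse t)" if "t \<noteq> 0" for t
  proof -
    have "u + t *s v = t *s (v + inverse t *s u)" using that by (simp add: vec.scale_right_distrib)
    then show ?thesis using homogD[OF assms(2) that] p q by metis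
  qed
  \<comment> \<open>\<open>reflect_poly\<close> reverses with respect to the actual degree of
    \<open>q\<close>, which may differ from \<open>d\<close>; the two monomials make up for the
    difference.\<close>
  have "p * monom 1 (degree q) = monom 1 d * reflect_poly q"
  proof (rule poly_eqI_nonzero[of "{0}"])
    fix t :: 'a assume "t \<notin> {0}"
    then have t: "t \<noteq> 0" by auto
    then show "poly (p * monom 1 (degree q)) t = poly (monom 1 d * reflect_poly q) t"
      by (simp add: * poly_monom poly_reflect_poly_nz)
  qed auto
  then have c: "coeff (monom 1 (degree q) * p) k = coeff (monom 1 d * reflect_poly q) k" for k
    by (simp add: mult.commute)
  have "coeff p n = coeff (reflect_poly q) (n + degree q - d)" if "n + degree q \<ge> d" for n
    using c[of "n + degree q"] that by (simp add: coeff_monom_mult)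
  note cp = this
  show "coeff p d = f v" using cp[of d] q[of 0] by (simp add: coeff_reflect_poly poly_0_coeff_0)
  show "degree p \<le> d"
  proof (rule degree_le, intro allI impI)
    fix n assume "n > d"
    then have "n + degree q - d > degree q" by auto
    then show "coeff p n = 0" using cp[of n] \<open>n > d\<close> by (simp add: coeff_reflect_poly)
  qed
qed

section \<open>Determinants of rank-one perturbations\<close>

definition dot :: "'k::comm_ring_1 ^ 'n::finite \<Rightarrow> 'k ^ 'n \<Rightarrow> 'k" where
  "dot x y = (\<Sum>i\<in>UNIV. x $ i * y $ i)"

definition outer :: "'k::comm_ring_1 ^ 'n \<Rightarrow> 'k ^ 'm \<Rightarrow> 'k ^ 'm ^ 'n" where
  "outer x y = (\<chi> i j. x $ i * y $ j)"

lemma dot_add_right: "dot x (y + z) = dot x y + dot x z"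
  and dot_scale_right: "dot x (c *s y) = c * dot x y"
  and dot_diff_right: "dot x (y - z) = dot x y - dot x z"
  by (simp_all add: dot_def algebra_simps sum.distrib sum_distrib_left sum_subtractf)

lemma dot_axis: "dot x (axis i 1) = x $ i"
  by (simp add: dot_def axis_def if_distrib cong: if_cong)

lemma outer_mult_vec: "outer x y *v z = dot y z *s x"
  by (simp add: outer_def dot_def matrix_vector_mult_def vec_eq_iff sum_distrib_left sum_distrib_right mult_ac)

lemma mat_mult_vec: "mat c *v (z :: 'k::comm_ring_1 ^ 'n::finite) = c *s z"
  by (simp add: mat_def matrix_vector_mult_def vec_eq_iff if_distrib if_distribR cong: if_cong)

lemma mult_axis: "(A *v axis k 1) $ i = (A $ i $ k :: 'k::comm_ring_1)"
  by (simp add: matrix_vector_mult_def axis_def if_distrib cong: if_cong)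

lemma det_mat: "det (mat c :: 'k::comm_ring_1 ^ 'n ^ 'n) = c ^ CARD('n)"
  by (subst det_diagonal) (auto simp: mat_def)

text \<open>Let \<open>S\<close> be the identity with column \<open>k\<close> replaced by
  \<open>x\<close>. It carries an axis vector to \<open>x\<close>, so conjugation by
  \<open>S\<close> yields a perturbation of a single row, whose determinant follows from Cramer's
  rule.\<close>

lemma det_one_plus_outer:
  fixes x y :: "'k::field ^ 'n::finite"
  shows "det (mat 1 + outer x y) = 1 + dot y x"
proof (cases "x = 0")
  case True
  then have "outer x y = 0" by (simp add: outer_def vec_eq_iff)
  with True show ?thesis by (simp add: dot_def)
next
  case False
  then obtain k where k: "x $ k \<noteq> 0" by (auto simp: vec_eq_iff)
  have cl: "det (\<chi> i j. if j = k then z $ i else (mat 1 :: 'k ^ 'n ^ 'n) $ i $ j) = z $ k" for z :: "'k ^ 'n"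
    using cramer_lemma[of k "mat 1 :: 'k ^ 'n ^ 'n" z, unfolded matrix_vector_mul_lid] by simp
  define S :: "'k ^ 'n ^ 'n" where "S = (\<chi> i j. if j = k then x $ i else mat 1 $ i $ j)"
  have detS: "det S = x $ k" unfolding S_def by (rule cl)
  define z where "z = transpose S *v y"
  have Sk: "S *v axis k 1 = x"
    by (simp add: S_def vec_eq_iff mult_axis)
  have zk: "z $ k = dot y x"
    by (simp add: z_def S_def transpose_def matrix_vector_mult_def dot_def mult.commute)
  have dz: "dot z v = dot y (S *v v)" for v
    unfolding z_def dot_def matrix_vector_mult_def transpose_def
    by (simp add: sum_distrib_left sum_distrib_right) (subst sum.swap, simp add: mult_ac)
  have "(mat 1 + outer x y) ** S = S ** (mat 1 + outer (axis k 1) z)"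
    by (simp add: matrix_eq matrix_vector_mul_assoc[symmetric] matrix_vector_mult_add_rdistrib
        outer_mult_vec matrix_vector_right_distrib vec.scale Sk dz mat_mult_vec)
  then have "det (mat 1 + outer x y) * det S = det S * det (mat 1 + outer (axis k 1) z)"
    by (metis det_mul)
  moreover have "det (mat 1 + outer (axis k 1) z) = 1 + z $ k"
  proof -
    have "transpose (mat 1 + outer (axis k 1) z) = (\<chi> i j. if j = k then (axis k 1 + z) $ i else mat 1 $ i $ j)"
      by (auto simp: transpose_def vec_eq_iff outer_def mat_def axis_def)
    then have "det (transpose (mat 1 + outer (axis k 1) z)) = (axis k 1 + z) $ k" by (simp only: cl)
    then show ?thesis by (simp add: axis_def)
  qed
  ultimately show ?thesis using k by (simp add: detS zk)
qed

text \<open>In coordinates, this compares the pullbacks of the residue form of a cubic by two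
  proportional lifts of one map.\<close>

lemma det_cocycle:
  fixes M N :: "'k::field ^ 5 ^ 5"
  assumes M: "det M \<noteq> 0" and nz: "u \<noteq> 0" "d \<noteq> 0" "e \<noteq> 0" "y \<noteq> 0"
    and N: "\<And>z. N *v z = u *s (M *v z) + dot \<alpha> z *s y + dot \<phi> z *s w"
    and p: "M *v p = d *s y" "N *v p = (e * u) *s y" "dot \<phi> p = 0"
    and \<eta>: "\<And>z. dot \<eta> (M *v z) = G * dot \<phi> z" "\<And>z. u\<^sup>2 * dot \<eta> (N *v z) = H * dot \<phi> z"
      "dot \<eta> y = 0" and \<phi>: "\<phi> \<noteq> 0"
  shows "d * G * det N = e * u\<^sup>2 * H * det M"
proof -
  obtain w' where w': "M *v w' = w"
    using M by (metis invertible_det_nz invertible_def matrix_vector_mul_assoc matrix_vector_mul_lid)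
  have "(u * d + dot \<alpha> p) *s y = (e * u) *s y"
    using N[of p] p by (simp add: vec.scale_left_distrib)
  then have "u * d + dot \<alpha> p = e * u"
    using nz(4) by (metis vector_mul_rcancel)
  then have \<alpha>p: "dot \<alpha> p = (e - d) * u"
    by (simp add: algebra_simps add_eq_conv_diff)
  \<comment> \<open>\<open>z\<close> solves u z + (\<alpha>(z)/d) p = w', explicitly so because
    \<alpha>(p) = (e - d) u. With it \<open>N\<close> splits into \<open>M\<close>, a scalar matrix
    and two rank-one perturbations of the identity.\<close>
  define z where "z = (1 / u) *s w' - (dot \<alpha> w' / (e * u\<^sup>2)) *s p"
  have \<alpha>z: "dot \<alpha> z = d * dot \<alpha> w' / (e * u)"
    unfolding z_def using nz
    by (simp add: dot_diff_right dot_scale_right \<alpha>p field_simps power2_eq_square)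
  have uz: "u *s z + (dot \<alpha> z / d) *s p = w'"
    unfolding \<alpha>z using nz by (simp add: z_def vec_eq_iff field_simps power2_eq_square)
  have My: "M *v p = d *s y" by (rule p)
  have "N = M ** (mat u ** ((mat 1 + outer ((1 / (u * d)) *s p) \<alpha>) ** (mat 1 + outer z \<phi>)))"
  proof -
    have "N *v x = M *v (u *s ((x + dot \<phi> x *s z) + dot \<alpha> (x + dot \<phi> x *s z) *s ((1 / (u * d)) *s p)))" for x
    proof -
      have "u *s ((x + dot \<phi> x *s z) + dot \<alpha> (x + dot \<phi> x *s z) *s ((1 / (u * d)) *s p))
         = u *s x + (dot \<alpha> x / d) *s p + dot \<phi> x *s (u *s z + (dot \<alpha> z / d) *s p)"
        using nz by (simp add: dot_add_right dot_scale_right vec_eq_iff field_simps)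
      then show ?thesis unfolding uz
        using nz by (simp add: N matrix_vector_right_distrib vec.scale w' My)
    qed
    then show ?thesis
      by (simp add: matrix_eq matrix_vector_mul_assoc[symmetric] matrix_vector_mult_add_rdistrib outer_mult_vec mat_mult_vec)
  qed
  then have detN: "det N = det M * (u ^ 5 * ((1 + dot \<alpha> ((1 / (u * d)) *s p)) * (1 + dot \<phi> z)))"
    by (simp add: det_mul det_one_plus_outer det_mat)
  have f1: "1 + dot \<alpha> ((1 / (u * d)) *s p) = e / d"
    using nz by (simp add: dot_scale_right \<alpha>p field_simps)
  have f2: "dot \<phi> w' = u * dot \<phi> z"
    unfolding uz[symmetric] by (simp add: dot_add_right dot_scale_right p)
  \<comment> \<open>Applying \<eta> to the formula for \<open>N\<close> removes the term along
    \<open>y\<close> and turns the one along \<open>w\<close> into G \<phi>(w'). Both sides are then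
    multiples of \<phi>, and a nonzero coordinate of \<phi> lets the factors be compared.\<close>
  have H: "H = u\<^sup>2 * G * (u + dot \<phi> w')"
  proof -
    obtain i where i: "\<phi> $ i \<noteq> 0" using \<phi> by (auto simp: vec_eq_iff)
    have "H * dot \<phi> x = u\<^sup>2 * G * (u + dot \<phi> w') * dot \<phi> x" for x
      using \<eta>(1)[of w'] unfolding \<eta>(2)[symmetric] N
      by (simp add: dot_add_right dot_scale_right \<eta> w' algebra_simps)
    from this[of "axis i 1"] show ?thesis using i by (simp add: dot_axis)
  qed
  have "d * G * det N = (d * (e / d)) * (G * (det M * (u ^ 5 * (1 + dot \<phi> z))))"
    unfolding detN f1 by (simp only: mult_ac)
  also have "d * (e / d) = e" using nz by simp
  finally show ?thesis unfolding H f2 by algebra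
qed

section \<open>Polynomials in one variable\<close>

text \<open>Common roots are split off one at a time; the degree of the nonzero entry
  \<open>W j\<close> drops at each step, so this ends.\<close>

lemma poly_vector_content:
  fixes W :: "'i \<Rightarrow> 'k::field poly"
  assumes "W j \<noteq> 0"
  obtains h \<psi> where "h \<noteq> 0" "\<And>i. W i = h * \<psi> i" "\<And>t. \<exists>i. poly (\<psi> i) t \<noteq> 0"
proof -
  have "\<exists>h \<psi>. h \<noteq> 0 \<and> (\<forall>i. W i = h * \<psi> i) \<and> (\<forall>t. \<exists>i. poly (\<psi> i) t \<noteq> 0)"
    using assms
  proof (induction "degree (W j)" arbitrary: W rule: less_induct)
    case less
    show ?case
    proof (cases "\<forall>t. \<exists>i. poly (W i) t \<noteq> 0")
      case True
      then show ?thesis by (intro exI[of _ 1] exI[of _ W]) auto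
    next
      case False
      then obtain t where "\<And>i. [:-t, 1:] dvd W i" by (auto simp: poly_eq_0_iff_dvd)
      then obtain V where V: "\<And>i. W i = [:-t, 1:] * V i" unfolding dvd_def by metis
      have Vj: "V j \<noteq> 0" using V[of j] less.prems by auto
      have "degree (W j) = Suc (degree (V j))" unfolding V[of j] using Vj by (subst degree_mult_eq) auto
      with less.hyps[of V] Vj obtain h \<psi> where
        h: "h \<noteq> 0" "\<And>i. V i = h * \<psi> i" "\<And>t. \<exists>i. poly (\<psi> i) t \<noteq> 0" by auto
      then show ?thesis
        by (intro exI[of _ "[:-t, 1:] * h"] exI[of _ \<psi>]) (auto simp: V mult.assoc simp del: mult_pCons_left)
    qed
  qed
  with that show ?thesis by metis
qed

text \<open>Over an algebraically closed field the degree is the sum of the multiplicities: a root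
  of one polynomial is a root of the other and is cancelled from both.\<close>

lemma degree_eq_of_order_eq:
  fixes p q :: "'k::alg_closed_field poly"
  assumes "p \<noteq> 0" "q \<noteq> 0" "\<And>t. Polynomial.order t p = Polynomial.order t q"
  shows "degree p = degree q"
  using assms
proof (induction "degree p" arbitrary: p q)
  case 0
  have "degree q = 0"
  proof (rule ccontr)
    assume "degree q \<noteq> 0"
    then obtain t where "poly q t = 0" using alg_closed_imp_poly_has_root[of q] by auto
    then have "Polynomial.order t p \<noteq> 0" using 0 by (simp add: order_root)
    then have "poly p t = 0" using 0 by (simp add: order_root)
    moreover obtain c where "p = [:c:]" using 0 by (metis degree_eq_zeroE)
    ultimately show False using 0 by auto
  qed
  with 0 show ?case by simp
next
  case (Suc n)
  then obtain t where t: "poly p t = 0" using alg_closed_imp_poly_has_root[of p] by auto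
  then have "poly q t = 0" using Suc.prems by (metis order_root)
  with t obtain p' q' where pq: "p = [:-t, 1:] * p'" "q = [:-t, 1:] * q'"
    by (auto simp: poly_eq_0_iff_dvd dvd_def)
  have nz: "p' \<noteq> 0" "q' \<noteq> 0" using Suc.prems pq by auto
  have "Polynomial.order s p' = Polynomial.order s q'" for s
    using Suc.prems(3)[of s] Suc.prems(1,2) unfolding pq by (simp add: order_mult del: mult_pCons_left)
  moreover have "degree p = Suc (degree p')" "degree q = Suc (degree q')"
    unfolding pq using nz by (subst degree_mult_eq; simp)+
  ultimately show ?case using Suc.hyps(1)[of p' q'] Suc.hyps(2) nz by simp
qed

section \<open>Lifts of morphisms and their Jacobians\<close>

lemma pd_uminus: "poly_deriv f f' \<Longrightarrow> poly_deriv (\<lambda>x. - f x) (\<lambda>x v. - f' x v)"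
  using pd_mult[OF pd_const[of "-1"], of f f'] by simp

lemma pd_diff:
  "poly_deriv f f' \<Longrightarrow> poly_deriv g g' \<Longrightarrow> poly_deriv (\<lambda>x. f x - g x) (\<lambda>x v. f' x v - g' x v)"
  using pd_add[of f f' "\<lambda>x. - g x" "\<lambda>x v. - g' x v"] by (simp add: pd_uminus)

definition vec_deriv ::
    "('k::field_char_0 ^ 'n::finite \<Rightarrow> 'k ^ 'm) \<Rightarrow> ('k ^ 'n \<Rightarrow> 'k ^ 'n \<Rightarrow> 'k ^ 'm) \<Rightarrow> bool" where
  "vec_deriv Q Q' \<longleftrightarrow> (\<forall>i. poly_deriv (\<lambda>x. Q x $ i) (\<lambda>x v. Q' x v $ i))"

lemma vec_derivD: "vec_deriv Q Q' \<Longrightarrow> poly_deriv (\<lambda>x. Q x $ i) (\<lambda>x v. Q' x v $ i)"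
  unfolding vec_deriv_def by blast

lemma vec_deriv_exists:
  assumes "\<And>i. poly_fun (\<lambda>x. Q x $ i)"
  obtains Q' where "vec_deriv Q Q'"
proof -
  obtain D where "\<And>i. poly_deriv (\<lambda>x. Q x $ i) (D i)" using assms unfolding poly_fun_def by metis
  then have "vec_deriv Q (\<lambda>x v. \<chi> i. D i x v)" by (simp add: vec_deriv_def)
  with that show ?thesis .
qed

definition jac :: "('k::field_char_0 ^ 'n \<Rightarrow> 'k ^ 'n \<Rightarrow> 'k ^ 'm) \<Rightarrow> 'k ^ 'n \<Rightarrow> 'k ^ 'n ^ 'm" where
  "jac Q' x = (\<chi> i j. Q' x (axis j 1) $ i)"

lemma jac_mult_vec:
  assumes "vec_deriv Q Q'"
  shows "jac Q' x *v v = Q' x v"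
proof (rule vec_eq_iff[THEN iffD2], rule allI)
  show "(jac Q' x *v v) $ i = Q' x v $ i" for i
    by (subst pd_linear_axis[OF vec_derivD[OF assms]]) (simp add: jac_def matrix_vector_mult_def mult.commute)
qed

lemma jac_entry_poly_fun: "vec_deriv Q Q' \<Longrightarrow> poly_fun (\<lambda>x. jac Q' x $ i $ j)"
  unfolding jac_def using pd_deriv_poly_fun[OF vec_derivD] by simp

lemma det_jac_poly_fun: "vec_deriv Q Q' \<Longrightarrow> poly_fun (\<lambda>x. det (jac Q' x))"
  unfolding det_def by (intro pf_intros jac_entry_poly_fun)

lemma det_jac_homog:
  assumes "vec_deriv Q Q'" "\<And>i. homog (Suc d) (\<lambda>x. Q x $ i)"
  shows "homog (CARD('n) * d) (\<lambda>x. det (jac Q' x :: 'k::field_char_0 ^ 'n ^ 'n))"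
  unfolding homog_def
proof (intro allI impI)
  fix c :: 'k and x assume c: "c \<noteq> 0"
  have "jac Q' (c *s x) $ i $ j = c ^ d * jac Q' x $ i $ j" for i j
    unfolding jac_def vec_lambda_beta
    using homogD[OF homog_deriv[OF vec_derivD[OF assms(1)] assms(2)] c] .
  then have "jac Q' (c *s x) = mat (c ^ d) ** jac Q' x"
    by (simp add: matrix_eq matrix_vector_mul_assoc[symmetric] mat_mult_vec)
      (simp add: matrix_vector_mult_def vec_eq_iff sum_distrib_left mult.assoc)
  then show "det (jac Q' (c *s x)) = c ^ (CARD('n) * d) * det (jac Q' x)"
    by (simp add: det_mul det_mat power_mult[symmetric] mult.commute[of d])
qed

lemma vec_euler:
  assumes "vec_deriv Q Q'" "\<And>i. homog d (\<lambda>x. Q x $ i)"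
  shows "Q' x x = of_nat d *s Q x"
  using pd_euler[OF vec_derivD[OF assms(1)] assms(2)] by (simp add: vec_eq_iff)

lemma det_nonzero_of_inj:
  fixes A :: "'k::field ^ 'n ^ 'n"
  assumes "\<And>z. A *v z = 0 \<Longrightarrow> z = 0"
  shows "det A \<noteq> 0"
  using assms unfolding invertible_det_nz[symmetric] invertible_left_inverse matrix_left_invertible_ker by blast

lemma surj_of_det_nonzero:
  fixes A :: "'k::field ^ 'n ^ 'n"
  assumes "det A \<noteq> 0"
  obtains z where "A *v z = y"
  using assms by (metis invertible_det_nz invertible_def matrix_vector_mul_assoc matrix_vector_mul_lid)

lemma proj_pt_eq_iff: "proj_pt x = proj_pt y \<longleftrightarrow> (\<exists>c. c \<noteq> 0 \<and> y = c *s x)"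
proof
  assume "proj_pt x = proj_pt y"
  moreover have "y \<in> proj_pt y" unfolding proj_pt_def by (auto intro!: exI[of _ 1])
  ultimately show "\<exists>c. c \<noteq> 0 \<and> y = c *s x" unfolding proj_pt_def by auto
next
  assume "\<exists>c. c \<noteq> 0 \<and> y = c *s x"
  then obtain c where c: "c \<noteq> 0" "y = c *s x" by blast
  show "proj_pt x = proj_pt y"
  proof (intro equalityI subsetI)
    fix z assume "z \<in> proj_pt x"
    then obtain e where "e \<noteq> 0" "z = e *s x" unfolding proj_pt_def by auto
    then show "z \<in> proj_pt y" unfolding proj_pt_def using c by (auto intro!: exI[of _ "e / c"])
  next
    fix z assume "z \<in> proj_pt y"
    then obtain e where "e \<noteq> 0" "z = e *s y" unfolding proj_pt_def by auto
    then show "z \<in> proj_pt x" unfolding proj_pt_def using c by (auto intro!: exI[of _ "e * c"])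
  qed
qed

lemma proj_pt_scale: "c \<noteq> 0 \<Longrightarrow> proj_pt (c *s x) = proj_pt x"
  by (metis proj_pt_eq_iff)

lemma proj_pt_cross: "proj_pt x = proj_pt y \<Longrightarrow> x $ i * y $ j = x $ j * y $ i"
  unfolding proj_pt_eq_iff by (auto simp: mult_ac)

lemma proj_pt_eqI:
  assumes "x \<noteq> 0" "y \<noteq> 0" "\<And>i j. x $ i * y $ j = x $ j * y $ i"
  shows "proj_pt x = proj_pt y"
proof -
  obtain j where j: "x $ j \<noteq> 0" using assms(1) by (auto simp: vec_eq_iff)
  have y: "y = (y $ j / x $ j) *s x"
    using assms(3) j by (simp add: vec_eq_iff field_simps)
  moreover from y assms(2) have "y $ j / x $ j \<noteq> 0" by (metis vector_smult_lzero)
  ultimately show ?thesis unfolding proj_pt_eq_iff by blast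
qed

text \<open>The geometry of \<open>F\<close>, isolated from its equation: \<open>F\<close> generates
  the ideal of functions vanishing on X (\<open>F_null\<close>), X has no vertex
  (\<open>F_not_cone\<close>), and no line consists of singular points (\<open>F_sing\<close>). In
  \<open>F_expand\<close> the coefficient of t^2 is again a value of \<open>dF\<close>, with
  exchanged arguments, as for any cubic form.\<close>

locale cubic_threefold =
  fixes F :: "'k::{alg_closed_field, field_char_0} ^ 5 \<Rightarrow> 'k" and dF
  assumes F_deriv: "poly_deriv F dF"
    and F_expand: "\<And>y z t. F (y + t *s z) = F y + t * dF y z + t\<^sup>2 * dF z y + t ^ 3 * F z"
    and F_homog: "homog 3 F"
    and F_nonzero: "\<exists>x. F x \<noteq> 0"
    and F_null: "\<And>P. poly_fun P \<Longrightarrow> (\<And>x. F x = 0 \<Longrightarrow> P x = 0) \<Longrightarrow> \<exists>W. poly_fun W \<and> (\<forall>x. P x = F x * W x)"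
    and F_not_cone: "\<And>y. (\<And>z. dF z y = 0) \<Longrightarrow> y = 0"
    and F_sing: "\<And>u v. (\<And>s t. s *s u + t *s v = 0 \<Longrightarrow> s = 0 \<and> t = 0) \<Longrightarrow> \<exists>t z. dF (u + t *s v) z \<noteq> 0"
begin

text \<open>A lift is globally polynomial at the price of possibly vanishing at points of X, where
  it says nothing about \<open>f\<close>. Degree at least three leaves room for adding a multiple of
  \<open>F\<close> without changing the degree.\<close>

definition lift :: "(('k ^ 5) set \<Rightarrow> ('k ^ 5) set) \<Rightarrow> nat \<Rightarrow> ('k ^ 5 \<Rightarrow> 'k ^ 5) \<Rightarrow> bool" where
  "lift f d Q \<longleftrightarrow> 3 \<le> d \<and> (\<forall>i. poly_fun (\<lambda>x. Q x $ i) \<and> homog d (\<lambda>x. Q x $ i)) \<and>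
     (\<forall>x. F x = 0 \<longrightarrow> F (Q x) = 0 \<and> (Q x \<noteq> 0 \<longrightarrow> f (proj_pt x) = proj_pt (Q x)))"

lemma liftD:
  assumes "lift f d Q"
  shows "3 \<le> d" "poly_fun (\<lambda>x. Q x $ i)" "homog d (\<lambda>x. Q x $ i)"
    "F x = 0 \<Longrightarrow> F (Q x) = 0" "F x = 0 \<Longrightarrow> Q x \<noteq> 0 \<Longrightarrow> f (proj_pt x) = proj_pt (Q x)"
  using assms unfolding lift_def by auto

lemma lift_zero: assumes "lift f d Q" shows "Q 0 = 0"
proof -
  have "Q 0 $ i = 2 ^ d * Q 0 $ i" for i
    using homogD[OF liftD(3)[OF assms], of 2 0 i] by simp
  moreover have "(2 :: 'k) ^ d \<noteq> 1"
  proof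
    assume "(2 :: 'k) ^ d = 1"
    then have "of_nat (2 ^ d) = (of_nat 1 :: 'k)" by simp
    then show False using liftD(1)[OF assms] by (simp only: of_nat_eq_iff) simp
  qed
  ultimately have "Q 0 $ i = 0" for i by (metis mult_cancel_right1)
  then show ?thesis by (simp add: vec_eq_iff)
qed

lemma lift_cross:
  assumes "lift f d Q" "lift f e R" "F x = 0"
  shows "Q x $ i * R x $ j = Q x $ j * R x $ i"
proof (cases "Q x = 0 \<or> R x = 0")
  case False
  then have "proj_pt (Q x) = proj_pt (R x)" using assms by (metis liftD(5))
  then show ?thesis by (rule proj_pt_cross)
qed auto

lemma lift_factor:
  assumes "lift f d Q"
  obtains G where "poly_fun G" "\<And>x. F (Q x) = F x * G x"
proof -
  have "poly_fun (\<lambda>x. F (Q x))"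
    by (rule pf_compose[OF pd_poly_fun[OF F_deriv] liftD(2)[OF assms]])
  then show ?thesis using F_null[of "\<lambda>x. F (Q x)"] liftD(4)[OF assms] that by blast
qed

text \<open>F(Q(x)) = F(x) G(x) is differentiated by the chain rule and by the product rule; on X
  the term containing F(x) drops out. So \<open>G\<close> is the factor by which the gradient is
  pulled back.\<close>

lemma lift_chain:
  assumes "vec_deriv Q Q'" "poly_fun G" "\<And>x. F (Q x) = F x * G x" "F x = 0"
  shows "dF (Q x) (Q' x v) = G x * dF x v"
proof -
  obtain G' where G': "poly_deriv G G'" using assms(2) unfolding poly_fun_def by blast
  have "poly_deriv (\<lambda>x. F (Q x)) (\<lambda>x v. dF (Q x) (Q' x v))"
    by (rule pd_compose[OF F_deriv vec_derivD[OF assms(1)]])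
  moreover have "poly_deriv (\<lambda>x. F (Q x)) (\<lambda>x v. F x * G' x v + dF x v * G x)"
    unfolding assms(3) by (rule pd_mult[OF F_deriv G'])
  ultimately have "(\<lambda>x v. dF (Q x) (Q' x v)) = (\<lambda>x v. F x * G' x v + dF x v * G x)"
    by (rule pd_unique)
  then show ?thesis using assms(4) by (simp add: fun_eq_iff mult.commute)
qed

lemma factor_homog:
  assumes "lift f d Q" "poly_fun G" "\<And>x. F (Q x) = F x * G x"
  shows "homog (3 * (d - 1)) G"
  unfolding homog_def
proof (intro allI impI)
  fix c :: 'k and x assume c: "c \<noteq> 0"
  have Q: "Q (c *s x) = c ^ d *s Q x" for x
    using homogD[OF liftD(3)[OF assms(1)] c] by (simp add: vec_eq_iff)
  have *: "F x * (G (c *s x) - c ^ (3 * (d - 1)) * G x) = 0" for x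
  proof -
    have "F (c *s x) * G (c *s x) = c ^ (3 * d) * (F x * G x)"
      unfolding assms(3)[symmetric] Q using homogD[OF F_homog, of "c ^ d"] c
      by (simp add: power_mult[symmetric] mult.commute[of d])
    moreover have "F (c *s x) = c ^ 3 * F x" using homogD[OF F_homog c] .
    moreover have "3 * d = 3 + 3 * (d - 1)" using liftD(1)[OF assms(1)] by simp
    then have "c ^ (3 * d) = c ^ 3 * c ^ (3 * (d - 1))" by (metis power_add)
    ultimately show ?thesis using c by (simp add: algebra_simps)
  qed
  have "poly_fun (\<lambda>x. G (c *s x) - c ^ (3 * (d - 1)) * G x)"
    by (intro pf_intros assms(2) pf_compose[OF assms(2), of "\<lambda>x. c *s x"])
      (simp, intro pf_intros)
  from pf_no_zero_divisors[OF pd_poly_fun[OF F_deriv] this *] F_nonzero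
  show "G (c *s x) = c ^ (3 * (d - 1)) * G x" by auto
qed

end

locale cubic_automorphism = cubic_threefold F dF
  for F :: "'k::{alg_closed_field, field_char_0} ^ 5 \<Rightarrow> 'k" and dF +
  fixes f g :: "('k ^ 5) set \<Rightarrow> ('k ^ 5) set"
  assumes lift_f: "\<And>x. F x = 0 \<Longrightarrow> x \<noteq> 0 \<Longrightarrow> \<exists>d Q. lift f d Q \<and> Q x \<noteq> 0"
    and lift_g: "\<And>x. F x = 0 \<Longrightarrow> x \<noteq> 0 \<Longrightarrow> \<exists>d Q. lift g d Q \<and> Q x \<noteq> 0"
    and gf: "\<And>x. F x = 0 \<Longrightarrow> x \<noteq> 0 \<Longrightarrow> g (f (proj_pt x)) = proj_pt x"
    and fg: "\<And>x. F x = 0 \<Longrightarrow> x \<noteq> 0 \<Longrightarrow> f (g (proj_pt x)) = proj_pt x"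
begin

lemma inverse_automorphism: "cubic_automorphism F dF g f"
  by unfold_locales (use lift_f lift_g gf fg in auto)

text \<open>A lift \<open>R\<close> of \<open>g\<close> composed with \<open>Q\<close> is a multiple
  of the identity on X, so the minors of x and R(Q(x)) are multiples of \<open>F\<close>.
  Differentiating them at \<open>p\<close> along a tangent vector \<open>z\<close> killed by
  \<open>Q'\<close> makes \<open>z\<close> a multiple of \<open>p\<close>, and Euler's identity
  Q'(p) p = d Q(p) then leaves only z = 0.\<close>

lemma tangent_inj:
  assumes Q: "lift f d Q" and Q': "vec_deriv Q Q'" and p: "p \<noteq> 0" "F p = 0" "Q p \<noteq> 0"
    and z: "dF p z = 0" "Q' p z = 0"
  shows "z = 0"
proof -
  obtain e R where R: "lift g e R" "R (Q p) \<noteq> 0" using lift_g liftD(4)[OF Q] p by metis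
  obtain R' where R': "vec_deriv R R'" using vec_deriv_exists liftD(2)[OF R(1)] by blast
  obtain j where j: "p $ j \<noteq> 0" using p(1) by (auto simp: vec_eq_iff)
  have B': "poly_deriv (\<lambda>x. R (Q x) $ i) (\<lambda>x v. R' (Q x) (Q' x v) $ i)" for i
    by (rule pd_compose[OF vec_derivD[OF R'] vec_derivD[OF Q']])
  have B: "\<exists>c. R (Q x) = c *s x" if "F x = 0" for x
  proof (cases "R (Q x) = 0")
    case True
    then show ?thesis by (intro exI[of _ 0]) simp
  next
    case False
    then have "Q x \<noteq> 0" using lift_zero[OF R(1)] by auto
    then have "x \<noteq> 0" using lift_zero[OF Q] by auto
    have "proj_pt x = proj_pt (R (Q x))"
      using gf[OF that \<open>x \<noteq> 0\<close>] liftD(5)[OF Q that \<open>Q x \<noteq> 0\<close>] liftD(5)[OF R(1) liftD(4)[OF Q that] False] by simp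
    then show ?thesis unfolding proj_pt_eq_iff by blast
  qed
  have "z $ j * R (Q p) $ i = R (Q p) $ j * z $ i" for i
  proof -
    define P where "P x = x $ j * R (Q x) $ i - R (Q x) $ j * x $ i" for x
    have P': "poly_deriv P (\<lambda>x v. (x $ j * R' (Q x) (Q' x v) $ i + v $ j * R (Q x) $ i)
        - (R (Q x) $ j * v $ i + R' (Q x) (Q' x v) $ j * x $ i))"
      unfolding P_def by (intro pd_diff pd_mult pd_coord B')
    have "P x = 0" if "F x = 0" for x using B[OF that] by (auto simp: P_def)
    then obtain W where W: "poly_fun W" "\<And>x. P x = F x * W x" using F_null[OF pd_poly_fun[OF P']] by blast
    obtain W' where W': "poly_deriv W W'" using W(1) unfolding poly_fun_def by blast
    have "poly_deriv P (\<lambda>x v. F x * W' x v + dF x v * W x)"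
      using pd_mult[OF F_deriv W'] W(2) by presburger
    from fun_cong[OF fun_cong[OF pd_unique[OF P' this]], of p z] p(2) z
    show ?thesis by (simp add: pd_linear_zero[OF vec_derivD[OF R']])
  qed
  note main = this
  obtain c where c: "R (Q p) = c *s p" using B[OF p(2)] by blast
  then have "c \<noteq> 0" using R(2) by auto
  have zp: "z = (z $ j / p $ j) *s p"
    using main j \<open>c \<noteq> 0\<close> unfolding c by (simp add: vec_eq_iff field_simps)
  have "Q' p z = (z $ j / p $ j) *s Q' p p"
    by (subst zp) (simp add: vec_eq_iff pd_linear_scale[OF vec_derivD[OF Q']])
  also have "\<dots> = (z $ j / p $ j * of_nat d) *s Q p"
    by (simp add: vec_euler[OF Q' liftD(3)[OF Q]])
  finally have "z $ j = 0" using z(2) p(3) j liftD(1)[OF Q] by auto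
  with zp show ?thesis by simp
qed

text \<open>At a singular point every direction is tangent, so \<open>Q'\<close> is injective, hence
  surjective, and \<open>lift_chain\<close> transports the vanishing of the differential.\<close>

lemma singular_image:
  assumes Q: "lift f d Q" and p: "p \<noteq> 0" "F p = 0" "Q p \<noteq> 0" and sing: "\<And>z. dF p z = 0"
  shows "dF (Q p) z = 0"
proof -
  obtain Q' where Q': "vec_deriv Q Q'" using vec_deriv_exists liftD(2)[OF Q] by blast
  obtain G where G: "poly_fun G" "\<And>x. F (Q x) = F x * G x" using lift_factor[OF Q] by blast
  have "det (jac Q' p) \<noteq> 0"
    by (rule det_nonzero_of_inj) (use tangent_inj[OF Q Q' p] sing in \<open>simp add: jac_mult_vec[OF Q']\<close>)
  then obtain y where "jac Q' p *v y = z" using surj_of_det_nonzero by blast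
  then show ?thesis using lift_chain[OF Q' G p(2), of y] sing by (simp add: jac_mult_vec[OF Q'])
qed

text \<open>At a singular point any lift with Q(p) nonzero is already good, by a second-order
  comparison. At a smooth point \<open>G\<close> may vanish at \<open>p\<close>; then a multiple of
  \<open>F\<close> is added to \<open>Q\<close>, which changes nothing on X but moves the images of
  normal directions off the tangent space. The determinant is handled by
  \<open>tangent_inj\<close>.\<close>

lemma good_lift:
  assumes p: "p \<noteq> 0" "F p = 0"
  obtains d Q Q' G where "lift f d Q" "vec_deriv Q Q'" "poly_fun G" "\<And>x. F (Q x) = F x * G x"
    "Q p \<noteq> 0" "G p \<noteq> 0" "det (jac Q' p) \<noteq> 0"
proof -
  obtain d Q where Q: "lift f d Q" and Qp: "Q p \<noteq> 0" using lift_f p by blast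
  obtain Q' where Q': "vec_deriv Q Q'" using vec_deriv_exists liftD(2)[OF Q] by blast
  obtain G where G: "poly_fun G" "\<And>x. F (Q x) = F x * G x" using lift_factor[OF Q] by blast
  show ?thesis
  proof (cases "\<forall>z. dF p z = 0")
    case True
    then have sing: "dF p z = 0" for z by blast
    have det: "det (jac Q' p) \<noteq> 0"
      by (rule det_nonzero_of_inj) (use tangent_inj[OF Q Q' p Qp] sing in \<open>simp add: jac_mult_vec[OF Q']\<close>)
    have sQ: "dF (Q p) z = 0" for z by (rule singular_image[OF Q p Qp sing])
    have FQ: "F (Q p) = 0" by (rule liftD(4)[OF Q p(2)])
    \<comment> \<open>Both \<open>p\<close> and \<open>Q p\<close> are singular, so F(Q(p + tv)) =
      F(p + tv) G(p + tv) starts in degree two; this compares the coefficients of t^2. If G(p) were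
      zero, Q(p) would be a vertex of the cubic.\<close>
    have second: "dF (Q' p v) (Q p) = G p * dF v p" for v
    proof -
      have "\<exists>r. \<forall>t. Q (p + t *s v) $ i = Q p $ i + t * (Q' p v $ i + t * poly r t)" for i
      proof -
        obtain r where "\<And>t. Q (p + t *s v) $ i = Q p $ i + t * Q' p v $ i + t\<^sup>2 * poly r t"
          using pd_taylor[OF vec_derivD[OF Q']] by blast
        then show ?thesis by (intro exI[of _ r]) (simp add: algebra_simps power2_eq_square)
      qed
      then obtain r where r: "\<And>i t. Q (p + t *s v) $ i = Q p $ i + t * (Q' p v $ i + t * poly (r i) t)" by metis
      define \<zeta> where "\<zeta> i = [:Q' p v $ i:] + [:0, 1:] * r i" for i
      define Z where "Z t = (\<chi> i. poly (\<zeta> i) t)" for t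
      have QZ: "Q (p + t *s v) = Q p + t *s Z t" for t
        by (simp add: vec_eq_iff r Z_def \<zeta>_def)
      obtain A where A: "\<And>t. poly A t = dF (Z t) (Q p)"
        using pf_curve[OF pd_deriv_poly_fun[OF F_deriv], of \<zeta> "Q p"] unfolding Z_def by blast
      obtain B where B: "\<And>t. poly B t = F (Z t)"
        using pf_curve[OF pd_poly_fun[OF F_deriv], of \<zeta>] unfolding Z_def by blast
      obtain C where C: "\<And>t. poly C t = G (p + t *s v)" using pf_line[OF G(1)] by blast
      have "A + [:0, 1:] * B = C * [:dF v p, F v:]"
      proof (rule poly_eqI_nonzero[of "{0}"])
        fix t :: 'k assume "t \<notin> {0}"
        then have t: "t\<^sup>2 \<noteq> 0" by simp
        have "t\<^sup>2 * (dF (Z t) (Q p) + t * F (Z t)) = F (Q (p + t *s v))"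
          unfolding QZ F_expand FQ sQ by (simp add: algebra_simps power2_eq_square power3_eq_cube)
        also have "\<dots> = t\<^sup>2 * (G (p + t *s v) * (dF v p + t * F v))"
          unfolding G(2) F_expand[of p t v] p(2) sing by (simp add: algebra_simps power2_eq_square power3_eq_cube)
        finally show "poly (A + [:0, 1:] * B) t = poly (C * [:dF v p, F v:]) t"
          using t by (simp add: A B C) (simp add: algebra_simps)
      qed auto
      then have "poly (A + [:0, 1:] * B) 0 = poly (C * [:dF v p, F v:]) 0" by simp
      moreover have "Z 0 = Q' p v" by (simp add: Z_def \<zeta>_def)
      ultimately show ?thesis by (simp add: A C)
    qed
    have "G p \<noteq> 0"
    proof
      assume 0: "G p = 0"
      have "dF z (Q p) = 0" for z
      proof -
        obtain v where "jac Q' p *v v = z" using surj_of_det_nonzero[OF det] by blast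
        then show ?thesis using second[of v] 0 by (simp add: jac_mult_vec[OF Q'])
      qed
      then show False using F_not_cone Qp by blast
    qed
    with that Q Q' G Qp det show ?thesis by blast
  next
    case False
    have det: "det (jac R' p) \<noteq> 0"
      if R: "lift f e R" "vec_deriv R R'" "poly_fun H" "\<And>x. F (R x) = F x * H x" "R p \<noteq> 0" "H p \<noteq> 0"
      for e R R' H
    proof (rule det_nonzero_of_inj)
      fix z assume "jac R' p *v z = 0"
      then have z: "R' p z = 0" by (simp add: jac_mult_vec[OF R(2)])
      have "H p * dF p z = 0" using lift_chain[OF R(2-4) p(2), of z] unfolding z pd_linear_zero[OF F_deriv] by simp
      then show "z = 0" using tangent_inj[OF R(1,2) p R(5) _ z] R(6) by simp
    qed
    show ?thesis
    proof (cases "G p = 0")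
      case False
      with det[OF Q Q' G Qp] that Q Q' G Qp show ?thesis by blast
    next
      case True
      \<comment> \<open>The inverse also maps singular points to singular points, so the image of a
        smooth point is smooth.\<close>
      have "\<not> (\<forall>z. dF (Q p) z = 0)"
      proof
        assume s: "\<forall>z. dF (Q p) z = 0"
        have FQ: "F (Q p) = 0" by (rule liftD(4)[OF Q p(2)])
        obtain e R where R: "lift g e R" "R (Q p) \<noteq> 0" using lift_g[OF FQ Qp] by blast
        have "dF (R (Q p)) z = 0" for z
          by (rule cubic_automorphism.singular_image[OF inverse_automorphism R(1) Qp FQ R(2)]) (use s in blast)
        moreover have "proj_pt (R (Q p)) = proj_pt p"
          using gf[OF p(2,1)] liftD(5)[OF Q p(2) Qp] liftD(5)[OF R(1) FQ R(2)] by simp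
        then obtain c where c: "c \<noteq> 0" "p = c *s R (Q p)" unfolding proj_pt_eq_iff by blast
        moreover have "homog 2 (\<lambda>x. dF x z)" for z
          using homog_deriv[OF F_deriv, of 2] F_homog by (simp add: numeral_3_eq_3 numeral_2_eq_2)
        ultimately have "dF p z = 0" for z using homogD[of 2 "\<lambda>x. dF x z" c "R (Q p)"] by auto
        with \<open>\<not> (\<forall>z. dF p z = 0)\<close> show False by blast
      qed
      then obtain w where w: "dF (Q p) w \<noteq> 0" by blast
      obtain j where j: "p $ j \<noteq> 0" using p(1) by (auto simp: vec_eq_iff)
      \<comment> \<open>The power of x_j brings the multiple of \<open>F\<close> to degree
        \<open>d\<close> and is nonzero at \<open>p\<close>; the direction \<open>w\<close> is
        transverse to X at \<open>Q p\<close>.\<close>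
      define R where "R x = Q x + (F x * (x $ j) ^ (d - 3)) *s w" for x
      have onX: "R x = Q x" if "F x = 0" for x using that by (simp add: R_def)
      have R: "lift f d R"
        unfolding lift_def
      proof (intro conjI allI impI)
        show "3 \<le> d" by (rule liftD(1)[OF Q])
        show "poly_fun (\<lambda>x. R x $ i)" for i
          unfolding R_def vector_add_component vector_smult_component
          by (intro pf_intros liftD(2)[OF Q] pd_poly_fun[OF F_deriv])
        show "homog d (\<lambda>x. R x $ i)" for i
          unfolding homog_def
        proof (intro allI impI)
          fix c :: 'k and x assume c: "c \<noteq> 0"
          have "c ^ d = c ^ 3 * c ^ (d - 3)" using liftD(1)[OF Q] by (metis le_add_diff_inverse power_add)
          then show "R (c *s x) $ i = c ^ d * R x $ i"
            using homogD[OF liftD(3)[OF Q] c] homogD[OF F_homog c] by (simp add: R_def algebra_simps power_mult_distrib)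
        qed
        show "F (R x) = 0" if "F x = 0" for x using liftD(4)[OF Q that] onX[OF that] by simp
        show "f (proj_pt x) = proj_pt (R x)" if "F x = 0" "R x \<noteq> 0" for x
          using liftD(5)[OF Q that(1)] onX[OF that(1)] that(2) by simp
      qed
      obtain R' where R': "vec_deriv R R'" using vec_deriv_exists liftD(2)[OF R] by blast
      obtain H where H: "poly_fun H" "\<And>x. F (R x) = F x * H x" using lift_factor[OF R] by blast
      have Rp: "R p = Q p" using onX p(2) by blast
      have R'p: "R' p v = Q' p v + ((p $ j) ^ (d - 3) * dF p v) *s w" for v
      proof -
        have "poly_fun (\<lambda>x. (x $ j) ^ (d - 3) * w $ i)" for i by (intro pf_intros)
        then have "\<exists>m'. poly_deriv (\<lambda>x. (x $ j) ^ (d - 3) * w $ i) m'" for i unfolding poly_fun_def .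
        then obtain m' where m': "\<And>i. poly_deriv (\<lambda>x. (x $ j) ^ (d - 3) * w $ i) (m' i)" by metis
        have "poly_deriv (\<lambda>x. R x $ i) (\<lambda>x v. Q' x v $ i + (F x * m' i x v + dF x v * ((x $ j) ^ (d - 3) * w $ i)))" for i
          unfolding R_def vector_add_component vector_smult_component mult.assoc
          by (intro pd_add pd_mult F_deriv vec_derivD[OF Q'] m')
        from fun_cong[OF fun_cong[OF pd_unique[OF vec_derivD[OF R'] this]], of p v]
        show ?thesis using p(2) by (simp add: vec_eq_iff)
      qed
      have "H p \<noteq> 0"
      proof
        assume 0: "H p = 0"
        obtain z where z: "dF p z \<noteq> 0" using \<open>\<not> (\<forall>z. dF p z = 0)\<close> by blast
        have "dF (R p) (R' p z) = 0" using lift_chain[OF R' H p(2), of z] 0 by simp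
        then have "dF (Q p) (Q' p z) + (p $ j) ^ (d - 3) * dF p z * dF (Q p) w = 0"
          unfolding Rp R'p pd_linear_add[OF F_deriv] pd_linear_scale[OF F_deriv] .
        moreover have "dF (Q p) (Q' p z) = 0" using lift_chain[OF Q' G p(2), of z] True by simp
        ultimately show False using j z w by simp
      qed
      with det[OF R R' H] that[OF R R' H] Rp Qp show ?thesis by simp
    qed
  qed
qed

text \<open>The minors of the two lifts vanish on X, hence are multiples of \<open>F\<close>, and
  their differentials at \<open>p\<close> bring the Jacobian of \<open>R\<close> into the form
  required by \<open>det_cocycle\<close>. Thus det DQ / (d G) is multiplied by u^2 when R(p) = u
  Q(p); the degrees enter through Euler's identity.\<close>

lemma cocycle:
  assumes Q: "lift f d Q" "vec_deriv Q Q'" "poly_fun G" "\<And>x. F (Q x) = F x * G x"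
    and R: "lift f e R" "vec_deriv R R'" "poly_fun H" "\<And>x. F (R x) = F x * H x"
    and p: "F p = 0" "dF p z0 \<noteq> 0" "det (jac Q' p) \<noteq> 0" "Q p $ j \<noteq> 0" "R p $ j \<noteq> 0"
  shows "of_nat d * G p * det (jac R' p) * (Q p $ j)\<^sup>2 = of_nat e * (R p $ j)\<^sup>2 * H p * det (jac Q' p)"
proof -
  define u where "u = R p $ j / Q p $ j"
  have u: "u \<noteq> 0" using p by (simp add: u_def)
  have Rp: "R p = u *s Q p"
    using lift_cross[OF Q(1) R(1) p(1), of _ j] p(4) by (simp add: vec_eq_iff u_def field_simps)
  have "\<exists>c. \<forall>v. R p $ j * Q' p v $ i + R' p v $ j * Q p $ i - (Q p $ j * R' p v $ i + Q' p v $ j * R p $ i) = dF p v * c" for i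
  proof -
    define P where "P x = R x $ j * Q x $ i - Q x $ j * R x $ i" for x
    have P': "poly_deriv P (\<lambda>x v. (R x $ j * Q' x v $ i + R' x v $ j * Q x $ i) - (Q x $ j * R' x v $ i + Q' x v $ j * R x $ i))"
      unfolding P_def by (intro pd_diff pd_mult vec_derivD Q R)
    have "P x = 0" if "F x = 0" for x
      using lift_cross[OF Q(1) R(1) that, of i j] by (simp add: P_def mult.commute)
    then obtain W where W: "poly_fun W" "\<And>x. P x = F x * W x" using F_null[OF pd_poly_fun[OF P']] by blast
    obtain W' where W': "poly_deriv W W'" using W(1) unfolding poly_fun_def by blast
    have "poly_deriv P (\<lambda>x v. F x * W' x v + dF x v * W x)"
      using pd_mult[OF F_deriv W'] W(2) by presburger
    from fun_cong[OF fun_cong[OF pd_unique[OF P' this]], of p] p(1)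
    show ?thesis by (intro exI[of _ "W p"]) simp
  qed
  then obtain W where W: "\<And>v i. R p $ j * Q' p v $ i + R' p v $ j * Q p $ i - (Q p $ j * R' p v $ i + Q' p v $ j * R p $ i) = dF p v * W i"
    by metis
  \<comment> \<open>\<alpha> and \<open>w\<close> come from solving the differentiated identity for
    the minors with the coordinate \<open>j\<close> for R'(p) v.\<close>
  define \<alpha> where "\<alpha> = (\<chi> l. (R' p (axis l 1) $ j - u * Q' p (axis l 1) $ j) / Q p $ j)"
  define w where "w = (\<chi> i. - W i / Q p $ j)"
  define \<phi> where "\<phi> = (\<chi> l. dF p (axis l 1))"
  define \<eta> where "\<eta> = (\<chi> l. dF (Q p) (axis l 1))"
  have d\<phi>: "dot \<phi> v = dF p v" for v
    using pd_linear_axis[OF F_deriv, of p v] by (simp add: dot_def \<phi>_def mult.commute)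
  have d\<eta>: "dot \<eta> v = dF (Q p) v" for v
    using pd_linear_axis[OF F_deriv, of "Q p" v] by (simp add: dot_def \<eta>_def mult.commute)
  have d\<alpha>: "dot \<alpha> v = (R' p v $ j - u * Q' p v $ j) / Q p $ j" for v
    using pd_linear_axis[OF vec_derivD[OF R(2)], of p v j] pd_linear_axis[OF vec_derivD[OF Q(2)], of p v j]
    by (simp add: dot_def \<alpha>_def sum_divide_distrib sum_subtractf sum_distrib_left algebra_simps diff_divide_distrib)
  have FQ: "F (Q p) = 0" by (rule liftD(4)[OF Q(1) p(1)])
  have "of_nat d * G p * det (jac R' p) = of_nat e * u\<^sup>2 * H p * det (jac Q' p)"
  proof (rule det_cocycle[where y = "Q p" and \<alpha> = \<alpha> and \<phi> = \<phi> and w = w and p = p and \<eta> = \<eta>])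
    show "det (jac Q' p) \<noteq> 0" "u \<noteq> 0" by fact+
    show "of_nat d \<noteq> (0 :: 'k)" "of_nat e \<noteq> (0 :: 'k)" using liftD(1)[OF Q(1)] liftD(1)[OF R(1)] by auto
    show "Q p \<noteq> 0" using p(4) by auto
    show "jac R' p *v v = u *s (jac Q' p *v v) + dot \<alpha> v *s Q p + dot \<phi> v *s w" for v
    proof (rule vec_eq_iff[THEN iffD2], rule allI)
      fix i
      have "R' p v $ i = (u * Q p $ j * Q' p v $ i + R' p v $ j * Q p $ i - Q' p v $ j * (u * Q p $ i) - dF p v * W i) / Q p $ j"
        using W[of v i] p(4) unfolding Rp by (simp add: nonzero_eq_divide_eq algebra_simps)
      also have "\<dots> = (u *s Q' p v + ((R' p v $ j - u * Q' p v $ j) / Q p $ j) *s Q p + dF p v *s w) $ i"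
        using p(4) by (simp add: w_def field_simps)
      finally show "(jac R' p *v v) $ i = (u *s (jac Q' p *v v) + dot \<alpha> v *s Q p + dot \<phi> v *s w) $ i"
        unfolding jac_mult_vec[OF Q(2)] jac_mult_vec[OF R(2)] d\<alpha> d\<phi> .
    qed
    show "jac Q' p *v p = of_nat d *s Q p" unfolding jac_mult_vec[OF Q(2)] by (rule vec_euler[OF Q(2) liftD(3)[OF Q(1)]])
    show "jac R' p *v p = (of_nat e * u) *s Q p"
      unfolding jac_mult_vec[OF R(2)] using vec_euler[OF R(2) liftD(3)[OF R(1)], of p] by (simp add: Rp)
    show "dot \<phi> p = 0" unfolding d\<phi> using pd_euler[OF F_deriv F_homog, of p] p(1) by simp
    show "dot \<eta> (jac Q' p *v v) = G p * dot \<phi> v" for v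
      unfolding jac_mult_vec[OF Q(2)] d\<eta> d\<phi> by (rule lift_chain[OF Q(2-4) p(1)])
    have "homog 2 (\<lambda>x. dF x z)" for z
      using homog_deriv[OF F_deriv, of 2] F_homog by (simp add: numeral_3_eq_3 numeral_2_eq_2)
    then have "dF (R p) z = u\<^sup>2 * dF (Q p) z" for z unfolding Rp using homogD[of 2 "\<lambda>x. dF x z" u "Q p"] u by blast
    then show "u\<^sup>2 * dot \<eta> (jac R' p *v v) = H p * dot \<phi> v" for v
      unfolding jac_mult_vec[OF R(2)] d\<eta> d\<phi> using lift_chain[OF R(2-4) p(1), of v] by simp
    show "dot \<eta> (Q p) = 0" unfolding d\<eta> using pd_euler[OF F_deriv F_homog, of "Q p"] FQ by simp
    show "\<phi> \<noteq> 0" using d\<phi>[of z0] p(2) by (auto simp: dot_def)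
  qed
  then show ?thesis using p(4) by (simp add: u_def field_simps)
qed

end

section \<open>Images of lines and planes\<close>

context cubic_automorphism
begin

text \<open>Restricted to a line, \<open>f\<close> is given by forms \<open>\<psi>\<close> of some degree \<open>m\<close>. Lifts that are good near
  the various points of the line have Jacobians with no common zero after division by \<open>G h\<^sup>2\<close>; counting
  zeros gives \<open>5(d-1) = 3(d-1) + 2(d-m)\<close>, i.e. \<open>m = 1\<close>.\<close>

lemma line_image:
  assumes indep: "\<And>s t. s *s u + t *s v = 0 \<Longrightarrow> s = 0 \<and> t = 0"
    and onX: "\<And>s t. F (s *s u + t *s v) = 0"
  obtains u' v' where "\<And>s t. s \<noteq> 0 \<or> t \<noteq> 0 \<Longrightarrow>
    s *s u' + t *s v' \<noteq> 0 \<and> f (proj_pt (s *s u + t *s v)) = proj_pt (s *s u' + t *s v')"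
proof -
  define L where "L t = u + t *s v" for t
  have FL: "F (L t) = 0" for t using onX[of 1 t] by (simp add: L_def)
  have Lnz: "L t \<noteq> 0" for t using indep[of 1 t] by (auto simp: L_def)
  have Fv: "F v = 0" using onX[of 0 1] by simp
  have vnz: "v \<noteq> 0" using indep[of 0 1] by auto
  \<comment> \<open>The lift is good at \<open>v\<close>, the point at infinity, so that det DQ and
    \<open>G\<close> restrict to polynomials of degree exactly 5(d-1) and 3(d-1).\<close>
  obtain d Q Q' G where Q: "lift f d Q" "vec_deriv Q Q'" "poly_fun G" "\<And>x. F (Q x) = F x * G x"
    and Qv: "Q v \<noteq> 0" "G v \<noteq> 0" "det (jac Q' v) \<noteq> 0"
    using good_lift[OF vnz Fv] by metis
  have d3: "3 \<le> d" by (rule liftD(1)[OF Q(1)])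
  then have d1: "d = Suc (d - 1)" by simp
  have "\<exists>p. \<forall>t. poly p t = Q (L t) $ i" for i
    using pf_line[OF liftD(2)[OF Q(1)], of u v i] unfolding L_def by metis
  then obtain W where W: "\<And>i t. poly (W i) t = Q (L t) $ i" by metis
  have Wd: "degree (W i) \<le> d" "coeff (W i) d = Q v $ i" for i
    using homog_line_degree[OF liftD(2,3)[OF Q(1)]] W unfolding L_def by blast+
  obtain Dp where Dp: "\<And>t. poly Dp t = det (jac Q' (L t))"
    using pf_line[OF det_jac_poly_fun[OF Q(2)], of u v] unfolding L_def by blast
  have "degree Dp \<le> 5 * (d - 1)" "coeff Dp (5 * (d - 1)) = det (jac Q' v)"
    using homog_line_degree[OF det_jac_poly_fun[OF Q(2)] det_jac_homog[OF Q(2), of "d - 1"], of Dp u v]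
      Dp liftD(3)[OF Q(1)] d1 unfolding L_def by simp_all
  then have degD: "degree Dp = 5 * (d - 1)" using Qv(3) by (metis le_degree order_antisym)
  obtain Gp where Gp: "\<And>t. poly Gp t = G (L t)" using pf_line[OF Q(3), of u v] unfolding L_def by blast
  have "degree Gp \<le> 3 * (d - 1)" "coeff Gp (3 * (d - 1)) = G v"
    using homog_line_degree[OF Q(3) factor_homog[OF Q(1,3,4)], of Gp u v] Gp unfolding L_def by simp_all
  then have degG: "degree Gp = 3 * (d - 1)" using Qv(2) by (metis le_degree order_antisym)
  have Dnz: "Dp \<noteq> 0" and Gnz: "Gp \<noteq> 0" using degD degG d3 by auto
  obtain j0 where "Q v $ j0 \<noteq> 0" using Qv(1) by (auto simp: vec_eq_iff)
  then have j0: "W j0 \<noteq> 0" using Wd(2)[of j0] by auto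
  obtain h \<psi> where h: "h \<noteq> 0" and \<psi>: "\<And>i. W i = h * \<psi> i" "\<And>t. \<exists>i. poly (\<psi> i) t \<noteq> 0"
    using poly_vector_content[of W j0] j0 by metis
  \<comment> \<open>\<open>cocycle\<close> needs smooth points. Since \<open>Sp\<close> is not
    identically zero, only finitely many parameters have to be avoided.\<close>
  obtain ts zs where "dF (u + ts *s v) zs \<noteq> 0" using F_sing[OF indep] by blast
  obtain Sp where Sp: "\<And>t. poly Sp t = dF (L t) zs"
    using pf_line[OF pd_deriv_poly_fun[OF F_deriv], of u v zs] unfolding L_def by blast
  have Snz: "Sp \<noteq> 0" using Sp[of ts] \<open>dF (u + ts *s v) zs \<noteq> 0\<close> unfolding L_def by auto
  have cross: "\<exists>Z. (\<forall>i t. poly (Z i) t = R (L t) $ i) \<and> (\<forall>i j. Z i * \<psi> j = Z j * \<psi> i)" if R: "lift f e R" for e R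
  proof -
    have "\<exists>p. \<forall>t. poly p t = R (L t) $ i" for i
      using pf_line[OF liftD(2)[OF R], of u v i] unfolding L_def by metis
    then obtain Z where Z: "\<And>i t. poly (Z i) t = R (L t) $ i" by metis
    have "Z i * \<psi> j = Z j * \<psi> i" for i j
    proof -
      have "Z i * W j = Z j * W i"
        by (rule poly_eqI_nonzero[of "{}"]) (use lift_cross[OF R Q(1) FL] in \<open>auto simp: Z W\<close>)
      then have "h * (Z i * \<psi> j) = h * (Z j * \<psi> i)" unfolding \<psi>(1) by (simp only: mult_ac)
      with h show ?thesis by simp
    qed
    with Z show ?thesis by blast
  qed
  \<comment> \<open>A lift \<open>R\<close> that is good at the parameter t0 is compared with
    \<open>Q\<close> through \<open>cocycle\<close>. Its determinant, its factor \<open>H\<close>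
    and one of its coordinates have order zero at t0, and the matching coordinate of
    \<open>Q\<close> has the order of \<open>h\<close>, which enters squared.\<close>
  have ord: "Polynomial.order t0 Dp = Polynomial.order t0 (Gp * (h * h))" for t0
  proof -
    obtain e R R' H where R: "lift f e R" "vec_deriv R R'" "poly_fun H" "\<And>x. F (R x) = F x * H x"
      and Rt: "R (L t0) \<noteq> 0" "H (L t0) \<noteq> 0" "det (jac R' (L t0)) \<noteq> 0"
      using good_lift[OF Lnz FL] by metis
    obtain Z where Z: "\<And>i t. poly (Z i) t = R (L t) $ i" "\<And>i j. Z i * \<psi> j = Z j * \<psi> i"
      using cross[OF R(1)] by blast
    obtain Ep where Ep: "\<And>t. poly Ep t = det (jac R' (L t))"
      using pf_line[OF det_jac_poly_fun[OF R(2)], of u v] unfolding L_def by blast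
    obtain Hp where Hp: "\<And>t. poly Hp t = H (L t)" using pf_line[OF R(3), of u v] unfolding L_def by blast
    obtain j where j: "R (L t0) $ j \<noteq> 0" using Rt(1) by (auto simp: vec_eq_iff)
    have \<psi>j: "poly (\<psi> j) t0 \<noteq> 0"
    proof
      assume "poly (\<psi> j) t0 = 0"
      then have "poly (\<psi> i) t0 = 0" for i
        using arg_cong[OF Z(2)[of i j], of "\<lambda>p. poly p t0"] j by (simp add: Z(1))
      then show False using \<psi>(2) by blast
    qed
    have z: "poly (Z j) t0 \<noteq> 0" "poly Ep t0 \<noteq> 0" "poly Hp t0 \<noteq> 0" using j Rt by (simp_all add: Z(1) Ep Hp)
    then have nz: "Z j \<noteq> 0" "Ep \<noteq> 0" "Hp \<noteq> 0" "\<psi> j \<noteq> 0" using \<psi>j by auto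
    have Wj: "W j \<noteq> 0" using h nz by (simp add: \<psi>(1))
    have de: "(of_nat d :: 'k) \<noteq> 0" "(of_nat e :: 'k) \<noteq> 0" using d3 liftD(1)[OF R(1)] by auto
    have "[:of_nat d:] * (Gp * (Ep * (W j * W j))) = [:of_nat e:] * (Z j * (Z j * (Hp * Dp)))"
    proof (rule poly_eqI_nonzero)
      show "finite ({t. poly (W j * Z j * Dp * Sp) t = 0})"
        using Wj nz Dnz Snz by (intro poly_roots_finite) auto
      fix t assume "t \<notin> {t. poly (W j * Z j * Dp * Sp) t = 0}"
      then have "dF (L t) zs \<noteq> 0" "det (jac Q' (L t)) \<noteq> 0" "Q (L t) $ j \<noteq> 0" "R (L t) $ j \<noteq> 0"
        by (auto simp: W Z Dp Sp)
      from cocycle[OF Q R FL this]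
      show "poly ([:of_nat d:] * (Gp * (Ep * (W j * W j)))) t = poly ([:of_nat e:] * (Z j * (Z j * (Hp * Dp)))) t"
        by (simp add: W Z Dp Ep Gp Hp power2_eq_square mult_ac)
    qed
    then have "Polynomial.order t0 ([:of_nat d:] * (Gp * (Ep * (W j * W j)))) =
      Polynomial.order t0 ([:of_nat e:] * (Z j * (Z j * (Hp * Dp))))" by simp
    moreover have "Polynomial.order t0 [:c:] = 0" if "c \<noteq> 0" for c using that by (simp add: order_0I)
    moreover have "Polynomial.order t0 Ep = 0" "Polynomial.order t0 Hp = 0" "Polynomial.order t0 (Z j) = 0"
      "Polynomial.order t0 (\<psi> j) = 0"
      using z \<psi>j by (simp_all add: order_0I)
    moreover have "Polynomial.order t0 (W j) = Polynomial.order t0 h"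
      unfolding \<psi>(1) using h nz \<psi>j by (subst order_mult) (auto simp: order_0I)
    ultimately show ?thesis
      using nz de Wj Dnz Gnz h by (simp add: order_mult del: mult_pCons_left)
  qed
  have "degree Dp = degree (Gp * (h * h))"
    by (rule degree_eq_of_order_eq) (use Dnz Gnz h ord in auto)
  then have degh: "Suc (degree h) = d"
    using d3 Gnz h by (simp add: degD degG degree_mult_eq)
  have deg\<psi>: "degree (\<psi> i) \<le> 1" for i
    using Wd(1)[of i] degh h unfolding \<psi>(1) by (cases "\<psi> i = 0") (auto simp: degree_mult_eq)
  define u' where "u' = (\<chi> i. coeff (\<psi> i) 0)"
  define v' where "v' = (\<chi> i. coeff (\<psi> i) 1)"
  have \<psi>_eq: "\<psi> i = [:u' $ i, v' $ i:]" for i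
  proof (rule poly_eqI)
    fix n
    show "coeff (\<psi> i) n = coeff [:u' $ i, v' $ i:] n"
      using deg\<psi>[of i] by (cases n; cases "n - 1") (auto simp: u'_def v'_def coeff_eq_0)
  qed
  have Qv': "Q v = lead_coeff h *s v'"
  proof -
    have "Q v $ i = lead_coeff h * v' $ i" for i
      unfolding Wd(2)[symmetric] \<psi>(1) \<psi>_eq degh[symmetric]
      by (simp add: coeff_eq_0 mult.commute)
    then show ?thesis by (simp add: vec_eq_iff)
  qed
  have inf: "v' \<noteq> 0 \<and> f (proj_pt v) = proj_pt v'"
    using Qv(1) liftD(5)[OF Q(1) Fv] h by (auto simp: Qv' proj_pt_scale)
  have fin: "u' + t *s v' \<noteq> 0 \<and> f (proj_pt (L t)) = proj_pt (u' + t *s v')" for t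
  proof -
    have \<psi>t: "(u' + t *s v') $ i = poly (\<psi> i) t" for i by (simp add: \<psi>_eq)
    obtain e R where R: "lift f e R" "R (L t) \<noteq> 0" using lift_f[OF FL Lnz] by blast
    obtain Z where Z: "\<And>i t. poly (Z i) t = R (L t) $ i" "\<And>i j. Z i * \<psi> j = Z j * \<psi> i"
      using cross[OF R(1)] by blast
    have nz: "u' + t *s v' \<noteq> 0"
      using \<psi>(2)[of t] unfolding \<psi>t[symmetric] by (metis zero_index)
    moreover have "proj_pt (R (L t)) = proj_pt (u' + t *s v')"
    proof (rule proj_pt_eqI[OF R(2) nz])
      show "R (L t) $ i * (u' + t *s v') $ j = R (L t) $ j * (u' + t *s v') $ i" for i j
        using arg_cong[OF Z(2)[of i j], of "\<lambda>p. poly p t"] unfolding \<psi>t by (simp add: Z(1))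
    qed
    ultimately show ?thesis using liftD(5)[OF R(1) FL R(2)] by simp
  qed
  show ?thesis
  proof (rule that[of u' v'])
    fix s t :: 'k assume st: "s \<noteq> 0 \<or> t \<noteq> 0"
    show "s *s u' + t *s v' \<noteq> 0 \<and> f (proj_pt (s *s u + t *s v)) = proj_pt (s *s u' + t *s v')"
    proof (cases "s = 0")
      case True
      with st inf show ?thesis by (simp add: proj_pt_scale)
    next
      case False
      then have "s *s u + t *s v = s *s L (t / s)" "s *s u' + t *s v' = s *s (u' + (t / s) *s v')"
        by (simp_all add: L_def vec.scale_right_distrib)
      then show ?thesis using fin[of "t / s"] False by (simp add: proj_pt_scale)
    qed
  qed
qed

lemma f_inj:
  assumes "F x = 0" "x \<noteq> 0" "F y = 0" "y \<noteq> 0" "f (proj_pt x) = f (proj_pt y)"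
  obtains c where "c \<noteq> 0" "y = c *s x"
  using gf assms that by (metis proj_pt_eq_iff)

text \<open>A fundamental theorem of projective geometry in which no field automorphism can occur,
  since each line is already mapped linearly. The images of \<open>u\<close>, \<open>v\<close>,
  \<open>w\<close> and u + v + w fix the frame; the work lies in showing that the scales found along
  different lines agree.\<close>

lemma plane_image:
  assumes indep: "\<And>r s t. r *s u + s *s v + t *s w = 0 \<Longrightarrow> r = 0 \<and> s = 0 \<and> t = 0"
    and onX: "\<And>r s t. F (r *s u + s *s v + t *s w) = 0"
  obtains u' v' w' where "\<And>r s t. r \<noteq> 0 \<or> s \<noteq> 0 \<or> t \<noteq> 0 \<Longrightarrow>
    r *s u' + s *s v' + t *s w' \<noteq> 0 \<and>
    f (proj_pt (r *s u + s *s v + t *s w)) = proj_pt (r *s u' + s *s v' + t *s w')"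
proof -
  have line: "\<exists>a' b'. \<forall>s t. s \<noteq> 0 \<or> t \<noteq> 0 \<longrightarrow>
      s *s a' + t *s b' \<noteq> 0 \<and> f (proj_pt (s *s a + t *s b)) = proj_pt (s *s a' + t *s b')"
    if a: "a = r1 *s u + s1 *s v + t1 *s w" and b: "b = r2 *s u + s2 *s v + t2 *s w"
      and ind: "\<And>s t. s * r1 + t * r2 = 0 \<Longrightarrow> s * s1 + t * s2 = 0 \<Longrightarrow> s * t1 + t * t2 = 0 \<Longrightarrow> s = 0 \<and> t = 0"
    for a b r1 s1 t1 r2 s2 t2
  proof -
    have ab: "s *s a + t *s b = (s * r1 + t * r2) *s u + (s * s1 + t * s2) *s v + (s * t1 + t * t2) *s w" for s t
      unfolding a b by (simp add: vec_eq_iff algebra_simps)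
    show ?thesis
      by (rule line_image[of a b]) (use ab onX indep ind in metis, use ab onX in metis, blast)
  qed
  obtain u' v' where uv: "\<And>s t. s \<noteq> 0 \<or> t \<noteq> 0 \<Longrightarrow>
      s *s u' + t *s v' \<noteq> 0 \<and> f (proj_pt (s *s u + t *s v)) = proj_pt (s *s u' + t *s v')"
    using line[of u 1 0 0 v 0 1 0] by auto
  text \<open>Match the scale of \<open>w'\<close> along the line joining \<open>u + v\<close> to \<open>w\<close>.\<close>
  obtain w' where uvw: "\<And>s t. s \<noteq> 0 \<or> t \<noteq> 0 \<Longrightarrow>
      s *s (u' + v') + t *s w' \<noteq> 0 \<and> f (proj_pt (s *s (u + v) + t *s w)) = proj_pt (s *s (u' + v') + t *s w')"
  proof -
    obtain a' b' where ab: "\<And>s t. s \<noteq> 0 \<or> t \<noteq> 0 \<Longrightarrow>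
      s *s a' + t *s b' \<noteq> 0 \<and> f (proj_pt (s *s (u + v) + t *s w)) = proj_pt (s *s a' + t *s b')"
      using line[of "u + v" 1 1 0 w 0 0 1] by auto
    have "proj_pt a' = proj_pt (u' + v')" using ab[of 1 0] uv[of 1 1] by simp
    then obtain c where c: "c \<noteq> 0" "u' + v' = c *s a'" unfolding proj_pt_eq_iff by blast
    have "s *s (u' + v') + t *s (c *s b') = c *s (s *s a' + t *s b')" for s t
      unfolding c by (simp add: vec_eq_iff algebra_simps)
    then show ?thesis using ab c(1) by (intro that[of "c *s b'"]) (simp add: proj_pt_scale)
  qed
  have indep': "r = 0 \<and> s = 0 \<and> t = 0" if 0: "r *s u' + s *s v' + t *s w' = 0" for r s t
  proof -
    have "t = 0"
    proof (rule ccontr)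
      assume t: "t \<noteq> 0"
      have w': "w' = (- r / t) *s u' + (- s / t) *s v'"
        using 0 t by (simp add: vec_eq_iff field_simps) (metis add_eq_0_iff2 mult.commute add.commute)
      have "w' \<noteq> 0" using uvw[of 0 1] by simp
      then have nz: "- r / t \<noteq> 0 \<or> - s / t \<noteq> 0" using w' by auto
      have "f (proj_pt w) = f (proj_pt ((- r / t) *s u + (- s / t) *s v))"
        using uvw[of 0 1] uv[OF nz] unfolding w'[symmetric] by simp
      moreover have "F w = 0" using onX[of 0 0 1] by simp
      moreover have "w \<noteq> 0" using indep[of 0 0 1] by auto
      moreover have "F ((- r / t) *s u + (- s / t) *s v) = 0" using onX[of "- r / t" "- s / t" 0] by simp
      moreover have "(- r / t) *s u + (- s / t) *s v \<noteq> 0" using indep[of "- r / t" "- s / t" 0] nz by auto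
      ultimately obtain c where c: "c \<noteq> 0" "(- r / t) *s u + (- s / t) *s v = c *s w"
        using f_inj[of w "(- r / t) *s u + (- s / t) *s v"] by metis
      have "(- r / t) *s u + (- s / t) *s v + (- c) *s w = 0" unfolding c by (simp add: vec_eq_iff)
      then show False using indep c(1) by fastforce
    qed
    then show ?thesis using 0 uv[of r s] by auto
  qed
  \<comment> \<open>The scale \<open>k\<close> may depend on the line through \<open>w\<close>. For
    the lines through \<open>u\<close> and \<open>v\<close> the point u + v + w will show that it is
    1.\<close>
  have mixed: "\<exists>k. k \<noteq> 0 \<and> (\<forall>s t. s \<noteq> 0 \<or> t \<noteq> 0 \<longrightarrow> f (proj_pt (s *s a + t *s w)) = proj_pt (s *s a' + t *s (k *s w')))"
    if a: "a = r1 *s u + s1 *s v" and a': "a' = r1 *s u' + s1 *s v'" and nz: "r1 \<noteq> 0 \<or> s1 \<noteq> 0" for a a' r1 s1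
  proof -
    have ind: "s * r1 + t * 0 = 0 \<Longrightarrow> s * s1 + t * 0 = 0 \<Longrightarrow> s * 0 + t * 1 = 0 \<Longrightarrow> s = 0 \<and> t = 0" for s t
      using nz by auto
    obtain x y where xy: "\<And>s t. s \<noteq> 0 \<or> t \<noteq> 0 \<Longrightarrow>
      s *s x + t *s y \<noteq> 0 \<and> f (proj_pt (s *s a + t *s w)) = proj_pt (s *s x + t *s y)"
      using line[of a r1 s1 0 w 0 0 1, OF _ _ ind] a by auto
    have "proj_pt x = proj_pt a'" using xy[of 1 0] uv[OF nz] a a' by simp
    then obtain c where c: "c \<noteq> 0" "a' = c *s x" unfolding proj_pt_eq_iff by blast
    have "proj_pt w' = proj_pt y" using xy[of 0 1] uvw[of 0 1] by simp
    then obtain e where e: "e \<noteq> 0" "y = e *s w'" unfolding proj_pt_eq_iff by blast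
    have "s *s a' + t *s ((c * e) *s w') = c *s (s *s x + t *s y)" for s t
      unfolding c e by (simp add: vec_eq_iff algebra_simps)
    then show ?thesis using xy c(1) e(1) by (intro exI[of _ "c * e"]) (simp add: proj_pt_scale)
  qed
  have comb: "proj_pt (r1 *s u' + s1 *s v' + t1 *s w') = proj_pt (r2 *s u' + s2 *s v' + t2 *s w') \<Longrightarrow>
     \<exists>c. c \<noteq> 0 \<and> r2 = c * r1 \<and> s2 = c * s1 \<and> t2 = c * t1" for r1 s1 t1 r2 s2 t2
  proof -
    assume "proj_pt (r1 *s u' + s1 *s v' + t1 *s w') = proj_pt (r2 *s u' + s2 *s v' + t2 *s w')"
    then obtain c where c: "c \<noteq> 0" "r2 *s u' + s2 *s v' + t2 *s w' = c *s (r1 *s u' + s1 *s v' + t1 *s w')"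
      unfolding proj_pt_eq_iff by blast
    then have "(r2 - c * r1) *s u' + (s2 - c * s1) *s v' + (t2 - c * t1) *s w' = 0"
      by (simp add: vec_eq_iff algebra_simps)
    from indep'[OF this] c(1) show ?thesis by auto
  qed
  text \<open>The point \<open>r u + s v + t w\<close> lies on two of the lines already controlled, which fixes the scale.\<close>
  obtain k1 where k1: "k1 \<noteq> 0" "\<And>s t. s \<noteq> 0 \<or> t \<noteq> 0 \<Longrightarrow> f (proj_pt (s *s u + t *s w)) = proj_pt (s *s u' + t *s (k1 *s w'))"
    using mixed[of u 1 0 u'] by auto
  obtain k2 where k2: "k2 \<noteq> 0" "\<And>s t. s \<noteq> 0 \<or> t \<noteq> 0 \<Longrightarrow> f (proj_pt (s *s v + t *s w)) = proj_pt (s *s v' + t *s (k2 *s w'))"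
    using mixed[of v 0 1 v'] by auto
  have through_v: "\<exists>m. f (proj_pt (r *s u + s *s v + t *s w)) = proj_pt (r *s u' + (m * s) *s v' + (k1 * t) *s w')"
    if rt: "r \<noteq> 0 \<or> t \<noteq> 0" for r s t
  proof -
    have ind: "x * r + y * 0 = 0 \<Longrightarrow> x * 0 + y * 1 = 0 \<Longrightarrow> x * t + y * 0 = 0 \<Longrightarrow> x = 0 \<and> y = 0" for x y
      using rt by auto
    obtain x y where xy: "\<And>a b. a \<noteq> 0 \<or> b \<noteq> 0 \<Longrightarrow> a *s x + b *s y \<noteq> 0 \<and>
        f (proj_pt (a *s (r *s u + t *s w) + b *s v)) = proj_pt (a *s x + b *s y)"
      using line[of "r *s u + t *s w" r 0 t v 0 1 0, OF _ _ ind] by auto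
    have "proj_pt x = proj_pt (r *s u' + t *s (k1 *s w'))" using xy[of 1 0] k1(2)[OF rt] by simp
    then obtain c where c: "c \<noteq> 0" "r *s u' + t *s (k1 *s w') = c *s x" unfolding proj_pt_eq_iff by blast
    have "proj_pt v' = proj_pt y" using xy[of 0 1] uv[of 0 1] by simp
    then obtain e where e: "e \<noteq> 0" "y = e *s v'" unfolding proj_pt_eq_iff by blast
    have "f (proj_pt (r *s u + s *s v + t *s w)) = proj_pt (x + s *s y)"
      using xy[of 1 s] by (simp add: add_ac)
    also have "\<dots> = proj_pt (c *s (x + s *s y))" using c(1) by (simp add: proj_pt_scale)
    also have "c *s (x + s *s y) = c *s x + ((c * e) * s) *s v'"
      unfolding e by (simp add: vec_eq_iff algebra_simps)
    also have "\<dots> = r *s u' + ((c * e) * s) *s v' + (k1 * t) *s w'"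
      unfolding c(2)[symmetric] by (simp add: vec_eq_iff algebra_simps)
    finally show ?thesis by blast
  qed
  have k1_1: "k1 = 1"
  proof -
    obtain m where "f (proj_pt (1 *s u + 1 *s v + 1 *s w)) = proj_pt (1 *s u' + (m * 1) *s v' + (k1 * 1) *s w')"
      using through_v[of 1 1 1] by auto
    moreover have "f (proj_pt (1 *s u + 1 *s v + 1 *s w)) = proj_pt (1 *s u' + 1 *s v' + 1 *s w')"
      using uvw[of 1 1] by (simp add: add_ac)
    ultimately have "proj_pt (1 *s u' + (m * 1) *s v' + (k1 * 1) *s w') = proj_pt (1 *s u' + 1 *s v' + 1 *s w')" by simp
    from comb[OF this] show ?thesis by auto
  qed
  have main: "f (proj_pt (r *s u + s *s v + t *s w)) = proj_pt (r *s u' + s *s v' + t *s w')"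
    if r: "r \<noteq> 0" for r s t
  proof (cases "t = 0")
    case True
    then show ?thesis using uv[of r s] r by simp
  next
    case False
    obtain k where k: "k \<noteq> 0" "\<And>x y. x \<noteq> 0 \<or> y \<noteq> 0 \<Longrightarrow>
        f (proj_pt (x *s (r *s u + s *s v) + y *s w)) = proj_pt (x *s (r *s u' + s *s v') + y *s (k *s w'))"
      using mixed[of "r *s u + s *s v" r s "r *s u' + s *s v'"] r by auto
    obtain m where m: "f (proj_pt (r *s u + s *s v + t *s w)) = proj_pt (r *s u' + (m * s) *s v' + (k1 * t) *s w')"
      using through_v[of r t s] r by auto
    have e1: "f (proj_pt (r *s u + s *s v + t *s w)) = proj_pt (r *s u' + s *s v' + (k * t) *s w')"
      using k(2)[of 1 t] by (simp add: mult.commute)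
    from comb[OF m[unfolded e1]] have "k = 1" using r False k1_1 by auto
    then show ?thesis using e1 by simp
  qed
  have k2_1: "k2 = 1"
  proof -
    have ind: "x * 0 + y * 1 = 0 \<Longrightarrow> x * 1 + y * 0 = 0 \<Longrightarrow> x * 1 + y * 0 = 0 \<Longrightarrow> x = 0 \<and> y = 0" for x y :: 'k by auto
    obtain x y where xy: "\<And>a b. a \<noteq> 0 \<or> b \<noteq> 0 \<Longrightarrow> a *s x + b *s y \<noteq> 0 \<and>
        f (proj_pt (a *s (v + w) + b *s u)) = proj_pt (a *s x + b *s y)"
      using line[of "v + w" 0 1 1 u 1 0 0, OF _ _ ind] by auto
    have "proj_pt x = proj_pt (v' + k2 *s w')" using xy[of 1 0] k2(2)[of 1 1] by simp
    then obtain c where c: "c \<noteq> 0" "v' + k2 *s w' = c *s x" unfolding proj_pt_eq_iff by blast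
    have "proj_pt u' = proj_pt y" using xy[of 0 1] uv[of 1 0] by simp
    then obtain e where e: "e \<noteq> 0" "y = e *s u'" unfolding proj_pt_eq_iff by blast
    have "f (proj_pt (1 *s u + 1 *s v + 1 *s w)) = proj_pt (x + y)" using xy[of 1 1] by (simp add: add_ac)
    also have "\<dots> = proj_pt (c *s (x + y))" using c(1) by (simp add: proj_pt_scale)
    also have "c *s (x + y) = c *s x + (c * e) *s u'"
      unfolding e by (simp add: vec_eq_iff algebra_simps)
    also have "\<dots> = (c * e) *s u' + 1 *s v' + k2 *s w'"
      unfolding c(2)[symmetric] by (simp add: vec_eq_iff algebra_simps)
    finally have "proj_pt (1 *s u' + 1 *s v' + 1 *s w') = proj_pt ((c * e) *s u' + 1 *s v' + k2 *s w')"
      using main[of 1 1 1] by simp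
    from comb[OF this] show ?thesis by auto
  qed
  show ?thesis
  proof (rule that)
    fix r s t :: 'k assume nz: "r \<noteq> 0 \<or> s \<noteq> 0 \<or> t \<noteq> 0"
    have "r *s u' + s *s v' + t *s w' \<noteq> 0" using indep' nz by blast
    moreover have "f (proj_pt (r *s u + s *s v + t *s w)) = proj_pt (r *s u' + s *s v' + t *s w')"
    proof (cases "r = 0")
      case True
      then show ?thesis using k2(2)[of s t] k2_1 nz by simp
    qed (rule main)
    ultimately show "r *s u' + s *s v' + t *s w' \<noteq> 0 \<and>
      f (proj_pt (r *s u + s *s v + t *s w)) = proj_pt (r *s u' + s *s v' + t *s w')" ..
  qed
qed

end

section \<open>Evaluation of formal polynomials\<close>

lemma exhaust_5:
  fixes x :: 5
  shows "x = 1 \<or> x = 2 \<or> x = 3 \<or> x = 4 \<or> x = 5"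
proof (induct x)
  case (of_int z)
  then have "z = 0 \<or> z = 1 \<or> z = 2 \<or> z = 3 \<or> z = 4" by fastforce
  then show ?case by auto
qed

lemma forall_5: "(\<forall>i::5. P i) \<longleftrightarrow> P 1 \<and> P 2 \<and> P 3 \<and> P 4 \<and> P 5"
  by (metis exhaust_5)

lemma UNIV_5: "UNIV = {1, 2, 3, 4, 5::5}"
  using exhaust_5 by auto

lemma sum_5: "sum h (UNIV :: 5 set) = h 1 + h 2 + h 3 + h 4 + h 5"
  unfolding UNIV_5 by (simp add: ac_simps)

lemma vector_5 [simp]:
  "(vector [p, q, r, s, t] :: 'a::zero ^ 5) $ 1 = p"
  "(vector [p, q, r, s, t] :: 'a::zero ^ 5) $ 2 = q"
  "(vector [p, q, r, s, t] :: 'a::zero ^ 5) $ 3 = r"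
  "(vector [p, q, r, s, t] :: 'a::zero ^ 5) $ 4 = s"
  "(vector [p, q, r, s, t] :: 'a::zero ^ 5) $ 5 = t"
  unfolding vector_def by simp_all

lemma vec_eq_5: "x = y \<longleftrightarrow> x $ 1 = y $ 1 \<and> x $ 2 = y $ 2 \<and> x $ 3 = y $ 3 \<and> x $ 4 = y $ 4 \<and> x $ (5::5) = y $ 5"
  by (simp add: vec_eq_iff forall_5)

definition monomial :: "('n::finite \<Rightarrow>\<^sub>0 nat) \<Rightarrow> 'k::comm_ring_1 ^ 'n \<Rightarrow> 'k" where
  "monomial m v = (\<Prod>i\<in>UNIV. (v $ i) ^ Poly_Mapping.lookup m i)"

lemma monomial_add: "monomial (m + n) v = monomial m v * monomial n v"
  by (simp add: monomial_def lookup_add power_add prod.distrib)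

lemma monomial_zero [simp]: "monomial 0 v = 1"
  by (simp add: monomial_def)

lemma monomial_single: "monomial (Poly_Mapping.single i 1) v = v $ i"
proof -
  have "monomial (Poly_Mapping.single i 1) v = (\<Prod>j\<in>UNIV. if j = i then v $ i else 1)"
    unfolding monomial_def by (rule prod.cong) (auto simp: lookup_single when_def)
  then show ?thesis by simp
qed

text \<open>If \<open>i\<close> does not occur in \<open>m\<close>, the truncated subtraction leaves
  \<open>m\<close> unchanged and the factor \<open>of_nat 0\<close> removes the term.\<close>

definition monomial_diff :: "'n::finite \<Rightarrow> ('n \<Rightarrow>\<^sub>0 nat) \<Rightarrow> 'k::comm_ring_1 ^ 'n \<Rightarrow> 'k" where
  "monomial_diff i m v = of_nat (Poly_Mapping.lookup m i) * monomial (m - Poly_Mapping.single i 1) v"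

lemma monomial_diff_add:
  fixes v :: "'k::comm_ring_1 ^ 'n::finite"
  shows "monomial_diff i (m + n) v = monomial_diff i m v * monomial n v + monomial m v * monomial_diff i n v"
proof -
  define rest where "rest m = (\<Prod>j\<in>UNIV - {i}. (v $ j) ^ Poly_Mapping.lookup m j)" for m
  have split: "monomial m v = (v $ i) ^ Poly_Mapping.lookup m i * rest m" for m
    unfolding monomial_def rest_def by (subst prod.remove[of UNIV i]) auto
  have rest_add: "rest (m + n) = rest m * rest n"
    by (simp add: rest_def lookup_add power_add prod.distrib)
  have rest_minus: "rest (m - Poly_Mapping.single i 1) = rest m" for m
    unfolding rest_def by (rule prod.cong) (auto simp: lookup_minus lookup_single when_def)
  have d: "monomial_diff i m v = of_nat (Poly_Mapping.lookup m i) * (v $ i) ^ (Poly_Mapping.lookup m i - 1) * rest m" for m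
    unfolding monomial_diff_def split rest_minus by (simp add: lookup_minus mult.assoc)
  have pow: "of_nat (p + q) * x ^ (p + q - 1) = of_nat p * x ^ (p - 1) * x ^ q + x ^ p * (of_nat q * x ^ (q - 1))"
    for p q :: nat and x :: 'k
    by (cases p; cases q) (auto simp: power_add algebra_simps)
  show ?thesis unfolding d split rest_add lookup_add pow by (simp add: algebra_simps)
qed

lemma poly_sum_superset:
  assumes "finite S" "Poly_Mapping.keys P \<subseteq> S" "\<And>m. \<phi> m 0 = 0"
  shows "(\<Sum>m\<in>Poly_Mapping.keys P. \<phi> m (Poly_Mapping.lookup P m)) = (\<Sum>m\<in>S. \<phi> m (Poly_Mapping.lookup P m))"
  using assms by (intro sum.mono_neutral_left) (auto simp: in_keys_iff)

text \<open>Both evaluation and evaluation of a partial derivative are of the form \<open>\<Sum> c\<^sub>m \<phi>(m)\<close>.\<close>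

definition lin_ext :: "(('n \<Rightarrow>\<^sub>0 nat) \<Rightarrow> 'k::comm_ring_1) \<Rightarrow> ('n, 'k) polyn \<Rightarrow> 'k" where
  "lin_ext \<phi> P = (\<Sum>m\<in>Poly_Mapping.keys P. Poly_Mapping.lookup P m * \<phi> m)"

lemma lin_ext_add: "lin_ext \<phi> (P + Q) = lin_ext \<phi> P + lin_ext \<phi> Q"
proof -
  let ?S = "Poly_Mapping.keys P \<union> Poly_Mapping.keys Q"
  have "lin_ext \<phi> R = (\<Sum>m\<in>?S. Poly_Mapping.lookup R m * \<phi> m)" if "Poly_Mapping.keys R \<subseteq> ?S" for R
    unfolding lin_ext_def by (rule poly_sum_superset) (use that in auto)
  then show ?thesis
    using Poly_Mapping.keys_add[of P Q] by (simp add: lookup_add distrib_right sum.distrib)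
qed

lemma lin_ext_zero [simp]: "lin_ext \<phi> 0 = 0"
  by (simp add: lin_ext_def)

lemma lin_ext_uminus: "lin_ext \<phi> (- P) = - lin_ext \<phi> P"
  using lin_ext_add[of \<phi> P "- P"] by (simp add: eq_neg_iff_add_eq_0 add.commute)

lemma lin_ext_diff: "lin_ext \<phi> (P - Q) = lin_ext \<phi> P - lin_ext \<phi> Q"
  using lin_ext_add[of \<phi> P "- Q"] by (simp add: lin_ext_uminus)

lemma lin_ext_sum: "lin_ext \<phi> (\<Sum>i\<in>I. P i) = (\<Sum>i\<in>I. lin_ext \<phi> (P i))"
  by (induction I rule: infinite_finite_induct) (auto simp: lin_ext_add)

lemma lin_ext_single: "lin_ext \<phi> (Poly_Mapping.single m c) = c * \<phi> m"
  by (simp add: lin_ext_def)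

lemma polyn_decompose:
  fixes P :: "('n, 'k::comm_ring_1) polyn"
  shows "P = (\<Sum>m\<in>Poly_Mapping.keys P. Poly_Mapping.single m (Poly_Mapping.lookup P m))"
  by (rule poly_mapping_eqI) (simp add: lookup_sum lookup_single when_def in_keys_iff sum.delta')

text \<open>Two bilinear expressions agree once they agree on monomials; multiplicativity of
  evaluation and the Leibniz rule are both obtained this way.\<close>

lemma polyn_mult_induct:
  fixes P Q :: "('n, 'k::comm_ring_1) polyn"
  assumes single: "\<And>m c n d. T (Poly_Mapping.single m c) (Poly_Mapping.single n d)"
    and zero: "\<And>Q. T 0 Q" "\<And>P. T P 0"
    and add: "\<And>P P' Q. T P Q \<Longrightarrow> T P' Q \<Longrightarrow> T (P + P') Q" "\<And>P Q Q'. T P Q \<Longrightarrow> T P Q' \<Longrightarrow> T P (Q + Q')"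
  shows "T P Q"
proof -
  have s1: "(\<And>i. i \<in> I \<Longrightarrow> T (A i) B) \<Longrightarrow> T (\<Sum>i\<in>I. A i) B" for I A B
    by (induction I rule: infinite_finite_induct) (auto intro: zero add)
  have s2: "(\<And>i. i \<in> I \<Longrightarrow> T B (A i)) \<Longrightarrow> T B (\<Sum>i\<in>I. A i)" for I A B
    by (induction I rule: infinite_finite_induct) (auto intro: zero add)
  show ?thesis
    by (subst polyn_decompose, rule s1, subst polyn_decompose[of Q], rule s2, rule single)
qed

lemma eval_polyn_lin_ext: "eval_polyn P v = lin_ext (\<lambda>m. monomial m v) P"
  by (simp add: eval_polyn_def lin_ext_def monomial_def)

lemma eval_partial_deriv: "eval_polyn (partial_deriv i P) v = lin_ext (\<lambda>m. monomial_diff i m v) P"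
  unfolding eval_polyn_lin_ext partial_deriv_def lin_ext_sum lin_ext_single
  by (simp add: lin_ext_def monomial_diff_def mult_ac)

lemma eval_add: "eval_polyn (P + Q) v = eval_polyn P v + eval_polyn Q v"
  and eval_diff: "eval_polyn (P - Q) v = eval_polyn P v - eval_polyn Q v"
  and eval_Const: "eval_polyn (Const c) v = c"
  and eval_Var: "eval_polyn (Var j) v = v $ j"
  unfolding eval_polyn_lin_ext Const_def Var_def
  by (simp_all only: lin_ext_add lin_ext_diff lin_ext_single monomial_single monomial_zero mult_1 mult_1_right)

lemma eval_mult: "eval_polyn (P * Q) v = eval_polyn P v * eval_polyn Q v"
  unfolding eval_polyn_lin_ext
  by (rule polyn_mult_induct[of "\<lambda>P Q. lin_ext (\<lambda>m. monomial m v) (P * Q) = lin_ext (\<lambda>m. monomial m v) P * lin_ext (\<lambda>m. monomial m v) Q"])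
    (simp_all add: mult_single lin_ext_single lin_ext_add monomial_add algebra_simps)

lemma eval_sum: "eval_polyn (\<Sum>i\<in>I. P i) v = (\<Sum>i\<in>I. eval_polyn (P i) v)"
  by (simp add: eval_polyn_lin_ext lin_ext_sum)

lemma diff_add: "eval_polyn (partial_deriv i (P + Q)) v = eval_polyn (partial_deriv i P) v + eval_polyn (partial_deriv i Q) v"
  and diff_diff: "eval_polyn (partial_deriv i (P - Q)) v = eval_polyn (partial_deriv i P) v - eval_polyn (partial_deriv i Q) v"
  by (simp_all only: eval_partial_deriv lin_ext_add lin_ext_diff)

lemma diff_mult: "eval_polyn (partial_deriv i (P * Q)) v =
    eval_polyn (partial_deriv i P) v * eval_polyn Q v + eval_polyn P v * eval_polyn (partial_deriv i Q) v"
  unfolding eval_partial_deriv unfolding eval_polyn_lin_ext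
  by (rule polyn_mult_induct[of "\<lambda>P Q. lin_ext (\<lambda>m. monomial_diff i m v) (P * Q) =
      lin_ext (\<lambda>m. monomial_diff i m v) P * lin_ext (\<lambda>m. monomial m v) Q + lin_ext (\<lambda>m. monomial m v) P * lin_ext (\<lambda>m. monomial_diff i m v) Q"])
    (simp_all add: mult_single lin_ext_single lin_ext_add monomial_diff_add algebra_simps)

lemma diff_Const: "eval_polyn (partial_deriv i (Const c)) v = 0"
  unfolding eval_partial_deriv Const_def lin_ext_single by (simp add: monomial_diff_def)

lemma diff_Var: "eval_polyn (partial_deriv i (Var j)) v = (if i = j then 1 else 0)"
  unfolding eval_partial_deriv Var_def lin_ext_single
  by (simp add: monomial_diff_def lookup_single when_def)

lemma eval_poly_fun: "poly_fun (\<lambda>v. eval_polyn P v)"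
  unfolding eval_polyn_def by (intro pf_intros)

lemma eval_homog:
  fixes P :: "('n::finite, 'k::field_char_0) polyn"
  assumes "homogeneous d P"
  shows "homog d (\<lambda>v. eval_polyn P v)"
  unfolding homog_def
proof (intro allI impI)
  fix c :: 'k and v :: "'k ^ 'n"
  have "Poly_Mapping.lookup P m * (\<Prod>i\<in>UNIV. ((c *s v) $ i) ^ Poly_Mapping.lookup m i) =
      c ^ d * (Poly_Mapping.lookup P m * (\<Prod>i\<in>UNIV. (v $ i) ^ Poly_Mapping.lookup m i))"
    if "m \<in> Poly_Mapping.keys P" for m
    using assms that by (simp add: homogeneous_def power_mult_distrib prod.distrib flip: power_sum)
  then show "eval_polyn P (c *s v) = c ^ d * eval_polyn P v"
    unfolding eval_polyn_def sum_distrib_left by (intro sum.cong) auto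
qed

section \<open>The cubic form\<close>

definition cub :: "'k::field \<Rightarrow> 'k \<Rightarrow> 'k ^ 5 \<Rightarrow> 'k" where
  "cub a b x = (a * x$1 + x$2 + b * x$3) * x$4 * x$5 + x$4 * (x$3 * x$3 - x$1 * x$1) + x$5 * (x$3 * x$3 - x$2 * x$2)"

definition dcub :: "'k::field \<Rightarrow> 'k \<Rightarrow> 'k ^ 5 \<Rightarrow> 'k ^ 5 \<Rightarrow> 'k" where
  "dcub a b x v = (a * v$1 + v$2 + b * v$3) * x$4 * x$5 + (a * x$1 + x$2 + b * x$3) * (v$4 * x$5 + x$4 * v$5)
    + v$4 * (x$3 * x$3 - x$1 * x$1) + x$4 * (2 * x$3 * v$3 - 2 * x$1 * v$1)
    + v$5 * (x$3 * x$3 - x$2 * x$2) + x$5 * (2 * x$3 * v$3 - 2 * x$2 * v$2)"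

lemma eval_cubic_form: "eval_polyn (cubic_form a b) v = cub a b v"
  unfolding cubic_form_def cub_def power2_eq_square
  by (simp only: eval_add eval_diff eval_mult eval_Const eval_Var)

lemma eval_diff_cubic_form: "eval_polyn (partial_deriv i (cubic_form a b)) v = dcub a b v (axis i 1)"
  unfolding cubic_form_def dcub_def power2_eq_square
  by (simp only: diff_add diff_diff diff_mult diff_Const diff_Var eval_add eval_diff eval_mult eval_Const eval_Var)
    (simp add: axis_def algebra_simps)

lemma pd_cub: "poly_deriv (cub a b) (dcub a b)"
proof -
  have "(\<lambda>x v. ((((a * x$1 + x$2 + b * x$3) * x$4) * v$5
        + ((a * x$1 + x$2 + b * x$3) * v$4 + ((a * v$1 + 0 * x$1) + v$2 + (b * v$3 + 0 * x$3)) * x$4) * x$5)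
      + (x$4 * ((x$3 * v$3 + v$3 * x$3) - (x$1 * v$1 + v$1 * x$1)) + v$4 * (x$3 * x$3 - x$1 * x$1)))
      + (x$5 * ((x$3 * v$3 + v$3 * x$3) - (x$2 * v$2 + v$2 * x$2)) + v$5 * (x$3 * x$3 - x$2 * x$2))) = dcub a b"
    by (intro ext) (simp add: dcub_def algebra_simps)
  then show ?thesis
    unfolding cub_def[abs_def] by (elim subst) (intro pd_add pd_diff pd_mult pd_coord pd_const)
qed

lemma pf_cub: "poly_fun (cub a b)"
  by (rule pd_poly_fun[OF pd_cub])

lemma cub_expand: "cub a b (y + t *s z) = cub a b y + t * dcub a b y z + t\<^sup>2 * dcub a b z y + t ^ 3 * cub a b z"
  unfolding cub_def dcub_def vector_add_component vector_smult_component by algebra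

lemma cub_homog: "homog 3 (cub a b)"
  unfolding homog_def cub_def vector_smult_component by (auto; algebra)

text \<open>Each test point \<open>z\<close> is chosen so that the differential at \<open>z\<close>
  in the direction \<open>y\<close> is a multiple of one coordinate of \<open>y\<close>, once the
  earlier ones are known to vanish.\<close>

lemma dcub_not_cone:
  fixes a b :: "'k::field_char_0"
  assumes "\<And>z. dcub a b z y = 0"
  shows "y = 0"
proof -
  have "y $ 4 = 0" using assms[of "vector [1, 0, 0, 0, 0]"] by (simp add: dcub_def)
  moreover have "y $ 5 = 0" using assms[of "vector [0, 1, 0, 0, 0]"] by (simp add: dcub_def)
  moreover have "y $ 3 = 0" using assms[of "vector [0, 0, 1, 1, 0]"] calculation by (simp add: dcub_def)
  moreover have "y $ 1 = 0" using assms[of "vector [1, 0, 0, 1, 0]"] calculation by (simp add: dcub_def)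
  moreover have "y $ 2 = 0" using assms[of "vector [0, 1, 0, 0, 1]"] calculation by (simp add: dcub_def)
  ultimately show ?thesis by (simp add: vec_eq_5)
qed

lemma proj_pt_mem_hypersurface:
  "proj_pt x \<in> hypersurface (cubic_form a b) \<longleftrightarrow> x \<noteq> 0 \<and> cub a b x = 0"
proof -
  have "proj_pt x \<in> (proj_space :: ('a ^ 5) set set) \<longleftrightarrow> x \<noteq> 0"
    unfolding proj_space_def by (auto simp: proj_pt_eq_iff) (metis vec.scale_one zero_neq_one)
  moreover have "(\<forall>v\<in>proj_pt x. cub a b v = 0) \<longleftrightarrow> cub a b x = 0"
    unfolding proj_pt_def using homogD[OF cub_homog, of _ a b x] by (auto intro!: exI[of _ 1])
  ultimately show ?thesis by (simp add: hypersurface_def eval_cubic_form)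
qed

lemma hypersurface_cases:
  assumes "p \<in> hypersurface (cubic_form a b)"
  obtains x where "p = proj_pt x" "x \<noteq> 0" "cub a b x = 0"
proof -
  obtain x where "p = proj_pt x" using assms unfolding hypersurface_def proj_space_def by auto
  with that assms proj_pt_mem_hypersurface show ?thesis by metis
qed

lemma singular_points_eq:
  fixes a b :: "'k::field_char_0"
  shows "singular_points (cubic_form a b) = {proj_pt x |x. x \<noteq> 0 \<and> cub a b x = 0 \<and> (\<forall>z. dcub a b x z = 0)}"
proof -
  have ax: "(\<forall>i. dcub a b x (axis i 1) = 0) \<longleftrightarrow> (\<forall>z. dcub a b x z = 0)" for x
    using pd_linear_axis[OF pd_cub, of a b x] by (metis (no_types, lifting) mult_zero_right sum.neutral)
  have "homog 2 (\<lambda>x. dcub a b x z)" for z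
    using homog_deriv[OF pd_cub[of a b], of 2 z] cub_homog[of a b] by (simp add: numeral_3_eq_3 numeral_2_eq_2)
  then have sc: "dcub a b (c *s x) z = c\<^sup>2 * dcub a b x z" if "c \<noteq> 0" for c x z
    using homogD[of 2 "\<lambda>x. dcub a b x z" c] that by blast
  have "(\<forall>v\<in>proj_pt x. \<forall>i. dcub a b v (axis i 1) = 0) \<longleftrightarrow> (\<forall>z. dcub a b x z = 0)" for x
    unfolding ax proj_pt_def using sc by (auto intro!: exI[of _ 1])
  then have "proj_pt x \<in> singular_points (cubic_form a b) \<longleftrightarrow> x \<noteq> 0 \<and> cub a b x = 0 \<and> (\<forall>z. dcub a b x z = 0)" for x
    by (simp add: singular_points_def proj_pt_mem_hypersurface eval_diff_cubic_form)
  moreover have "p \<in> singular_points (cubic_form a b) \<Longrightarrow> \<exists>x. p = proj_pt x" for p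
    unfolding singular_points_def by (auto elim: hypersurface_cases)
  ultimately show ?thesis by blast
qed

section \<open>Functions vanishing on the cubic threefold\<close>

definition upd :: "'k ^ 'n \<Rightarrow> 'n \<Rightarrow> 'k \<Rightarrow> 'k ^ 'n" where
  "upd x i c = (\<chi> j. if j = i then c else x $ j)"

lemma upd_nth: "upd x i c $ j = (if j = i then c else x $ j)"
  by (simp add: upd_def)

lemma indep_upd: "indep i f \<Longrightarrow> f (upd x i c) = f x"
  by (rule indepD) (auto simp: upd_def)

context
  fixes a b :: "'k::field_char_0"
  assumes a: "a \<noteq> 0"
begin

text \<open>Write \<open>F = q x\<^sub>5 + c\<close>, where \<open>q\<close> in turn is linear in \<open>x\<^sub>1\<close>.\<close>

definition qq :: "'k ^ 5 \<Rightarrow> 'k" where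
  "qq x = (a * x$1 + x$2 + b * x$3) * x$4 + x$3 * x$3 - x$2 * x$2"

definition cc :: "'k ^ 5 \<Rightarrow> 'k" where
  "cc x = x$4 * (x$3 * x$3 - x$1 * x$1)"

lemma cub_split: "cub a b x = qq x * x$5 + cc x"
  by (simp add: cub_def qq_def cc_def algebra_simps)

lemma pf_qq: "poly_fun qq" and pf_cc: "poly_fun cc"
  and indep_qq: "indep 5 qq" and indep_cc: "indep 5 cc"
  unfolding qq_def[abs_def] cc_def[abs_def] by (intro pf_intros | simp add: indep_def)+

text \<open>At x4 = 0 the form \<open>qq\<close> becomes x3^2 - x2^2, which is not zero; so x4
  divides \<open>A'\<close> and can be cancelled from both sides, once for each power.\<close>

lemma x4_cancel:
  assumes "poly_fun A" "poly_fun A'" "\<And>x. (a * x$4) ^ N * A x = A' x * qq x"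
  shows "\<exists>W. poly_fun W \<and> (\<forall>x. A x = W x * qq x)"
  using assms(2,3)
proof (induction N arbitrary: A')
  case 0
  then show ?case by auto
next
  case (Suc N)
  obtain A'' B where A'': "poly_fun A''" "poly_fun B" "indep 4 B" "\<And>x. A' x = A'' x * x$4 + B x"
    using pf_coord_division[OF Suc.prems(1), of 4] by metis
  have "B x * (x$3 * x$3 - x$2 * x$2) = 0" for x
  proof -
    have "0 = A' (upd x 4 0) * qq (upd x 4 0)" using Suc.prems(2)[of "upd x 4 0"] by (simp add: upd_nth)
    then show ?thesis by (simp add: A''(4) indep_upd[OF A''(3)] upd_nth qq_def)
  qed
  moreover have "poly_fun (\<lambda>x::'k ^ 5. x$3 * x$3 - x$2 * x$2)" by (intro pf_intros)
  moreover have "\<not> (\<forall>x::'k ^ 5. x$3 * x$3 - x$2 * x$2 = 0)"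
    by (intro notI) (drule spec[of _ "vector [0, 0, 1, 0, 0]"], simp)
  ultimately have B: "B x = 0" for x using pf_no_zero_divisors[OF A''(2)] by blast
  have "x$4 * (a * ((a * x$4) ^ N * A x) - A'' x * qq x) = 0" for x
    using Suc.prems(2)[of x] unfolding A''(4) B by (simp add: algebra_simps)
  moreover have "poly_fun (\<lambda>x. a * ((a * x$4) ^ N * A x) - A'' x * qq x)"
    by (intro pf_intros assms A'' pf_qq)
  moreover have "\<not> (\<forall>x::'k ^ 5. x$4 = 0)"
    by (intro notI) (drule spec[of _ "vector [0, 0, 0, 1, 0]"], simp)
  ultimately have "a * ((a * x$4) ^ N * A x) - A'' x * qq x = 0" for x
    using pf_no_zero_divisors[OF pf_coord] by blast
  then have "(a * x$4) ^ N * A x = ((1 / a) * A'' x) * qq x" for x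
    using a by (simp add: field_simps)
  moreover have "poly_fun (\<lambda>x. (1 / a) * A'' x)" by (intro pf_intros A'')
  ultimately show ?case using Suc.IH[of "\<lambda>x. (1 / a) * A'' x"] by blast
qed

text \<open>Where x4 is nonzero, qq = 0 can be solved for x1. Substituting the root kills the
  product of the pseudo-remainder with \<kappa>, which is \<open>cc\<close> at that root with
  denominators cleared. Hence the remainder is zero, and \<open>x4_cancel\<close> removes the powers
  of x4.\<close>

lemma qq_divides:
  assumes "poly_fun A" "\<And>x. qq x = 0 \<Longrightarrow> A x * cc x = 0"
  shows "\<exists>W. poly_fun W \<and> (\<forall>x. A x = W x * qq x)"
proof -
  define \<beta> :: "'k ^ 5 \<Rightarrow> 'k" where "\<beta> x = (x$2 + b * x$3) * x$4 + x$3 * x$3 - x$2 * x$2" for x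
  have "poly_fun \<beta>" "indep 1 \<beta>" "poly_fun (\<lambda>x::'k ^ 5. a * x$4)" "indep 1 (\<lambda>x::'k ^ 5. a * x$4)"
    unfolding \<beta>_def[abs_def] by (intro pf_intros | simp add: indep_def)+
  then obtain N A' B where AB: "poly_fun A'" "poly_fun B" "indep 1 B"
    "\<And>x. (a * x$4) ^ N * A x = A' x * (a * x$4 * x$1 + \<beta> x) + B x"
    using pf_pseudo_division[OF assms(1), of "\<lambda>x. a * x$4" 1 \<beta>] by metis
  have q: "a * x$4 * x$1 + \<beta> x = qq x" for x by (simp add: \<beta>_def qq_def algebra_simps)
  define \<kappa> where "\<kappa> x = x$4 * ((a * x$4 * x$3)\<^sup>2 - (\<beta> x)\<^sup>2)" for x
  have "B x * \<kappa> x = 0" for x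
  proof (cases "x$4 = 0")
    case False
    define y where "y = upd x 1 (- \<beta> x / (a * x$4))"
    have \<beta>y: "\<beta> y = \<beta> x" by (simp add: y_def \<beta>_def upd_nth)
    have "qq y = 0" unfolding q[symmetric] \<beta>y using False a by (simp add: y_def upd_nth)
    then have "B x * cc y = 0"
      using assms(2)[of y] AB(4)[of y] indep_upd[OF AB(3), of x] unfolding q by (metis add_0 mult.assoc mult_zero_right y_def)
    moreover have "cc y * (a * x$4)\<^sup>2 = \<kappa> x"
      using False a by (simp add: cc_def \<kappa>_def y_def upd_nth field_simps power2_eq_square)
    ultimately show ?thesis by (metis mult.assoc mult_zero_left)
  qed (simp add: \<kappa>_def)
  moreover have "poly_fun \<kappa>" unfolding \<kappa>_def[abs_def] \<beta>_def by (intro pf_intros)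
  moreover have "\<not> (\<forall>x. \<kappa> x = 0)"
    by (intro notI) (drule spec[of _ "vector [0, 1, 0, 2, 0]"], simp add: \<kappa>_def \<beta>_def)
  ultimately have "B x = 0" for x using pf_no_zero_divisors[OF AB(2)] by blast
  then show ?thesis using x4_cancel[OF assms(1) AB(1), of N] AB(4) unfolding q by simp
qed

lemma qq_nonzero: "\<not> (\<forall>x. qq x = 0)"
  by (intro notI) (drule spec[of _ "vector [0, 0, 1, 0, 0]"], simp add: qq_def)

text \<open>The cubic is qq x5 + cc, so on qq = 0 the identity reduces to A cc = 0. Therefore
  \<open>qq\<close> divides \<open>A\<close>, and one power cancels.\<close>

lemma qq_cancel:
  assumes "poly_fun P" "poly_fun A" "\<And>x. qq x ^ N * P x = A x * cub a b x"
  shows "\<exists>W. poly_fun W \<and> (\<forall>x. P x = cub a b x * W x)"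
  using assms(2,3)
proof (induction N arbitrary: A)
  case 0
  then show ?case by (auto simp: mult.commute)
next
  case (Suc N)
  have "A x * cc x = 0" if "qq x = 0" for x using Suc.prems(2)[of x] that by (simp add: cub_split)
  then obtain W where W: "poly_fun W" "\<And>x. A x = W x * qq x" using qq_divides[OF Suc.prems(1)] by blast
  have "qq x * (qq x ^ N * P x - W x * cub a b x) = 0" for x
    using Suc.prems(2)[of x] unfolding W(2) by (simp add: algebra_simps)
  moreover have "poly_fun (\<lambda>x. qq x ^ N * P x - W x * cub a b x)"
    by (intro pf_intros assms W pf_qq pf_cub)
  ultimately have "qq x ^ N * P x - W x * cub a b x = 0" for x
    using pf_no_zero_divisors[OF pf_qq] qq_nonzero by blast
  then show ?case using Suc.IH[OF W(1)] by simp
qed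

lemma solve_x5:
  assumes "qq x \<noteq> 0"
  shows "cub a b (upd x 5 (- cc x / qq x)) = 0"
  using assms by (simp add: cub_split indep_upd[OF indep_qq] indep_upd[OF indep_cc] upd_nth)

text \<open>This is primality of the ideal of the cubic. Pseudo-division by the cubic leaves
  remainders without x5, and x5 = -cc/qq lifts every choice of the other coordinates with qq nonzero
  to X. So the product of the remainders vanishes, and one of them is zero.\<close>

lemma vanish_product:
  assumes "poly_fun S" "poly_fun T" "\<And>x. cub a b x = 0 \<Longrightarrow> S x * T x = 0"
  shows "(\<exists>W. poly_fun W \<and> (\<forall>x. S x = cub a b x * W x)) \<or> (\<exists>W. poly_fun W \<and> (\<forall>x. T x = cub a b x * W x))"
proof -
  obtain N A B where AB: "poly_fun A" "poly_fun B" "indep 5 B" "\<And>x. qq x ^ N * S x = A x * cub a b x + B x"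
    using pf_pseudo_division[OF assms(1) pf_qq indep_qq pf_cc indep_cc] unfolding cub_split by metis
  obtain M C D where CD: "poly_fun C" "poly_fun D" "indep 5 D" "\<And>x. qq x ^ M * T x = C x * cub a b x + D x"
    using pf_pseudo_division[OF assms(2) pf_qq indep_qq pf_cc indep_cc] unfolding cub_split by metis
  have "(B x * D x) * qq x = 0" for x
  proof (cases "qq x = 0")
    case False
    define y where "y = upd x 5 (- cc x / qq x)"
    have y: "cub a b y = 0" unfolding y_def by (rule solve_x5[OF False])
    have "B x * D x = B y * D y" unfolding y_def by (simp add: indep_upd[OF AB(3)] indep_upd[OF CD(3)])
    also have "\<dots> = (qq y ^ N * S y) * (qq y ^ M * T y)" unfolding AB(4) CD(4) y by simp
    also have "\<dots> = 0" using assms(3)[OF y] by auto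
    finally show ?thesis by simp
  qed simp
  then have "B x * D x = 0" for x
    using pf_no_zero_divisors[OF pf_mult[OF AB(2) CD(2)] pf_qq] qq_nonzero by blast
  then consider "\<forall>x. B x = 0" | "\<forall>x. D x = 0"
    using pf_no_zero_divisors[OF AB(2) CD(2)] by blast
  then show ?thesis
  proof cases
    case 1
    then show ?thesis using qq_cancel[OF assms(1) AB(1), of N] AB(4) by simp
  next
    case 2
    then show ?thesis using qq_cancel[OF assms(2) CD(1), of M] CD(4) by simp
  qed
qed

text \<open>Primality is applied to 1 and \<open>P\<close>; the cubic cannot divide 1, as it
  vanishes at the origin.\<close>

lemma cub_null:
  assumes "poly_fun P" "\<And>x. cub a b x = 0 \<Longrightarrow> P x = 0"
  shows "\<exists>W. poly_fun W \<and> (\<forall>x. P x = cub a b x * W x)"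
proof -
  have "(\<exists>W. poly_fun W \<and> (\<forall>x. (1 :: 'k) = cub a b x * W x)) \<or> ?thesis"
    by (rule vanish_product[OF pf_const assms(1)]) (use assms(2) in simp)
  moreover have "cub a b 0 = 0" by (simp add: cub_def)
  ultimately show ?thesis by (metis mult_zero_left zero_neq_one)
qed

lemma cub_prime:
  assumes "poly_fun S" "poly_fun T" "\<And>x. cub a b x = 0 \<Longrightarrow> S x * T x = 0"
  shows "(\<forall>x. cub a b x = 0 \<longrightarrow> S x = 0) \<or> (\<forall>x. cub a b x = 0 \<longrightarrow> T x = 0)"
  using vanish_product[OF assms] by auto

end

section \<open>Automorphisms are linear\<close>

lemma singular_line:
  fixes a b :: "'k::field_char_0"
  assumes fin: "finite (singular_points (cubic_form a b))"
    and indep: "\<And>s t. s *s u + t *s v = 0 \<Longrightarrow> s = 0 \<and> t = 0"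
  shows "\<exists>t z. dcub a b (u + t *s v) z \<noteq> 0"
proof (rule ccontr)
  assume "\<not> ?thesis"
  then have sing: "dcub a b (u + t *s v) z = 0" for t z by blast
  have "cub a b (u + t *s v) = 0" for t
    using pd_euler[OF pd_cub cub_homog, of a b "u + t *s v"] sing by simp
  moreover have "u + t *s v \<noteq> 0" for t using indep[of 1 t] by auto
  ultimately have "range (\<lambda>t. proj_pt (u + t *s v)) \<subseteq> singular_points (cubic_form a b)"
    unfolding singular_points_eq using sing by auto
  moreover have "inj (\<lambda>t. proj_pt (u + t *s v))"
  proof (rule injI)
    fix s t assume "proj_pt (u + s *s v) = proj_pt (u + t *s v)"
    then obtain c where "u + t *s v = c *s (u + s *s v)" unfolding proj_pt_eq_iff by blast
    then have "(1 - c) *s u + (t - c * s) *s v = 0" by (simp add: vec_eq_iff algebra_simps)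
    from indep[OF this] show "s = t" by simp
  qed
  ultimately show False
    using fin infinite_UNIV_char_0[where 'a='k] by (meson finite_imageD finite_subset)
qed

lemma cubic_threefold_cub:
  fixes a b :: "'k::{alg_closed_field, field_char_0}"
  assumes "a \<noteq> 0" "finite (singular_points (cubic_form a b))"
  shows "cubic_threefold (cub a b) (dcub a b)"
proof
  show "\<exists>x. cub a b x \<noteq> 0"
    by (rule exI[of _ "vector [0, 0, 1, 1, 0]"]) (simp add: cub_def)
  show "\<exists>W. poly_fun W \<and> (\<forall>x. P x = cub a b x * W x)"
    if "poly_fun P" "\<And>x. cub a b x = 0 \<Longrightarrow> P x = 0" for P
    by (rule cub_null[OF assms(1) that])
  show "y = 0" if "\<And>z. dcub a b z y = 0" for y by (rule dcub_not_cone[OF that])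
  show "\<exists>t z. dcub a b (u + t *s v) z \<noteq> 0" if "\<And>s t. s *s u + t *s v = 0 \<Longrightarrow> s = 0 \<and> t = 0" for u v
    by (rule singular_line[OF assms(2) that])
qed (rule pd_cub cub_expand cub_homog)+

text \<open>The local formula is multiplied by \<open>g\<close>, which hides the points where it is
  not valid, and by x_j^3, which brings the degree to at least three; x_j is nonzero at the given
  point.\<close>

lemma regular_lift:
  fixes a b :: "'k::{alg_closed_field, field_char_0}"
  assumes T: "cubic_threefold (cub a b) (dcub a b)" and X: "X = hypersurface (cubic_form a b)"
    and reg: "regular_map X X f" and x: "cub a b x = 0" "x \<noteq> 0"
  shows "\<exists>d Q. cubic_threefold.lift (cub a b) f d Q \<and> Q x \<noteq> 0"
proof -
  interpret cubic_threefold "cub a b" "dcub a b" by (rule T)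
  have mem: "proj_pt y \<in> X \<longleftrightarrow> y \<noteq> 0 \<and> cub a b y = 0" for y
    unfolding X by (rule proj_pt_mem_hypersurface)
  have self: "y \<in> proj_pt y" for y :: "'k ^ 5" unfolding proj_pt_def by (auto intro!: exI[of _ 1])
  have "proj_pt x \<in> X" using mem x by blast
  from bspec[OF conjunct2[OF reg[unfolded regular_map_def]] this]
  obtain g e R d where gR: "homogeneous e g \<and> (\<forall>i. homogeneous d (R i)) \<and> (\<forall>v\<in>proj_pt x. eval_polyn g v \<noteq> 0) \<and>
      (\<forall>q\<in>X. \<forall>v\<in>q. eval_polyn g v \<noteq> 0 \<longrightarrow>
         (\<chi> i. eval_polyn (R i) v) \<noteq> 0 \<and> f q = proj_pt (\<chi> i. eval_polyn (R i) v))"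
    by (elim exE)
  then have g: "homogeneous e g" "\<And>i. homogeneous d (R i)" "\<forall>v\<in>proj_pt x. eval_polyn g v \<noteq> 0"
    and R: "\<And>q v. q \<in> X \<Longrightarrow> v \<in> q \<Longrightarrow> eval_polyn g v \<noteq> 0 \<Longrightarrow>
      (\<chi> i. eval_polyn (R i) v) \<noteq> 0 \<and> f q = proj_pt (\<chi> i. eval_polyn (R i) v)"
    by blast+
  obtain j where j: "x $ j \<noteq> 0" using x by (auto simp: vec_eq_iff)
  define S where "S y = (\<chi> i. eval_polyn (R i) y)" for y
  define Q where "Q y = ((y $ j) ^ 3 * eval_polyn g y) *s S y" for y
  have S: "S y \<noteq> 0" "f (proj_pt y) = proj_pt (S y)" "cub a b (S y) = 0"
    if "cub a b y = 0" "y \<noteq> 0" "eval_polyn g y \<noteq> 0" for y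
  proof -
    have y: "proj_pt y \<in> X" using that mem by blast
    show "S y \<noteq> 0" "f (proj_pt y) = proj_pt (S y)" using R[OF y self that(3)] unfolding S_def by auto
    moreover have "f (proj_pt y) \<in> X" using reg y unfolding regular_map_def by auto
    ultimately show "cub a b (S y) = 0" using mem by auto
  qed
  have Qnz: "y \<noteq> 0 \<and> eval_polyn g y \<noteq> 0 \<and> (y $ j) ^ 3 * eval_polyn g y \<noteq> 0" if "Q y \<noteq> 0" for y
    using that unfolding Q_def by (cases "y $ j = 0") auto
  have Qi: "Q y $ i = (y $ j) ^ 3 * eval_polyn g y * eval_polyn (R i) y" for y i
    by (simp add: Q_def S_def)
  have "lift f (3 + e + d) Q"
    unfolding lift_def
  proof (intro conjI allI impI)
    show "poly_fun (\<lambda>y. Q y $ i)" for i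
      unfolding Qi by (intro pf_intros eval_poly_fun)
    show "homog (3 + e + d) (\<lambda>y. Q y $ i)" for i
      unfolding Qi homog_def using homogD[OF eval_homog[OF g(1)]] homogD[OF eval_homog[OF g(2)]]
      by (simp add: power_add power_mult_distrib)
    fix y assume y: "cub a b y = 0"
    show "cub a b (Q y) = 0"
    proof (cases "Q y = 0")
      case False
      have "cub a b (Q y) = ((y $ j) ^ 3 * eval_polyn g y) ^ 3 * cub a b (S y)"
        unfolding Q_def by (rule homogD[OF cub_homog]) (use Qnz[OF False] in blast)
      then show ?thesis using S(3)[OF y] Qnz[OF False] by simp
    qed (simp add: cub_def)
    show "f (proj_pt y) = proj_pt (Q y)" if "Q y \<noteq> 0"
      using S(2)[OF y] Qnz[OF that] by (simp add: Q_def proj_pt_scale)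
  qed simp
  moreover have "Q x \<noteq> 0"
    using g(3) self[of x] j S(1)[OF x] by (simp add: Q_def)
  ultimately show ?thesis by blast
qed

lemma aut_cubic_automorphism:
  fixes a b :: "'k::{alg_closed_field, field_char_0}"
  assumes T: "cubic_threefold (cub a b) (dcub a b)" and X: "X = hypersurface (cubic_form a b)"
    and f: "f \<in> carrier (aut_group X)"
  shows "cubic_automorphism (cub a b) (dcub a b) f (inv_into X f)"
proof -
  interpret cubic_threefold "cub a b" "dcub a b" by (rule T)
  have bij: "bij_betw f X X" and reg: "regular_map X X f" "regular_map X X (inv_into X f)"
    using f by (auto simp: aut_group_def Bij_def)
  show ?thesis
  proof
    fix x assume x: "cub a b x = 0" "x \<noteq> 0"
    then have "proj_pt x \<in> X" unfolding X by (simp add: proj_pt_mem_hypersurface)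
    then show "inv_into X f (f (proj_pt x)) = proj_pt x" "f (inv_into X f (proj_pt x)) = proj_pt x"
      using bij by (auto simp: bij_betw_inv_into_left bij_betw_inv_into_right)
    show "\<exists>d Q. lift f d Q \<and> Q x \<noteq> 0" "\<exists>d Q. lift (inv_into X f) d Q \<and> Q x \<noteq> 0"
      using regular_lift[OF T X _ x] reg by blast+
  qed
qed

text \<open>The frame argument on a projective line: comparison at x, y and x + y leaves one common
  scalar. It glues linear maps on two planes along their common line.\<close>

lemma pencil_scale:
  assumes nz: "\<And>r s. r \<noteq> 0 \<or> s \<noteq> 0 \<Longrightarrow> r *s x + s *s y \<noteq> 0"
    and eq: "\<And>r s. r \<noteq> 0 \<or> s \<noteq> 0 \<Longrightarrow> proj_pt (r *s x + s *s y) = proj_pt (r *s x' + s *s y')"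
  obtains c where "c \<noteq> 0" "x' = c *s x" "y' = c *s y"
proof -
  have "proj_pt x = proj_pt x'" "proj_pt y = proj_pt y'" "proj_pt (x + y) = proj_pt (x' + y')"
    using eq[of 1 0] eq[of 0 1] eq[of 1 1] by simp_all
  then obtain c d e where c: "c \<noteq> 0" "x' = c *s x" and d: "y' = d *s y" and e: "x' + y' = e *s (x + y)"
    unfolding proj_pt_eq_iff by blast
  have "(c - e) *s x + (d - e) *s y = 0"
    using e unfolding c d by (simp add: vec_eq_iff algebra_simps)
  then have "c - e = 0 \<and> d - e = 0" using nz by blast
  with c d that show ?thesis by simp
qed

context cubic_automorphism
begin

lemma plane_extend:
  assumes indep: "\<And>r s t. r *s u + s *s v + t *s w = 0 \<Longrightarrow> r = 0 \<and> s = 0 \<and> t = 0"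
    and onX: "\<And>r s t. F (r *s u + s *s v + t *s w) = 0"
    and uv: "\<And>r s. r \<noteq> 0 \<or> s \<noteq> 0 \<Longrightarrow> f (proj_pt (r *s u + s *s v)) = proj_pt (r *s u' + s *s v')"
  obtains w' where "\<And>r s t. r \<noteq> 0 \<or> s \<noteq> 0 \<or> t \<noteq> 0 \<Longrightarrow>
    r *s u' + s *s v' + t *s w' \<noteq> 0 \<and>
    f (proj_pt (r *s u + s *s v + t *s w)) = proj_pt (r *s u' + s *s v' + t *s w')"
proof -
  obtain x y z where xyz: "\<And>r s t. r \<noteq> 0 \<or> s \<noteq> 0 \<or> t \<noteq> 0 \<Longrightarrow>
    r *s x + s *s y + t *s z \<noteq> 0 \<and>
    f (proj_pt (r *s u + s *s v + t *s w)) = proj_pt (r *s x + s *s y + t *s z)"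
    using plane_image[OF indep onX] by blast
  have 1: "r *s x + s *s y \<noteq> 0 \<and> proj_pt (r *s x + s *s y) = proj_pt (r *s u' + s *s v')"
    if "r \<noteq> 0 \<or> s \<noteq> 0" for r s
    using xyz[of r s 0] uv[OF that] that by simp
  obtain c where c: "c \<noteq> 0" "u' = c *s x" "v' = c *s y"
    by (rule pencil_scale[of x y u' v']) (use 1 in auto)
  have "r *s u' + s *s v' + t *s (c *s z) = c *s (r *s x + s *s y + t *s z)" for r s t
    unfolding c by (simp add: vec_eq_iff algebra_simps)
  then show ?thesis using xyz c(1) by (intro that[of "c *s z"]) (simp add: proj_pt_scale)
qed

lemma line_scaled:
  assumes indep: "\<And>s t. s *s z + t *s w = 0 \<Longrightarrow> s = 0 \<and> t = 0"
    and onX: "\<And>s t. F (s *s z + t *s w) = 0"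
    and zw: "f (proj_pt z) = proj_pt z'" "f (proj_pt w) = proj_pt w'"
  obtains c where "c \<noteq> 0" "\<And>s t. s \<noteq> 0 \<or> t \<noteq> 0 \<Longrightarrow>
    s *s z' + (c * t) *s w' \<noteq> 0 \<and> f (proj_pt (s *s z + t *s w)) = proj_pt (s *s z' + (c * t) *s w')"
proof -
  obtain x y where xy: "\<And>s t. s \<noteq> 0 \<or> t \<noteq> 0 \<Longrightarrow>
    s *s x + t *s y \<noteq> 0 \<and> f (proj_pt (s *s z + t *s w)) = proj_pt (s *s x + t *s y)"
    using line_image[OF indep onX] by blast
  have "proj_pt x = proj_pt z'" "proj_pt w' = proj_pt y" using xy[of 1 0] xy[of 0 1] zw by simp_all
  then obtain c d where c: "c \<noteq> 0" "z' = c *s x" and d: "d \<noteq> 0" "y = d *s w'" unfolding proj_pt_eq_iff by blast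
  have "s *s z' + ((c * d) * t) *s w' = c *s (s *s x + t *s y)" for s t
    unfolding c d by (simp add: vec_eq_iff algebra_simps)
  then show ?thesis using xy c(1) d(1) by (intro that[of "c * d"]) (simp_all add: proj_pt_scale)
qed

text \<open>A point on two lines joining points where \<open>f\<close> is already known: its image is the
  intersection of the two image lines.\<close>

lemma two_lines:
  assumes indep1: "\<And>s t. s *s z + t *s w = 0 \<Longrightarrow> s = 0 \<and> t = 0"
    and onX1: "\<And>s t. F (s *s z + t *s w) = 0"
    and zw: "f (proj_pt z) = proj_pt z'" "f (proj_pt w) = proj_pt w'"
    and indep2: "\<And>s t. s *s x + t *s y = 0 \<Longrightarrow> s = 0 \<and> t = 0"
    and onX2: "\<And>s t. F (s *s x + t *s y) = 0"
    and xy: "f (proj_pt x) = proj_pt x'" "f (proj_pt y) = proj_pt y'"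
    and sum: "z + w = x + y" "z' + w' = x' + y'"
    and off: "\<And>p q. x \<noteq> p *s z + q *s w"
  shows "z' + w' \<noteq> 0 \<and> f (proj_pt (z + w)) = proj_pt (z' + w')"
proof -
  obtain c where c: "c \<noteq> 0" "\<And>s t. s \<noteq> 0 \<or> t \<noteq> 0 \<Longrightarrow>
    s *s z' + (c * t) *s w' \<noteq> 0 \<and> f (proj_pt (s *s z + t *s w)) = proj_pt (s *s z' + (c * t) *s w')"
    using line_scaled[OF indep1 onX1 zw] by blast
  obtain d where d: "d \<noteq> 0" "\<And>s t. s \<noteq> 0 \<or> t \<noteq> 0 \<Longrightarrow>
    s *s x' + (d * t) *s y' \<noteq> 0 \<and> f (proj_pt (s *s x + t *s y)) = proj_pt (s *s x' + (d * t) *s y')"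
    using line_scaled[OF indep2 onX2 xy] by blast
  have nz: "z' + w' \<noteq> 0" using c(2)[of 1 "1 / c"] c(1) by simp
  \<comment> \<open>If neither scale is 1, equating the two descriptions of the image point places
    x' on the image of the first line. By injectivity of \<open>f\<close> the point x then lies on
    the first line, against \<open>off\<close>.\<close>
  have "c = 1 \<or> d = 1"
  proof (rule ccontr)
    assume "\<not> ?thesis"
    then have cd: "c \<noteq> 1" "d \<noteq> 1" by auto
    have "f (proj_pt (z + w)) = proj_pt (z' + c *s w')" using c(2)[of 1 1] by simp
    moreover have "f (proj_pt (z + w)) = proj_pt (x' + d *s y')" unfolding sum using d(2)[of 1 1] by simp
    ultimately have "proj_pt (z' + c *s w') = proj_pt (x' + d *s y')" by simp
    then obtain k where k: "x' + d *s y' = k *s (z' + c *s w')" unfolding proj_pt_eq_iff by blast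
    have "(1 - d) *s x' = (x' + d *s y') - d *s (x' + y')" by (simp add: vec_eq_iff algebra_simps)
    also have "\<dots> = (k - d) *s z' + (k * c - d) *s w'"
      unfolding k sum(2)[symmetric] by (simp add: vec_eq_iff algebra_simps)
    finally have x'1: "(1 - d) *s x' = (k - d) *s z' + (k * c - d) *s w'" .
    have x': "x' = ((k - d) / (1 - d)) *s z' + ((k * c - d) / (1 - d)) *s w'"
    proof -
      have "x' = (1 / (1 - d)) *s ((1 - d) *s x')" using cd by simp
      also have "\<dots> = ((k - d) / (1 - d)) *s z' + ((k * c - d) / (1 - d)) *s w'"
        unfolding x'1 by (simp add: vec.scale_right_distrib)
      finally show ?thesis .
    qed
    define p q where "p = (k - d) / (1 - d)" and "q = (k * c - d) / (1 - d) / c"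
    have x'2: "x' = p *s z' + (c * q) *s w'" using x' c(1) by (simp add: p_def q_def)
    have "x' \<noteq> 0" using d(2)[of 1 0] by simp
    then have pq: "p \<noteq> 0 \<or> q \<noteq> 0" using x'2 by auto
    have "f (proj_pt (p *s z + q *s w)) = f (proj_pt x)" using c(2)[OF pq] xy(1) unfolding x'2 by simp
    moreover have "F (p *s z + q *s w) = 0" by (rule onX1)
    moreover have "p *s z + q *s w \<noteq> 0" using indep1 pq by blast
    moreover have "F x = 0" "x \<noteq> 0" using onX2[of 1 0] indep2[of 1 0] by auto
    ultimately obtain e where "x = e *s (p *s z + q *s w)" using f_inj by metis
    then have "x = (e * p) *s z + (e * q) *s w" by (simp add: vec.scale_right_distrib)
    with off show False by blast
  qed
  then have "f (proj_pt (z + w)) = proj_pt (z' + w')"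
  proof
    assume "c = 1" then show ?thesis using c(2)[of 1 1] by simp
  next
    assume "d = 1" then show ?thesis unfolding sum using d(2)[of 1 1] by simp
  qed
  with nz show ?thesis ..
qed

end

text \<open>\<open>\<Delta>\<close> and \<open>\<Theta>\<close> describe the line on the threefold through a general point \<open>y\<close> that meets the planes
  \<open>x\<^sub>4 = x\<^sub>3 - x\<^sub>2 = 0\<close> and \<open>x\<^sub>5 = x\<^sub>3 - x\<^sub>1 = 0\<close>; replacing \<open>x\<^sub>3, b\<close> by \<open>-x\<^sub>3, -b\<close> gives the line that meets
  \<open>x\<^sub>4 = x\<^sub>3 + x\<^sub>2 = 0\<close> and \<open>x\<^sub>5 = x\<^sub>3 + x\<^sub>1 = 0\<close>.\<close>

definition \<Delta> :: "'k::field \<Rightarrow> 'k \<Rightarrow> 'k \<Rightarrow> 'k ^ 5 \<Rightarrow> 'k" where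
  "\<Delta> a b e y = (a + 1 + e * b) * y$4 * y$5 + 2 * y$4 * (e * y$3 - y$1) + 2 * y$5 * (e * y$3 - y$2)"

definition \<Theta> :: "'k::field \<Rightarrow> 'k \<Rightarrow> 'k \<Rightarrow> 'k ^ 5 \<Rightarrow> 'k" where
  "\<Theta> a b e y = ((a * y$1 + (1 + e * b) * (e * y$3)) * y$4 * y$5 + y$4 * (y$3 * y$3 - y$1 * y$1)
     + 2 * y$5 * (e * y$3) * (e * y$3 - y$2)) / \<Delta> a b e y"

definition line_z :: "'k::field \<Rightarrow> 'k \<Rightarrow> 'k \<Rightarrow> 'k ^ 5 \<Rightarrow> 'k ^ 5" where
  "line_z a b e y = vector [y$1 - \<Theta> a b e y, e * y$3 - \<Theta> a b e y, y$3 - e * \<Theta> a b e y, 0, y$5]"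

definition line_w :: "'k::field \<Rightarrow> 'k \<Rightarrow> 'k \<Rightarrow> 'k ^ 5 \<Rightarrow> 'k ^ 5" where
  "line_w a b e y = vector [\<Theta> a b e y, y$2 - e * y$3 + \<Theta> a b e y, e * \<Theta> a b e y, y$4, 0]"

text \<open>The factors y4 and y5 make \<open>line_z\<close> and \<open>line_w\<close> independent,
  the two values of \<Delta> make \<Theta> meaningful for both signs, and the last two keep the two
  lines through \<open>y\<close> distinct.\<close>

definition generic :: "'k::field \<Rightarrow> 'k \<Rightarrow> 'k ^ 5 \<Rightarrow> 'k" where
  "generic a b y = y$4 * (y$5 * (\<Delta> a b 1 y * (\<Delta> a b (-1) y * ((y$3 - y$1) * (a * y$5 + y$3 - y$1)))))"

text \<open>Both \<open>line_z\<close> and \<open>line_w\<close> give points of planes on the cubic,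
  so only the coefficients of s^2 t and s t^2 can survive. Their sum is the value at
  \<open>y\<close>, which is zero, and the first one is linear in \<Theta> because e^2 = 1; \<Theta>
  is its root.\<close>

lemma line_on_cubic:
  assumes "e * e = 1" "\<Delta> a b e y \<noteq> 0" "cub a b y = 0"
  shows "cub a b (s *s line_z a b e y + t *s line_w a b e y) = 0"
proof -
  define h where "h = \<Theta> a b e y"
  have "h * \<Delta> a b e y = (a * y$1 + (1 + e * b) * (e * y$3)) * y$4 * y$5 + y$4 * (y$3 * y$3 - y$1 * y$1)
     + 2 * y$5 * (e * y$3) * (e * y$3 - y$2)"
    using assms(2) by (simp add: h_def \<Theta>_def)
  then show ?thesis
    using assms(1,3) unfolding line_z_def line_w_def h_def[symmetric] \<Delta>_def cub_def vector_add_component vector_smult_component vector_5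
    by algebra
qed

lemma \<Delta>_homog: "\<Delta> a b e (c *s y) = c\<^sup>2 * \<Delta> a b e y"
  unfolding \<Delta>_def vector_smult_component by algebra

lemma generic_homog: "generic a b (c *s y) = c ^ 8 * generic a b y"
  unfolding generic_def \<Delta>_homog vector_smult_component by algebra

lemma pf_\<Delta>: "poly_fun (\<Delta> a b e)"
  unfolding \<Delta>_def[abs_def] by (intro pf_intros)

lemma pf_generic: "poly_fun (generic a b)"
  unfolding generic_def[abs_def] by (intro pf_intros pf_\<Delta>)

text \<open>By primality a product does not vanish identically on X if none of its factors does, and
  for each factor of \<open>generic\<close> an explicit point is given. This takes the place of
  density of open subsets.\<close>

lemma generic_exists:
  fixes a b :: "'k::field_char_0"
  assumes a: "a \<noteq> 0" and T: "poly_fun T" "cub a b x0 = 0" "T x0 \<noteq> 0"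
  obtains y where "cub a b y = 0" "generic a b y \<noteq> 0" "T y \<noteq> 0"
proof -
  have prod: "\<exists>x. cub a b x = 0 \<and> S x * U x \<noteq> 0"
    if "poly_fun S" "poly_fun U" "\<exists>x. cub a b x = 0 \<and> S x \<noteq> 0" "\<exists>x. cub a b x = 0 \<and> U x \<noteq> 0" for S U
    using cub_prime[OF a that(1,2), of b] that(3,4) by blast
  have "\<exists>x. cub a b x = 0 \<and> T x * generic a b x \<noteq> 0"
    unfolding generic_def
  proof (intro prod pf_intros pf_\<Delta> T)
    show "\<exists>x. cub a b x = 0 \<and> T x \<noteq> 0" using T by blast
    show "\<exists>x. cub a b x = 0 \<and> x $ 4 \<noteq> 0" by (rule exI[of _ "vector [0, 0, 0, 1, 0]"]) (simp add: cub_def)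
    show "\<exists>x. cub a b x = 0 \<and> x $ 5 \<noteq> 0" by (rule exI[of _ "vector [0, 0, 0, 0, 1]"]) (simp add: cub_def)
    show "\<exists>x. cub a b x = 0 \<and> \<Delta> a b 1 x \<noteq> 0"
      by (rule exI[of _ "vector [0, 1, -1, 0, 1]"]) (simp add: cub_def \<Delta>_def)
    show "\<exists>x. cub a b x = 0 \<and> \<Delta> a b (- 1) x \<noteq> 0"
      by (rule exI[of _ "vector [0, 1, 1, 0, 1]"]) (simp add: cub_def \<Delta>_def)
    show "\<exists>x. cub a b x = 0 \<and> x $ 3 - x $ 1 \<noteq> 0"
      by (rule exI[of _ "vector [1, 0, 0, 0, 0]"]) (simp add: cub_def)
    show "\<exists>x. cub a b x = 0 \<and> a * x $ 5 + x $ 3 - x $ 1 \<noteq> 0"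
      by (rule exI[of _ "vector [1, 0, 0, 0, 0]"]) (simp add: cub_def)
  qed
  with that show ?thesis by auto
qed

definition matrix_of_columns :: "'k::zero ^ 5 \<Rightarrow> 'k ^ 5 \<Rightarrow> 'k ^ 5 \<Rightarrow> 'k ^ 5 \<Rightarrow> 'k ^ 5 \<Rightarrow> 'k ^ 5 ^ 5" where
  "matrix_of_columns p q r s t = (\<chi> i. vector [p $ i, q $ i, r $ i, s $ i, t $ i])"

lemma matrix_of_columns_mult:
  "matrix_of_columns p q r s t *v y = y$1 *s p + y$2 *s q + y$3 *s r + y$4 *s s + (y :: 'k::field ^ 5)$5 *s t"
  by (simp add: matrix_of_columns_def matrix_vector_mult_def vec_eq_iff sum_5 mult.commute)

text \<open>The plane x4 = x5 = 0 supplies three columns. Each of the other four planes meets it in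
  a line and adds one column; the two planes in x4 = 0, and likewise the two in x5 = 0, share a
  further line, which forces their new columns to coincide.\<close>

lemma linear_on_planes:
  fixes a b :: "'k::{alg_closed_field, field_char_0}"
  assumes "cubic_automorphism (cub a b) (dcub a b) f g"
  obtains A :: "'k ^ 5 ^ 5" where
    "\<And>y. y \<noteq> 0 \<Longrightarrow> y$4 = 0 \<Longrightarrow> y$2 = y$3 \<or> y$2 = - y$3 \<Longrightarrow> f (proj_pt y) = proj_pt (A *v y)"
    "\<And>y. y \<noteq> 0 \<Longrightarrow> y$5 = 0 \<Longrightarrow> y$1 = y$3 \<or> y$1 = - y$3 \<Longrightarrow> f (proj_pt y) = proj_pt (A *v y)"
proof -
  interpret cubic_automorphism "cub a b" "dcub a b" f g by (rule assms)
  define e1 e2 e3 e4 e5 :: "'k ^ 5" where e: "e1 = vector [1,0,0,0,0]" "e2 = vector [0,1,0,0,0]"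
    "e3 = vector [0,0,1,0,0]" "e4 = vector [0,0,0,1,0]" "e5 = vector [0,0,0,0,1]"
  obtain u1 u2 u3 where u: "\<And>r s t. r \<noteq> 0 \<or> s \<noteq> 0 \<or> t \<noteq> 0 \<Longrightarrow> r *s u1 + s *s u2 + t *s u3 \<noteq> 0 \<and>
    f (proj_pt (r *s e1 + s *s e2 + t *s e3)) = proj_pt (r *s u1 + s *s u2 + t *s u3)"
  proof -
    have "r = 0 \<and> s = 0 \<and> t = 0" if "r *s e1 + s *s e2 + t *s e3 = 0" for r s t
      using that by (simp add: e vec_eq_5)
    moreover have "cub a b (r *s e1 + s *s e2 + t *s e3) = 0" for r s t by (simp add: e cub_def)
    ultimately show ?thesis using plane_image[of e1 e2 e3] that by blast
  qed
  have V: "\<exists>w'. \<forall>r s t. r \<noteq> 0 \<or> s \<noteq> 0 \<or> t \<noteq> 0 \<longrightarrow> r *s v1 + s *s (v2 + d *s u3) + t *s w' \<noteq> 0 \<and>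
      f (proj_pt (r *s p1 + s *s (p2 + d *s e3) + t *s p)) = proj_pt (r *s v1 + s *s (v2 + d *s u3) + t *s w')"
    if d: "d * d = 1" and "p1 = e1 \<and> p2 = e2 \<and> v1 = u1 \<and> v2 = u2 \<and> p = e5 \<or> p1 = e2 \<and> p2 = e1 \<and> v1 = u2 \<and> v2 = u1 \<and> p = e4"
    for d p1 p2 v1 v2 p
  proof -
    have sq: "(s * d) * (s * d) = s * s" for s using d by (simp add: mult_ac)
    show ?thesis
    proof (rule plane_extend[of p1 "p2 + d *s e3" p v1 "v2 + d *s u3"])
      show "r = 0 \<and> s = 0 \<and> t = 0" if "r *s p1 + s *s (p2 + d *s e3) + t *s p = 0" for r s t
        using that \<open>p1 = e1 \<and> _ \<or> _\<close> by (auto simp: e vec_eq_5)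
      show "cub a b (r *s p1 + s *s (p2 + d *s e3) + t *s p) = 0" for r s t
        using \<open>p1 = e1 \<and> _ \<or> _\<close> sq by (auto simp: e cub_def)
      show "f (proj_pt (r *s p1 + s *s (p2 + d *s e3))) = proj_pt (r *s v1 + s *s (v2 + d *s u3))"
        if "r \<noteq> 0 \<or> s \<noteq> 0" for r s
        using \<open>p1 = e1 \<and> _ \<or> _\<close> u[of r s "s * d"] u[of s r "s * d"] that
        by (auto simp: vec.scale_right_distrib add_ac)
    qed blast
  qed
  have W: "\<exists>w'. \<forall>r s t d. d = 1 \<or> d = -1 \<longrightarrow> r \<noteq> 0 \<or> s \<noteq> 0 \<or> t \<noteq> 0 \<longrightarrow>
      f (proj_pt (r *s p1 + s *s (p2 + d *s e3) + t *s p)) = proj_pt (r *s v1 + s *s (v2 + d *s u3) + t *s w')"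
    if P: "p1 = e1 \<and> p2 = e2 \<and> v1 = u1 \<and> v2 = u2 \<and> p = e5 \<or> p1 = e2 \<and> p2 = e1 \<and> v1 = u2 \<and> v2 = u1 \<and> p = e4"
    for p1 p2 v1 v2 p
  proof -
    obtain w where w: "\<And>r s t. r \<noteq> 0 \<or> s \<noteq> 0 \<or> t \<noteq> 0 \<Longrightarrow> r *s v1 + s *s (v2 + 1 *s u3) + t *s w \<noteq> 0 \<and>
      f (proj_pt (r *s p1 + s *s (p2 + 1 *s e3) + t *s p)) = proj_pt (r *s v1 + s *s (v2 + 1 *s u3) + t *s w)"
      using V[OF _ P, of 1] by auto
    obtain w' where w': "\<And>r s t. r \<noteq> 0 \<or> s \<noteq> 0 \<or> t \<noteq> 0 \<Longrightarrow> r *s v1 + s *s (v2 + (-1) *s u3) + t *s w' \<noteq> 0 \<and>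
      f (proj_pt (r *s p1 + s *s (p2 + (-1) *s e3) + t *s p)) = proj_pt (r *s v1 + s *s (v2 + (-1) *s u3) + t *s w')"
      using V[OF _ P, of "-1"] by auto
    text \<open>The two planes meet in the line \<open>p1 p\<close>.\<close>
    have 1: "r *s v1 + t *s w \<noteq> 0 \<and> proj_pt (r *s v1 + t *s w) = proj_pt (r *s v1 + t *s w')" if "r \<noteq> 0 \<or> t \<noteq> 0" for r t
      using w[of r 0 t] w'[of r 0 t] that by simp
    obtain c where "c \<noteq> 0" "v1 = c *s v1" "w' = c *s w"
      by (rule pencil_scale[of v1 w v1 w']) (use 1 in auto)
    moreover have "v1 \<noteq> 0" using 1[of 1 0] by simp
    ultimately have ww: "w' = w" by (metis vec.scale_one vector_mul_rcancel)
    show ?thesis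
    proof (intro exI[of _ w] allI impI)
      fix r s t d :: 'k
      assume "d = 1 \<or> d = -1" and nz: "r \<noteq> 0 \<or> s \<noteq> 0 \<or> t \<noteq> 0"
      then show "f (proj_pt (r *s p1 + s *s (p2 + d *s e3) + t *s p)) = proj_pt (r *s v1 + s *s (v2 + d *s u3) + t *s w)"
        using w[OF nz] w'[OF nz] by (auto simp: ww)
    qed
  qed
  obtain u5 where u5: "\<And>r s t d. d = 1 \<or> d = -1 \<Longrightarrow> r \<noteq> 0 \<or> s \<noteq> 0 \<or> t \<noteq> 0 \<Longrightarrow>
      f (proj_pt (r *s e1 + s *s (e2 + d *s e3) + t *s e5)) = proj_pt (r *s u1 + s *s (u2 + d *s u3) + t *s u5)"
    using W[of e1 e2 u1 u2 e5] by blast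
  obtain u4 where u4: "\<And>r s t d. d = 1 \<or> d = -1 \<Longrightarrow> r \<noteq> 0 \<or> s \<noteq> 0 \<or> t \<noteq> 0 \<Longrightarrow>
      f (proj_pt (r *s e2 + s *s (e1 + d *s e3) + t *s e4)) = proj_pt (r *s u2 + s *s (u1 + d *s u3) + t *s u4)"
    using W[of e2 e1 u2 u1 e4] by blast
  show ?thesis
  proof (rule that[of "matrix_of_columns u1 u2 u3 u4 u5"])
    fix y :: "'k ^ 5" assume y: "y \<noteq> 0" "y$4 = 0" "y$2 = y$3 \<or> y$2 = - y$3"
    then obtain d where d: "d = 1 \<or> d = -1" "y$3 = y$2 * d" by (metis minus_minus mult.right_neutral mult_minus_right)
    have "y = y$1 *s e1 + y$2 *s (e2 + d *s e3) + y$5 *s e5" using y(2) d(2) by (simp add: e vec_eq_5)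
    moreover have "y$1 \<noteq> 0 \<or> y$2 \<noteq> 0 \<or> y$5 \<noteq> 0" using y d(2) by (auto simp: vec_eq_5)
    moreover have "matrix_of_columns u1 u2 u3 u4 u5 *v y = y$1 *s u1 + y$2 *s (u2 + d *s u3) + y$5 *s u5"
      unfolding matrix_of_columns_mult y(2) d(2) by (simp add: vec_eq_iff algebra_simps)
    ultimately show "f (proj_pt y) = proj_pt (matrix_of_columns u1 u2 u3 u4 u5 *v y)"
      using u5[OF d(1)] by metis
  next
    fix y :: "'k ^ 5" assume y: "y \<noteq> 0" "y$5 = 0" "y$1 = y$3 \<or> y$1 = - y$3"
    then obtain d where d: "d = 1 \<or> d = -1" "y$3 = y$1 * d" by (metis minus_minus mult.right_neutral mult_minus_right)
    have "y = y$2 *s e2 + y$1 *s (e1 + d *s e3) + y$4 *s e4" using y(2) d(2) by (simp add: e vec_eq_5)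
    moreover have "y$2 \<noteq> 0 \<or> y$1 \<noteq> 0 \<or> y$4 \<noteq> 0" using y d(2) by (auto simp: vec_eq_5)
    moreover have "matrix_of_columns u1 u2 u3 u4 u5 *v y = y$2 *s u2 + y$1 *s (u1 + d *s u3) + y$4 *s u4"
      unfolding matrix_of_columns_mult y(2) d(2) by (simp add: vec_eq_iff algebra_simps)
    ultimately show "f (proj_pt y) = proj_pt (matrix_of_columns u1 u2 u3 u4 u5 *v y)"
      using u4[OF d(1)] by metis
  qed
qed

lemma linear_generically:
  fixes a b :: "'k::{alg_closed_field, field_char_0}"
  assumes aut: "cubic_automorphism (cub a b) (dcub a b) f g"
  obtains A :: "'k ^ 5 ^ 5" where
    "\<And>y. cub a b y = 0 \<Longrightarrow> generic a b y \<noteq> 0 \<Longrightarrow> A *v y \<noteq> 0 \<and> f (proj_pt y) = proj_pt (A *v y)"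
proof -
  interpret cubic_automorphism "cub a b" "dcub a b" f g by (rule aut)
  obtain A :: "'k ^ 5 ^ 5" where
    A: "\<And>y. y \<noteq> 0 \<Longrightarrow> y$4 = 0 \<Longrightarrow> y$2 = y$3 \<or> y$2 = - y$3 \<Longrightarrow> f (proj_pt y) = proj_pt (A *v y)"
    "\<And>y. y \<noteq> 0 \<Longrightarrow> y$5 = 0 \<Longrightarrow> y$1 = y$3 \<or> y$1 = - y$3 \<Longrightarrow> f (proj_pt y) = proj_pt (A *v y)"
    using linear_on_planes[OF aut] by blast
  show ?thesis
  proof (rule that)
    fix y :: "'k ^ 5" assume y: "cub a b y = 0" "generic a b y \<noteq> 0"
    have nz: "y$4 \<noteq> 0" "y$5 \<noteq> 0" "\<Delta> a b 1 y \<noteq> 0" "\<Delta> a b (-1) y \<noteq> 0" "(y$3 - y$1) * (a * y$5 + y$3 - y$1) \<noteq> 0"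
      using y(2) unfolding generic_def by auto
    let ?z = "\<lambda>e. line_z a b e y" and ?w = "\<lambda>e. line_w a b e y"
    have sum: "?z e + ?w e = y" for e
      by (simp add: line_z_def line_w_def vec_eq_5)
    have indep: "s = 0 \<and> t = 0" if "s *s ?z e + t *s ?w e = 0" for s t e
      using that nz(1,2) by (simp add: line_z_def line_w_def vec_eq_5)
    have e: "e * e = 1" "\<Delta> a b e y \<noteq> 0" if "e \<in> {1, -1}" for e using that nz by auto
    have onX: "cub a b (s *s ?z e + t *s ?w e) = 0" if "e \<in> {1, -1}" for s t e
      by (rule line_on_cubic[OF e[OF that] y(1)])
    have fz: "f (proj_pt (?z e)) = proj_pt (A *v ?z e)" if "e \<in> {1, -1}" for e
    proof (rule A(1))
      show "?z e \<noteq> 0" using indep[of 1 e 0] by auto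
      show "?z e $ 4 = 0" "?z e $ 2 = ?z e $ 3 \<or> ?z e $ 2 = - (?z e $ 3)" using that by (auto simp: line_z_def)
    qed
    have fw: "f (proj_pt (?w e)) = proj_pt (A *v ?w e)" if "e \<in> {1, -1}" for e
    proof (rule A(2))
      show "?w e \<noteq> 0" using indep[of 0 e 1] by auto
      show "?w e $ 5 = 0" "?w e $ 1 = ?w e $ 3 \<or> ?w e $ 1 = - (?w e $ 3)" using that by (auto simp: line_w_def)
    qed
    \<comment> \<open>Equal points would give \<Theta> = y3, and then the equation defining \<Theta>
      becomes y4 (y3 - y1)(a y5 + y3 - y1) = 0, which \<open>generic\<close> excludes.\<close>
    have off: "?z (-1) \<noteq> p *s ?z 1 + q *s ?w 1" for p q
    proof
      assume eq: "?z (-1) = p *s ?z 1 + q *s ?w 1"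
      have "q = 0" using eq nz(1) by (simp add: line_z_def line_w_def vec_eq_5)
      moreover have "p = 1" using eq nz(2) by (simp add: line_z_def line_w_def vec_eq_5)
      ultimately have "?z (-1) = ?z 1" using eq by simp
      then have "2 * (y$3 - \<Theta> a b 1 y) = 0" unfolding line_z_def vec_eq_5 vector_5 by algebra
      then have "\<Theta> a b 1 y = y$3" by simp
      then have "y$3 * \<Delta> a b 1 y = (a * y$1 + (1 + b) * y$3) * y$4 * y$5 + y$4 * (y$3 * y$3 - y$1 * y$1)
           + 2 * y$5 * y$3 * (y$3 - y$2)"
        using nz(3) unfolding \<Theta>_def by (simp add: field_simps)
      then have "y$4 * ((y$3 - y$1) * (a * y$5 + y$3 - y$1)) = 0"
        unfolding \<Delta>_def by algebra
      then show False using nz by simp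
    qed
    have "A *v ?z 1 + A *v ?w 1 \<noteq> 0 \<and> f (proj_pt (?z 1 + ?w 1)) = proj_pt (A *v ?z 1 + A *v ?w 1)"
      by (rule two_lines[where x = "?z (-1)" and y = "?w (-1)" and x' = "A *v ?z (-1)" and y' = "A *v ?w (-1)"])
        (use indep onX fz fw sum off in \<open>simp_all flip: matrix_vector_right_distrib\<close>)
    then show "A *v y \<noteq> 0 \<and> f (proj_pt y) = proj_pt (A *v y)"
      unfolding matrix_vector_right_distrib[symmetric] sum .
  qed
qed

text \<open>The five coordinate points lie on X and give five eigenvalues; three further points of
  X, each a combination of coordinate points, identify them with one another.\<close>

lemma eigenvectors_scalar:
  fixes M :: "'k::field_char_0 ^ 5 ^ 5"
  assumes a: "a \<noteq> 0" and eig: "\<And>x. cub a b x = 0 \<Longrightarrow> \<exists>m. M *v x = m *s x"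
  obtains \<kappa> where "\<And>x. M *v x = \<kappa> *s x"
proof -
  have ex: "M *v x = x$1 *s (M *v vector [1,0,0,0,0]) + x$2 *s (M *v vector [0,1,0,0,0]) + x$3 *s (M *v vector [0,0,1,0,0])
     + x$4 *s (M *v vector [0,0,0,1,0]) + x$5 *s (M *v vector [0,0,0,0,1])" for x
    by (simp add: matrix_vector_mult_def vec_eq_iff sum_5 mult.commute)
  have v: "cub a b (vector [1,0,0,0,0]) = 0" "cub a b (vector [0,1,0,0,0]) = 0" "cub a b (vector [0,0,1,0,0]) = 0"
    "cub a b (vector [0,0,0,1,0]) = 0" "cub a b (vector [0,0,0,0,1]) = 0" "cub a b (vector [1,1,1,0,0]) = 0"
    "cub a b (vector [a,0,0,0,1]) = 0" "cub a b (vector [0,1,0,1,0]) = 0"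
    by (simp_all add: cub_def)
  obtain m1 m2 m3 m4 m5 m6 m7 m8 where m: "M *v vector [1,0,0,0,0] = m1 *s vector [1,0,0,0,0]"
    "M *v vector [0,1,0,0,0] = m2 *s vector [0,1,0,0,0]" "M *v vector [0,0,1,0,0] = m3 *s vector [0,0,1,0,0]"
    "M *v vector [0,0,0,1,0] = m4 *s vector [0,0,0,1,0]" "M *v vector [0,0,0,0,1] = m5 *s vector [0,0,0,0,1]"
    "M *v vector [1,1,1,0,0] = m6 *s vector [1,1,1,0,0]" "M *v vector [a,0,0,0,1] = m7 *s vector [a,0,0,0,1]"
    "M *v vector [0,1,0,1,0] = m8 *s vector [0,1,0,1,0]"
    using eig[OF v(1)] eig[OF v(2)] eig[OF v(3)] eig[OF v(4)] eig[OF v(5)] eig[OF v(6)] eig[OF v(7)] eig[OF v(8)] by metis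
  have "m1 = m6 \<and> m2 = m6 \<and> m3 = m6" using m(6) unfolding ex[of "vector [1,1,1,0,0]"] m(1-5) by (simp add: vec_eq_5)
  moreover have "m1 = m5" using m(7) a unfolding ex[of "vector [a,0,0,0,1]"] m(1-5) by (simp add: vec_eq_5)
  moreover have "m2 = m4" using m(8) unfolding ex[of "vector [0,1,0,1,0]"] m(1-5) by (simp add: vec_eq_5)
  ultimately have "M *v x = m1 *s x" for x
    unfolding ex[of x] m(1-5) by (simp add: vec_eq_5)
  with that show ?thesis by blast
qed

text \<open>Both claims are closed conditions: a polynomial function vanishing at the generic points
  of X vanishes on X. The matrix is not yet known to be invertible, hence the proviso on
  \<open>A *v y\<close>.\<close>

lemma linear_globally:
  fixes a b :: "'k::{alg_closed_field, field_char_0}"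
  assumes a: "a \<noteq> 0" and aut: "cubic_automorphism (cub a b) (dcub a b) f g"
    and A: "\<And>y. cub a b y = 0 \<Longrightarrow> generic a b y \<noteq> 0 \<Longrightarrow> A *v y \<noteq> 0 \<and> f (proj_pt y) = proj_pt (A *v y)"
    and y: "cub a b y = 0"
  shows "cub a b (A *v y) = 0" "A *v y \<noteq> 0 \<Longrightarrow> f (proj_pt y) = proj_pt (A *v y)"
proof -
  interpret cubic_automorphism "cub a b" "dcub a b" f g by (rule aut)
  have zero: "generic a b 0 = 0" using generic_homog[of a b 0 0] by simp
  have prime: "T x = 0" if "poly_fun T" "\<And>x. cub a b x = 0 \<Longrightarrow> generic a b x \<noteq> 0 \<Longrightarrow> T x = 0" "cub a b x = 0" for T x
    using generic_exists[OF a that(1,3)] that(2) by blast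
  have "poly_fun (\<lambda>x. cub a b (A *v x))" by (rule pf_compose[OF pf_cub pf_linear])
  then show "cub a b (A *v y) = 0"
  proof (rule prime[OF _ _ y])
    fix x assume x: "cub a b x = 0" "generic a b x \<noteq> 0"
    then have "x \<noteq> 0" using zero by auto
    then obtain d Q where Q: "lift f d Q" "Q x \<noteq> 0" using lift_f[OF x(1)] by blast
    have "proj_pt (Q x) = proj_pt (A *v x)" using A[OF x] liftD(5)[OF Q(1) x(1) Q(2)] by simp
    then obtain c where "c \<noteq> 0" "A *v x = c *s Q x" unfolding proj_pt_eq_iff by blast
    then show "cub a b (A *v x) = 0" using liftD(4)[OF Q(1) x(1)] homogD[OF F_homog, of c "Q x"] by simp
  qed
  assume nz: "A *v y \<noteq> 0"
  then have "y \<noteq> 0" by auto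
  then obtain d Q where Q: "lift f d Q" "Q y \<noteq> 0" using lift_f[OF y] by blast
  have "proj_pt (Q y) = proj_pt (A *v y)"
  proof (rule proj_pt_eqI[OF Q(2) nz])
    fix i j
    have "poly_fun (\<lambda>x. Q x $ i * (A *v x) $ j - Q x $ j * (A *v x) $ i)"
      by (intro pf_intros liftD(2)[OF Q(1)] pf_linear)
    then have "Q y $ i * (A *v y) $ j - Q y $ j * (A *v y) $ i = 0"
    proof (rule prime[OF _ _ y])
      fix x assume x: "cub a b x = 0" "generic a b x \<noteq> 0"
      show "Q x $ i * (A *v x) $ j - Q x $ j * (A *v x) $ i = 0"
      proof (cases "Q x = 0")
        case False
        then have "proj_pt (Q x) = proj_pt (A *v x)" using A[OF x] liftD(5)[OF Q(1) x(1)] by simp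
        from proj_pt_cross[OF this, of i j] show ?thesis by simp
      qed simp
    qed
    then show "Q y $ i * (A *v y) $ j = Q y $ j * (A *v y) $ i" by simp
  qed
  then show "f (proj_pt y) = proj_pt (A *v y)" using liftD(5)[OF Q(1) y Q(2)] by simp
qed

text \<open>With \<open>B\<close> the matrix found for \<open>g\<close>, every point of X is an
  eigenvector of B A, so B A is scalar; it remains to exclude the scalar zero.\<close>

lemma automorphism_linear:
  fixes a b :: "'k::{alg_closed_field, field_char_0}"
  assumes a: "a \<noteq> 0" and aut: "cubic_automorphism (cub a b) (dcub a b) f g"
  obtains A where "det A \<noteq> 0" "\<And>x. cub a b x = 0 \<Longrightarrow> cub a b (A *v x) = 0"
    "\<And>x. cub a b x = 0 \<Longrightarrow> x \<noteq> 0 \<Longrightarrow> f (proj_pt x) = proj_pt (A *v x)"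
proof -
  interpret cubic_automorphism "cub a b" "dcub a b" f g by (rule aut)
  obtain A :: "'k ^ 5 ^ 5" where
    A: "\<And>y. cub a b y = 0 \<Longrightarrow> generic a b y \<noteq> 0 \<Longrightarrow> A *v y \<noteq> 0 \<and> f (proj_pt y) = proj_pt (A *v y)"
    using linear_generically[OF aut] by blast
  obtain B :: "'k ^ 5 ^ 5" where
    B: "\<And>y. cub a b y = 0 \<Longrightarrow> generic a b y \<noteq> 0 \<Longrightarrow> B *v y \<noteq> 0 \<and> g (proj_pt y) = proj_pt (B *v y)"
    using linear_generically[OF inverse_automorphism] by blast
  have GA: "cub a b (A *v y) = 0" "A *v y \<noteq> 0 \<Longrightarrow> f (proj_pt y) = proj_pt (A *v y)" if "cub a b y = 0" for y
    using linear_globally[OF a aut _ that, of A] A by blast+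
  have GB: "cub a b (B *v y) = 0" "B *v y \<noteq> 0 \<Longrightarrow> g (proj_pt y) = proj_pt (B *v y)" if "cub a b y = 0" for y
    using linear_globally[OF a inverse_automorphism _ that, of B] B by blast+
  have zero: "generic a b 0 = 0" using generic_homog[of a b 0 0] by simp
  have eig: "\<exists>m. (B ** A) *v x = m *s x" if x: "cub a b x = 0" for x
  proof (cases "B *v (A *v x) = 0")
    case True
    then show ?thesis by (intro exI[of _ 0]) (simp add: matrix_vector_mul_assoc)
  next
    case False
    then have nz: "A *v x \<noteq> 0" "x \<noteq> 0" by auto
    have "g (f (proj_pt x)) = proj_pt (B *v (A *v x))"
      using GA(2)[OF x nz(1)] GB(2)[OF GA(1)[OF x] False] by simp
    then have "proj_pt x = proj_pt (B *v (A *v x))" using gf[OF x nz(2)] by simp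
    then show ?thesis unfolding proj_pt_eq_iff by (auto simp: matrix_vector_mul_assoc)
  qed
  obtain \<kappa> where \<kappa>: "\<And>x. (B ** A) *v x = \<kappa> *s x" by (rule eigenvectors_scalar[OF a eig]) auto
  \<comment> \<open>A point x of X is sought such that x and R(x) are both generic, where
    \<open>R\<close> is a lift of \<open>g\<close>: then \<open>A\<close> maps R(x) to a nonzero
    multiple of x, on which \<open>B\<close> does not vanish. It exists by primality, since R(x0) is
    generic for the image \<open>x0\<close> of a generic point \<open>y0\<close>.\<close>
  have "\<kappa> \<noteq> 0"
  proof
    assume 0: "\<kappa> = 0"
    have "cub a b 0 = 0" "(1::'k) \<noteq> 0" by (simp_all add: cub_def)
    then obtain y0 where y0: "cub a b y0 = 0" "generic a b y0 \<noteq> 0" using generic_exists[OF a pf_const, of b 0 1] by auto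
    then have "y0 \<noteq> 0" using zero by auto
    define x0 where "x0 = A *v y0"
    have x0: "x0 \<noteq> 0" "cub a b x0 = 0" "f (proj_pt y0) = proj_pt x0" using A[OF y0] GA(1)[OF y0(1)] by (auto simp: x0_def)
    obtain e R where R: "lift g e R" "R x0 \<noteq> 0" using lift_g[OF x0(2,1)] by blast
    have "proj_pt y0 = proj_pt (R x0)" using liftD(5)[OF R(1) x0(2) R(2)] gf[OF y0(1) \<open>y0 \<noteq> 0\<close>] x0(3) by simp
    then obtain c where "c \<noteq> 0" "R x0 = c *s y0" unfolding proj_pt_eq_iff by blast
    then have "generic a b (R x0) \<noteq> 0" using y0 by (simp add: generic_homog)
    moreover have "poly_fun (\<lambda>x. generic a b (R x))" by (rule pf_compose[OF pf_generic liftD(2)[OF R(1)]])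
    ultimately obtain x where x: "cub a b x = 0" "generic a b x \<noteq> 0" "generic a b (R x) \<noteq> 0"
      using generic_exists[OF a _ x0(2)] by blast
    then have nz: "x \<noteq> 0" "R x \<noteq> 0" using zero by auto
    have cR: "cub a b (R x) = 0" by (rule liftD(4)[OF R(1) x(1)])
    have "proj_pt x = proj_pt (A *v R x)"
      using A[OF cR x(3)] liftD(5)[OF R(1) x(1) nz(2)] fg[OF x(1) nz(1)] by simp
    then obtain c where c: "c \<noteq> 0" "A *v R x = c *s x" unfolding proj_pt_eq_iff by blast
    then have "generic a b (A *v R x) \<noteq> 0" using x by (simp add: generic_homog)
    then have "B *v (A *v R x) \<noteq> 0" using B GA(1)[OF cR] by blast
    with \<kappa>[of "R x"] 0 show False by (simp add: matrix_vector_mul_assoc)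
  qed
  have inj: "z = 0" if "A *v z = 0" for z
    using \<kappa>[of z] that \<open>\<kappa> \<noteq> 0\<close> by (simp add: matrix_vector_mul_assoc[symmetric] vec.scale_eq_0_iff)
  show ?thesis
    by (rule that[OF det_nonzero_of_inj[OF inj] GA(1) GA(2)]) (use inj in auto)
qed

text \<open>The cofactor of the cubic in its pullback is homogeneous of degree zero, hence constant.
  The rule for differentials is the coefficient of t of the resulting identity along a line.\<close>

lemma linear_multiplier:
  fixes a b :: "'k::field_char_0"
  assumes a: "a \<noteq> 0" and A: "det A \<noteq> 0" "\<And>x. cub a b x = 0 \<Longrightarrow> cub a b (A *v x) = 0"
  obtains \<mu> where "\<mu> \<noteq> 0" "\<And>x. cub a b (A *v x) = \<mu> * cub a b x"
    "\<And>x v. dcub a b (A *v x) (A *v v) = \<mu> * dcub a b x v"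
proof -
  have pA: "poly_fun (\<lambda>x. cub a b (A *v x))" by (rule pf_compose[OF pf_cub pf_linear])
  obtain W where W: "poly_fun W" "\<And>x. cub a b (A *v x) = cub a b x * W x"
    using cub_null[OF a pA A(2)] by blast
  have "cub a b (vector [0, 0, 1, 1, 0]) \<noteq> 0" by (simp add: cub_def)
  then have nz: "\<not> (\<forall>x. cub a b x = 0)" by blast
  have "homog 0 W"
    unfolding homog_def
  proof (intro allI impI)
    fix c :: 'k and x assume c: "c \<noteq> 0"
    have "cub a b x * (W (c *s x) - W x) = 0" for x
    proof -
      have "cub a b (A *v (c *s x)) = c ^ 3 * cub a b (A *v x)" using homogD[OF cub_homog c] by (simp add: vec.scale)
      then have "c ^ 3 * (cub a b x * (W (c *s x) - W x)) = 0"
        unfolding W(2) homogD[OF cub_homog c] by (simp add: algebra_simps)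
      then show ?thesis using c by simp
    qed
    moreover have "poly_fun (\<lambda>x. W (c *s x) - W x)"
      by (intro pf_intros W(1) pf_compose[OF W(1), of "\<lambda>x. c *s x"]) (simp, intro pf_intros)
    ultimately have "W (c *s x) - W x = 0" using pf_no_zero_divisors[OF pf_cub] nz by blast
    then show "W (c *s x) = c ^ 0 * W x" by simp
  qed
  then have const: "W u = W v" for u v
  proof -
    obtain p where p: "\<And>t. poly p t = W (u + t *s v)" using pf_line[OF W(1)] by blast
    have "degree p \<le> 0" "coeff p 0 = W v" using homog_line_degree[OF W(1) \<open>homog 0 W\<close> p] .
    then have "poly p 0 = W v" by (simp add: poly_0_coeff_0)
    then show ?thesis using p[of 0] by simp
  qed
  define \<mu> where "\<mu> = W 0"
  have \<mu>: "cub a b (A *v x) = \<mu> * cub a b x" for x using W(2)[of x] const[of x 0] by (simp add: \<mu>_def)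
  show ?thesis
  proof (rule that[OF _ \<mu>])
    show "\<mu> \<noteq> 0"
    proof
      assume "\<mu> = 0"
      moreover obtain z where "A *v z = vector [0, 0, 1, 1, 0]" using surj_of_det_nonzero[OF A(1)] by blast
      ultimately show False using \<mu>[of z] by (simp add: cub_def)
    qed
    fix x v
    have "[:cub a b (A *v x), dcub a b (A *v x) (A *v v), dcub a b (A *v v) (A *v x), cub a b (A *v v):] =
      [:\<mu>:] * [:cub a b x, dcub a b x v, dcub a b v x, cub a b v:]"
    proof (rule poly_eqI_nonzero[of "{}"])
      fix t :: 'k
      have "cub a b (A *v x + t *s (A *v v)) = \<mu> * cub a b (x + t *s v)"
        unfolding \<mu>[symmetric] by (simp add: matrix_vector_right_distrib vec.scale)
      then show "poly [:cub a b (A *v x), dcub a b (A *v x) (A *v v), dcub a b (A *v v) (A *v x), cub a b (A *v v):] t =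
        poly ([:\<mu>:] * [:cub a b x, dcub a b x v, dcub a b v x, cub a b v:]) t"
        unfolding cub_expand by (simp add: algebra_simps power2_eq_square power3_eq_cube)
    qed simp
    then show "dcub a b (A *v x) (A *v v) = \<mu> * dcub a b x v" by simp
  qed
qed

section \<open>The eight nodes\<close>

definition nodes :: "'k::field \<Rightarrow> ('k ^ 5) set" where
  "nodes a = {vector [1,1,1,0,0], vector [1,-1,1,0,0], vector [-1,1,1,0,0], vector [-1,-1,1,0,0],
     vector [0,0,0,0,1], vector [a,0,0,0,1], vector [0,0,0,1,0], vector [0,1,0,1,0]}"

lemma nodes_singular:
  assumes "n \<in> nodes a"
  shows "n \<noteq> 0" "cub a b n = 0" "dcub a b n z = 0"
  using assms unfolding nodes_def by (auto simp: vec_eq_5 cub_def dcub_def)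

lemma nodes_inj:
  assumes "a \<noteq> (0 :: 'k::field_char_0)"
  shows "inj_on proj_pt (nodes a)" "card (nodes a) = 8"
proof -
  \<comment> \<open>The form x3 + x4 + x5 normalises all eight vectors, so proportional ones are
    equal.\<close>
  have sum: "x$3 + x$4 + x$5 = 1" if "x \<in> nodes a" for x
    using that unfolding nodes_def by auto
  have "x = y" if "x \<in> nodes a" "y \<in> nodes a" "y = c *s x" for x y c
  proof -
    have "c * (x$3 + x$4 + x$5) = 1" using sum[OF that(2)] unfolding that(3) by (simp add: algebra_simps)
    then show ?thesis using sum[OF that(1)] that(3) by simp
  qed
  then show "inj_on proj_pt (nodes a)" unfolding inj_on_def proj_pt_eq_iff by blast
  show "card (nodes a) = 8" using assms unfolding nodes_def by (simp add: card_insert_if vec_eq_5)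
qed

text \<open>The eight listed points are singular and, as \<open>a\<close> is nonzero, pairwise
  distinct, so a count of eight leaves no room for others.\<close>

lemma nodes_complete:
  fixes a b :: "'k::field_char_0"
  assumes a: "a \<noteq> 0" and nodal: "nodal_with (cubic_form a b) 8"
    and x: "x \<noteq> 0" "\<And>z. dcub a b x z = 0"
  obtains n c where "n \<in> nodes a" "c \<noteq> 0" "x = c *s n"
proof -
  have fin: "finite (singular_points (cubic_form a b))" and card: "card (singular_points (cubic_form a b)) = 8"
    using nodal unfolding nodal_with_def by auto
  have "proj_pt ` nodes a \<subseteq> singular_points (cubic_form a b)"
    unfolding singular_points_eq using nodes_singular by blast
  moreover have "card (proj_pt ` nodes a) = 8" using nodes_inj[OF a] by (simp add: card_image)
  ultimately have "proj_pt ` nodes a = singular_points (cubic_form a b)"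
    using fin card by (metis card_subset_eq)
  moreover have "cub a b x = 0" using pd_euler[OF pd_cub cub_homog, of a b x] x(2) by simp
  then have "proj_pt x \<in> singular_points (cubic_form a b)" unfolding singular_points_eq using x by blast
  ultimately obtain n where "n \<in> nodes a" "proj_pt n = proj_pt x" by (metis imageE)
  then show ?thesis using that unfolding proj_pt_eq_iff by blast
qed

text \<open>Otherwise there is a ninth node \<open>(a/2, s a/2, -r s a/2, s a, 1)\<close>.\<close>

lemma nodal_parameters:
  fixes a b :: "'k::field_char_0"
  assumes a: "a \<noteq> 0" and nodal: "nodal_with (cubic_form a b) 8" and rs: "r * r = 1" "s * s = 1"
  shows "b \<noteq> r * (1 + s * a)"
proof
  assume b: "b = r * (1 + s * a)"
  define n where "n = (vector [a, s * a, - r * s * a, 2 * s * a, 2] :: 'k ^ 5)"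
  have "n \<noteq> 0" by (simp add: n_def vec_eq_5)
  moreover have "dcub a b n z = 0" for z
    using rs unfolding dcub_def n_def b vector_5 by algebra
  ultimately obtain m c where "m \<in> nodes a" "c \<noteq> 0" "n = c *s m"
    using nodes_complete[OF a nodal] by metis
  moreover have "s \<noteq> 0" using rs by auto
  ultimately show False using a unfolding nodes_def n_def by (auto simp: vec_eq_5)
qed

text \<open>\<open>is_N\<close>, \<open>is_P\<close> and \<open>is_Q\<close> describe the nonzero
  multiples of four, two and two of the nodes: those in the plane x4 = x5 = 0, and the pairs outside
  it with x4 = 0 and with x5 = 0.\<close>

definition is_N :: "'k::field ^ 5 \<Rightarrow> bool" where
  "is_N x \<longleftrightarrow> x$4 = 0 \<and> x$5 = 0 \<and> x$3 \<noteq> 0 \<and> (x$1 = x$3 \<or> x$1 = - x$3) \<and> (x$2 = x$3 \<or> x$2 = - x$3)"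

definition is_P :: "'k::field \<Rightarrow> 'k ^ 5 \<Rightarrow> bool" where
  "is_P a x \<longleftrightarrow> x$2 = 0 \<and> x$3 = 0 \<and> x$4 = 0 \<and> x$5 \<noteq> 0 \<and> (x$1 = 0 \<or> x$1 = a * x$5)"

definition is_Q :: "'k::field ^ 5 \<Rightarrow> bool" where
  "is_Q x \<longleftrightarrow> x$1 = 0 \<and> x$3 = 0 \<and> x$5 = 0 \<and> x$4 \<noteq> 0 \<and> (x$2 = 0 \<or> x$2 = x$4)"

definition is_sing :: "'k::field \<Rightarrow> 'k ^ 5 \<Rightarrow> bool" where
  "is_sing a x \<longleftrightarrow> is_N x \<or> is_P a x \<or> is_Q x"

lemma is_sing_iff:
  fixes a b :: "'k::field_char_0"
  assumes a: "a \<noteq> 0" and nodal: "nodal_with (cubic_form a b) 8"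
  shows "is_sing a x \<longleftrightarrow> x \<noteq> 0 \<and> (\<forall>z. dcub a b x z = 0)"
proof
  assume "is_sing a x"
  then show "x \<noteq> 0 \<and> (\<forall>z. dcub a b x z = 0)"
    unfolding is_sing_def is_N_def is_P_def is_Q_def by (auto simp: dcub_def vec_eq_5)
next
  assume "x \<noteq> 0 \<and> (\<forall>z. dcub a b x z = 0)"
  then obtain n c where "n \<in> nodes a" "c \<noteq> 0" "x = c *s n" using nodes_complete[OF a nodal] by metis
  moreover have "\<forall>n \<in> nodes a. is_sing a n"
    unfolding nodes_def by (simp add: is_sing_def is_N_def is_P_def is_Q_def)
  moreover have "is_N (c *s n)" if "c \<noteq> 0" "is_N n"
  proof -
    have "c * n$1 = c * n$3 \<or> c * n$1 = - (c * n$3)" "c * n$2 = c * n$3 \<or> c * n$2 = - (c * n$3)"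
      using that(2) unfolding is_N_def by (metis mult_minus_right)+
    then show ?thesis using that unfolding is_N_def vector_smult_component by simp
  qed
  moreover have "is_P a (c *s n)" if "c \<noteq> 0" "is_P a n"
    using that unfolding is_P_def vector_smult_component by auto
  moreover have "is_Q (c *s n)" if "c \<noteq> 0" "is_Q n"
    using that unfolding is_Q_def vector_smult_component by auto
  ultimately show "is_sing a x" unfolding is_sing_def by blast
qed

text \<open>Vanishes on three nodes exactly if their plane lies on the cubic.\<close>

definition polar :: "'k::field \<Rightarrow> 'k \<Rightarrow> 'k ^ 5 \<Rightarrow> 'k ^ 5 \<Rightarrow> 'k ^ 5 \<Rightarrow> 'k" where
  "polar a b x y z = dcub a b (x + y) z - dcub a b x z - dcub a b y z"

lemma polar_plane: "x$4 = 0 \<Longrightarrow> x$5 = 0 \<Longrightarrow> y$4 = 0 \<Longrightarrow> y$5 = 0 \<Longrightarrow> z$4 = 0 \<Longrightarrow> z$5 = 0 \<Longrightarrow> polar a b x y z = 0"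
  by (simp add: polar_def dcub_def)

lemma polar_sym: "polar a b x y z = polar a b y x z"
  by (simp add: polar_def add.commute)

text \<open>On nodes of types P, Q, N the polar form is a nonzero multiple of some b +- a +- 1,
  where 1 - 2p and 1 - 2q encode signs; with a second P or Q it is nonzero unless that node repeats.
  So no third node spans with \<open>n\<close> and \<open>m\<close> a plane on the cubic.\<close>

lemma polar_PQ:
  fixes a b :: "'k::field_char_0"
  assumes a: "a \<noteq> 0" and b: "\<And>r s. r * r = 1 \<Longrightarrow> s * s = 1 \<Longrightarrow> b \<noteq> r * (1 + s * a)"
    and n: "is_P a n" and m: "is_Q m" and k: "is_sing a k" "polar a b n m k = 0"
  shows "\<exists>c. k = c *s n \<or> k = c *s m"
proof -
  have n': "n$2 = 0" "n$3 = 0" "n$4 = 0" "n$5 \<noteq> 0" and m': "m$1 = 0" "m$3 = 0" "m$5 = 0" "m$4 \<noteq> 0"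
    using n m by (auto simp: is_P_def is_Q_def)
  obtain p where p: "n$1 = a * n$5 * p" "p = 0 \<or> p = 1" using n unfolding is_P_def by (metis mult_zero_right mult.right_neutral)
  obtain q where q: "m$2 = m$4 * q" "q = 0 \<or> q = 1" using m unfolding is_Q_def by (metis mult_zero_right mult.right_neutral)
  consider "is_N k" | "is_P a k" | "is_Q k" using k(1) unfolding is_sing_def by blast
  then show ?thesis
  proof cases
    case 1
    then obtain s t where st: "k$1 = s * k$3" "k$2 = t * k$3" "s = 1 \<or> s = -1" "t = 1 \<or> t = -1" and k': "k$4 = 0" "k$5 = 0" "k$3 \<noteq> 0"
      unfolding is_N_def by (metis mult_1 mult_minus1)
    have "polar a b n m k = n$5 * m$4 * k$3 * (b + (1 - 2 * p) * s * a + (1 - 2 * q) * t)"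
      unfolding polar_def dcub_def vector_add_component n' m' k' st(1,2) p(1) q(1) by (simp add: algebra_simps)
    then have "b + (1 - 2 * p) * s * a + (1 - 2 * q) * t = 0" using k(2) n' m' k' by simp
    moreover have "((1 - 2 * q) * t) * ((1 - 2 * q) * t) = 1" "((1 - 2 * p) * s) * ((1 - 2 * p) * s) = 1"
      using p(2) q(2) st by auto
    \<comment> \<open>For signs A and T the equation b + A a + T = 0 reads b = -T (1 + A T a), which
      is the form excluded by hypothesis.\<close>
    moreover define r where "r = - ((1 - 2 * q) * t)"
    moreover define u where "u = (1 - 2 * p) * s * ((1 - 2 * q) * t)"
    ultimately have "r * r = 1" "u * u = 1" "b = r * (1 + u * a)" by algebra+
    then show ?thesis using b by blast
  next
    case 2
    then obtain p' where k': "k$1 = a * k$5 * p'" "k$2 = 0" "k$3 = 0" "k$4 = 0" "p' = 0 \<or> p' = 1"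
      unfolding is_P_def by (metis mult_zero_right mult.right_neutral)
    have "polar a b n m k = a * a * (n$5 * m$4 * k$5) * (p + p' - 2 * p * p')"
      unfolding polar_def dcub_def vector_add_component n' m' k'(1-4) p(1) q(1) by (simp add: algebra_simps)
    moreover have "k$5 \<noteq> 0" using 2 unfolding is_P_def by blast
    ultimately have "p = p'" using k(2) a n' m' k'(5) p(2) by auto
    then have "k = (k$5 / n$5) *s n" using n' k' p by (simp add: vec_eq_5)
    then show ?thesis by blast
  next
    case 3
    then obtain q' where k': "k$2 = k$4 * q'" "k$1 = 0" "k$3 = 0" "k$5 = 0" "q' = 0 \<or> q' = 1"
      unfolding is_Q_def by (metis mult_zero_right mult.right_neutral)
    have "polar a b n m k = (n$5 * m$4 * k$4) * (q + q' - 2 * q * q')"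
      unfolding polar_def dcub_def vector_add_component n' m' k'(1-4) p(1) q(1) by (simp add: algebra_simps)
    moreover have "k$4 \<noteq> 0" using 3 unfolding is_Q_def by blast
    ultimately have "q = q'" using k(2) n' m' k'(5) q(2) by auto
    then have "k = (k$4 / m$4) *s m" using m' k' q by (simp add: vec_eq_5)
    then show ?thesis by blast
  qed
qed

text \<open>For any other pair of nodes a third can be named: a further N for two N, the second P or
  Q when N is paired with P or Q, and (1,1,1,0,0) for two P or two Q. So the polar form alone
  characterises the P-Q pairs.\<close>

lemma polar_PQ_converse:
  fixes a b :: "'k::field_char_0"
  assumes a: "a \<noteq> 0" and n: "is_sing a n" and m: "is_sing a m" and nm: "\<And>c. m \<noteq> c *s n"
    and only: "\<And>k. is_sing a k \<Longrightarrow> polar a b n m k = 0 \<Longrightarrow> \<exists>c. k = c *s n \<or> k = c *s m"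
  shows "is_P a n \<and> is_Q m \<or> is_Q n \<and> is_P a m"
proof -
  have NN: False if N: "is_N n" "is_N m"
  proof -
    \<comment> \<open>Two candidates are needed, since one of them may be proportional to
      \<open>m\<close>.\<close>
    define k1 k2 where "k1 = (vector [- n$1, n$2, n$3, 0, 0] :: 'k ^ 5)" and "k2 = (vector [n$1, - n$2, n$3, 0, 0] :: 'k ^ 5)"
    have k: "is_sing a k1" "is_sing a k2" using N(1) by (auto simp: is_sing_def is_N_def k1_def k2_def)
    have "polar a b n m k1 = 0" "polar a b n m k2 = 0"
      using N by (auto intro!: polar_plane simp: is_N_def k1_def k2_def)
    moreover have "k1 \<noteq> c *s n" "k2 \<noteq> c *s n" for c
      using N(1) by (auto simp: k1_def k2_def is_N_def vec_eq_5)
    ultimately obtain c d where c: "k1 = c *s m" "k2 = d *s m" using only k by metis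
    then have "c * m$3 = d * m$3" unfolding k1_def k2_def vec_eq_5 by simp
    then have "c = d" using N(2) by (simp add: is_N_def)
    with c have "k1 = k2" by simp
    then show False using N(1) by (auto simp: k1_def k2_def is_N_def vec_eq_5)
  qed
  have NP: False if xy: "is_N x" "is_P a y" and ex: "\<And>k. is_sing a k \<Longrightarrow> polar a b x y k = 0 \<Longrightarrow> \<exists>c. k = c *s x \<or> k = c *s y" for x y
  proof -
    \<comment> \<open>The first coordinate exchanges the admissible values 0 and a, so
      \<open>k\<close> is the other node of type P.\<close>
    define k where "k = (vector [a - y$1 / y$5, 0, 0, 0, 1] :: 'k ^ 5)"
    have y5: "y$5 \<noteq> 0" using that(2) by (simp add: is_P_def)
    have "is_sing a k" using that(2) by (auto simp: k_def is_sing_def is_P_def)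
    moreover have "polar a b x y k = 0"
      using that(1,2) y5 by (auto simp: polar_def dcub_def k_def is_N_def is_P_def algebra_simps)
    ultimately obtain c where "k = c *s x \<or> k = c *s y" using ex by blast
    then show False using xy a by (auto simp: k_def is_N_def is_P_def vec_eq_5)
  qed
  have NQ: False if xy: "is_N x" "is_Q y" and ex: "\<And>k. is_sing a k \<Longrightarrow> polar a b x y k = 0 \<Longrightarrow> \<exists>c. k = c *s x \<or> k = c *s y" for x y
  proof -
    define k where "k = (vector [0, 1 - y$2 / y$4, 0, 1, 0] :: 'k ^ 5)"
    have y5: "y$4 \<noteq> 0" using that(2) by (simp add: is_Q_def)
    have "is_sing a k" using that(2) by (auto simp: k_def is_sing_def is_Q_def)
    moreover have "polar a b x y k = 0"
      using that(1,2) y5 by (auto simp: polar_def dcub_def k_def is_N_def is_Q_def algebra_simps)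
    ultimately obtain c where "k = c *s x \<or> k = c *s y" using ex by blast
    then show False using xy by (auto simp: k_def is_N_def is_Q_def vec_eq_5)
  qed
  have same: False if "is_P a n \<and> is_P a m \<or> is_Q n \<and> is_Q m"
  proof -
    define k where "k = (vector [1, 1, 1, 0, 0] :: 'k ^ 5)"
    have "is_sing a k" by (simp add: k_def is_sing_def is_N_def)
    moreover have "polar a b n m k = 0"
    proof (cases "is_P a n")
      case True
      with that have "is_P a m" by (auto simp: is_P_def is_Q_def)
      with True nm[of "m$5 / n$5"] show ?thesis
        by (auto simp: polar_def dcub_def k_def is_P_def vec_eq_5 algebra_simps)
    next
      case False
      with that have "is_Q n" "is_Q m" by auto
      with nm[of "m$4 / n$4"] show ?thesis
        by (auto simp: polar_def dcub_def k_def is_Q_def vec_eq_5 algebra_simps)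
    qed
    ultimately obtain c where "k = c *s n \<or> k = c *s m" using only by blast
    then show False using that by (auto simp: k_def is_P_def is_Q_def vec_eq_5)
  qed
  have only': "\<exists>c. k = c *s m \<or> k = c *s n" if "is_sing a k" "polar a b m n k = 0" for k
    using only[of k] that polar_sym[of a b n m k] by auto
  show ?thesis
    using n m NN NP[of n m] NP[of m n] NQ[of n m] NQ[of m n] only only' same unfolding is_sing_def by blast
qed

section \<open>Normal form of the automorphisms\<close>

text \<open>In the coordinates \<open>x\<^sub>1 - a x\<^sub>5 / 2, x\<^sub>2 - x\<^sub>4 / 2, x\<^sub>3, x\<^sub>4, x\<^sub>5\<close> these maps are monomial: if \<open>w\<close> holds, the
  first two and the last two coordinates are swapped, and the coordinates are scaled by \<open>s, t, 1, m, m\<close>.\<close>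

type_synonym 'k par = "bool \<times> 'k \<times> 'k \<times> 'k"

definition monomial_map :: "'k::field \<Rightarrow> 'k par \<Rightarrow> 'k ^ 5 \<Rightarrow> 'k ^ 5" where
  "monomial_map a = (\<lambda>(w, s, t, m) x.
     if w then vector [t * x$2 + (m * a - t) / 2 * x$4, s * x$1 + (m - a * s) / 2 * x$5, x$3, m * x$5, m * x$4]
     else vector [s * x$1 + a * (m - s) / 2 * x$5, t * x$2 + (m - t) / 2 * x$4, x$3, m * x$4, m * x$5])"

text \<open>The conditions for the cubic to be multiplied by \<open>m\<close>. In
  \<open>cub_diagonal\<close> the squares require s^2 = t^2 = 1, the term in x3 x4 x5 gives the
  condition on \<open>b\<close>, and the two terms in x4 and x5 alone give the rest, their
  coefficients a^2 and 1 being exchanged if \<open>w\<close> holds.\<close>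

definition par_ok :: "'k::field \<Rightarrow> 'k \<Rightarrow> 'k par \<Rightarrow> bool" where
  "par_ok a b = (\<lambda>(w, s, t, m). s * s = 1 \<and> t * t = 1 \<and> b * (m * m - m) = 0 \<and>
     (if w then m * m = a * a \<and> a * a * (m * m) = 1 else m * m = 1))"

definition par_mult :: "'k::field par \<Rightarrow> 'k par \<Rightarrow> 'k par" where
  "par_mult = (\<lambda>(w, s, t, m) (w', s', t', m').
     (w \<noteq> w', if w' then t * s' else s * s', if w' then s * t' else t * t', m * m'))"

text \<open>If \<open>w\<close> holds then m^4 = a^2 m^2 = 1, so m^3 inverts \<open>m\<close>;
  otherwise m^2 = 1.\<close>

definition par_inv :: "'k::field par \<Rightarrow> 'k par" where
  "par_inv = (\<lambda>(w, s, t, m). if w then (w, t, s, m * m * m) else (w, s, t, m))"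

definition par_group :: "'k::field \<Rightarrow> 'k \<Rightarrow> 'k par monoid" where
  "par_group a b = \<lparr>carrier = {p. par_ok a b p}, monoid.mult = par_mult, one = (False, 1, 1, 1)\<rparr>"

lemma par_ok_nz: "par_ok a b (w, s, t, m) \<Longrightarrow> m \<noteq> 0"
  by (auto simp: par_ok_def split: if_splits)

lemma par_ok_one: "par_ok a b (w, s, t, m) \<Longrightarrow> b \<noteq> 0 \<Longrightarrow> m = 1"
proof -
  assume ok: "par_ok a b (w, s, t, m)" and b: "b \<noteq> 0"
  then have "b * (m * m - m) = 0" unfolding par_ok_def prod.case by blast
  then have "m * (m - 1) = 0" using b by (simp add: right_diff_distrib)
  then show "m = 1" using par_ok_nz[OF ok] by simp
qed

lemma par_mult_ok:
  assumes "par_ok a b p" "par_ok a b q"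
  shows "par_ok a b (par_mult p q)"
proof -
  obtain w s t m where p: "p = (w, s, t, m)" by (cases p)
  obtain w' s' t' m' where q: "q = (w', s', t', m')" by (cases q)
  have b: "b * (m * m' * (m * m') - m * m') = 0"
    using par_ok_one[of a b w s t m] par_ok_one[of a b w' s' t' m'] assms p q by (cases "b = 0") auto
  have sq: "(x * y) * (x * y) = 1" if "x * x = 1" "y * y = 1" for x y :: 'a using that by algebra
  have h: "s * s = 1" "t * t = 1" "s' * s' = 1" "t' * t' = 1"
    "if w then m * m = a * a \<and> a * a * (m * m) = 1 else m * m = 1"
    "if w' then m' * m' = a * a \<and> a * a * (m' * m') = 1 else m' * m' = 1"
    using assms by (auto simp: p q par_ok_def)
  have "if w \<noteq> w' then (m * m') * (m * m') = a * a \<and> a * a * ((m * m') * (m * m')) = 1 else (m * m') * (m * m') = 1"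
    using h(5,6) by (cases w; cases w') (simp_all, algebra+)
  moreover have "(if w' then t * s' else s * s') * (if w' then t * s' else s * s') = 1"
    "(if w' then s * t' else t * t') * (if w' then s * t' else t * t') = 1"
    using sq h(1-4) by simp_all
  ultimately show ?thesis
    unfolding p q par_ok_def par_mult_def prod.case using b by blast
qed

lemma par_inv_ok:
  assumes "par_ok a b p"
  shows "par_ok a b (par_inv p)" "par_mult (par_inv p) p = (False, 1, 1, 1)"
proof -
  obtain w s t m where p: "p = (w, s, t, m)" by (cases p)
  have h: "s * s = 1" "t * t = 1" "b * (m * m - m) = 0" "if w then m * m = a * a \<and> a * a * (m * m) = 1 else m * m = 1"
    using assms by (auto simp: p par_ok_def)
  have m4: "m * m * m * m = 1" if w using h(4) that by (simp, algebra)
  have "b * (m * m * m * (m * m * m) - m * m * m) = 0" using h(3) by algebra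
  moreover have "m * m * m * (m * m * m) = a * a" "a * a * (m * m * m * (m * m * m)) = 1" if w
    using h(4) m4[OF that] that by (simp_all, algebra+)
  ultimately show "par_ok a b (par_inv p)" using h by (auto simp: p par_ok_def par_inv_def)
  show "par_mult (par_inv p) p = (False, 1, 1, 1)"
    using h m4 by (cases w) (auto simp: p par_mult_def par_inv_def)
qed

lemma group_par_group: "group (par_group a b)"
proof (rule groupI)
  fix p q r assume pqr: "p \<in> carrier (par_group a b)" "q \<in> carrier (par_group a b)" "r \<in> carrier (par_group a b)"
  show "p \<otimes>\<^bsub>par_group a b\<^esub> q \<in> carrier (par_group a b)"
    using pqr unfolding par_group_def by (simp add: par_mult_ok)
  show "p \<otimes>\<^bsub>par_group a b\<^esub> q \<otimes>\<^bsub>par_group a b\<^esub> r = p \<otimes>\<^bsub>par_group a b\<^esub> (q \<otimes>\<^bsub>par_group a b\<^esub> r)"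
    by (cases p; cases q; cases r) (auto simp: par_group_def par_mult_def)
next
  show "\<one>\<^bsub>par_group a b\<^esub> \<in> carrier (par_group a b)" by (simp add: par_group_def par_ok_def)
next
  fix p assume p: "p \<in> carrier (par_group a b)"
  show "\<one>\<^bsub>par_group a b\<^esub> \<otimes>\<^bsub>par_group a b\<^esub> p = p"
    by (cases p) (auto simp: par_group_def par_mult_def)
  show "\<exists>q \<in> carrier (par_group a b). q \<otimes>\<^bsub>par_group a b\<^esub> p = \<one>\<^bsub>par_group a b\<^esub>"
    using p par_inv_ok[of a b p] unfolding par_group_def by (intro bexI[of _ "par_inv p"]) simp_all
qed

lemma monomial_map_mult:
  fixes a :: "'k::field_char_0"
  shows "monomial_map a p (monomial_map a q x) = monomial_map a (par_mult p q) x"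
  by (cases p; cases q) (auto simp: monomial_map_def par_mult_def vec_eq_5 field_simps)

lemma monomial_map_one: "monomial_map a (False, 1, 1, 1) x = x"
  by (simp add: monomial_map_def vec_eq_5)

lemma monomial_map_scale: "monomial_map a p (c *s x) = c *s monomial_map a p x"
  by (cases p) (auto simp: monomial_map_def vec_eq_5 algebra_simps)

lemma monomial_map_inv:
  fixes a :: "'k::field_char_0"
  assumes "par_ok a b p"
  shows "monomial_map a (par_inv p) (monomial_map a p x) = x"
  unfolding monomial_map_mult par_inv_ok(2)[OF assms] by (rule monomial_map_one)

lemma monomial_map_zero: "monomial_map a p 0 = 0"
  using monomial_map_scale[of a p 0 0] by simp

lemma monomial_map_nz:
  fixes a :: "'k::field_char_0"
  shows "par_ok a b p \<Longrightarrow> x \<noteq> 0 \<Longrightarrow> monomial_map a p x \<noteq> 0"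
  using monomial_map_inv[of a b p x] monomial_map_zero[of a "par_inv p"] by metis

text \<open>Squares are completed in x1 and x2, which produces the coordinates in which the
  automorphisms are monomial; the factor 4 avoids fractions.\<close>

lemma cub_diagonal:
  "4 * cub a b x = 4 * b * x$3 * x$4 * x$5 + 4 * (x$4 + x$5) * (x$3 * x$3)
     - x$4 * (2 * x$1 - a * x$5)\<^sup>2 - x$5 * (2 * x$2 - x$4)\<^sup>2 + a * a * x$4 * (x$5 * x$5) + x$4 * x$4 * x$5"
  by (simp add: cub_def power2_eq_square algebra_simps)

lemma cub_monomial_map:
  fixes a b :: "'k::field_char_0"
  assumes "par_ok a b (w, s, t, m)"
  shows "cub a b (monomial_map a (w, s, t, m) x) = m * cub a b x"
proof -
  define y where "y = monomial_map a (w, s, t, m) x"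
  have h: "s * s = 1" "t * t = 1" "b * (m * m - m) = 0" "if w then m * m = a * a \<and> a * a * (m * m) = 1 else m * m = 1"
    using assms by (auto simp: par_ok_def)
  have "4 * cub a b y = m * (4 * cub a b x)"
  proof (cases w)
    case True
    have "2 * y$1 - a * y$5 = t * (2 * x$2 - x$4)" "2 * y$2 - y$4 = s * (2 * x$1 - a * x$5)"
      "y$3 = x$3" "y$4 = m * x$5" "y$5 = m * x$4"
      using True by (simp_all add: y_def monomial_map_def field_simps)
    then show ?thesis using h True unfolding cub_diagonal by (simp, algebra)
  next
    case False
    have "2 * y$1 - a * y$5 = s * (2 * x$1 - a * x$5)" "2 * y$2 - y$4 = t * (2 * x$2 - x$4)"
      "y$3 = x$3" "y$4 = m * x$4" "y$5 = m * x$5"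
      using False by (simp_all add: y_def monomial_map_def field_simps)
    then show ?thesis using h False unfolding cub_diagonal by (simp, algebra)
  qed
  then show ?thesis by (simp add: y_def)
qed

text \<open>Polar values are multiplied by \<mu>, so P-Q pairs go to P-Q pairs and nodes of type N
  to nodes of type N. This preserves the plane x4 = x5 = 0; columns of \<open>A\<close> are then
  read off from differences of nodes, and values of the cubic at a few points fix the remaining
  scalars.\<close>

lemma normal_form:
  fixes a b :: "'k::field_char_0"
  assumes a: "a \<noteq> 0" and nodal: "nodal_with (cubic_form a b) 8"
    and A: "det A \<noteq> 0" "\<And>x. cub a b x = 0 \<Longrightarrow> cub a b (A *v x) = 0"
  obtains p c where "c \<noteq> 0" "par_ok a b p" "\<And>x. A *v x = c *s monomial_map a p x"
proof -
  note result = that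
  obtain \<mu> where \<mu>: "\<mu> \<noteq> 0" "\<And>x. cub a b (A *v x) = \<mu> * cub a b x"
    "\<And>x v. dcub a b (A *v x) (A *v v) = \<mu> * dcub a b x v" using linear_multiplier[OF a A] by metis
  note bpar = nodal_parameters[OF a nodal]
  have surj: "\<exists>z. A *v z = y" for y using surj_of_det_nonzero[OF A(1)] by blast
  have ker: "x = 0" if "A *v x = 0" for x
    using A(1) that unfolding invertible_det_nz[symmetric] invertible_left_inverse matrix_left_invertible_ker by blast
  have inj: "x = y" if "A *v x = A *v y" for x y
    using ker[of "x - y"] that by (simp add: matrix_vector_mult_diff_distrib)
  have A0: "A *v x \<noteq> 0" if "x \<noteq> 0" for x using inj[of x 0] that by auto
  have sing: "is_sing a (A *v x) \<longleftrightarrow> is_sing a x" for x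
  proof -
    have "(\<forall>z. dcub a b (A *v x) z = 0) \<longleftrightarrow> (\<forall>z. dcub a b (A *v x) (A *v z) = 0)" using surj by metis
    also have "\<dots> \<longleftrightarrow> (\<forall>z. dcub a b x z = 0)" using \<mu>(1) by (simp add: \<mu>(3))
    finally have "(\<forall>z. dcub a b (A *v x) z = 0) \<longleftrightarrow> (\<forall>z. dcub a b x z = 0)" .
    moreover have "A *v x \<noteq> 0 \<longleftrightarrow> x \<noteq> 0" using A0[of x] by (cases "x = 0") auto
    ultimately show ?thesis unfolding is_sing_iff[OF a nodal] by blast
  qed
  have pol: "polar a b (A *v x) (A *v y) (A *v z) = \<mu> * polar a b x y z" for x y z
    unfolding polar_def matrix_vector_right_distrib[symmetric] \<mu>(3) by (simp add: algebra_simps)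
  have scale: "A *v x = c *s (A *v y) \<longleftrightarrow> x = c *s y" for x y c
    using inj by (auto simp flip: vec.scale)
  have PQ_sing: "is_sing a x" if "is_P a x \<or> is_Q x" for x using that by (auto simp: is_sing_def)
  have PQ_ne: "y \<noteq> c *s x" if "is_P a x" "is_Q y" for x y c
    using that by (auto simp: is_P_def is_Q_def)
  have PQ: "is_P a (A *v n) \<and> is_Q (A *v m) \<or> is_Q (A *v n) \<and> is_P a (A *v m)" if nm: "is_P a n" "is_Q m" for n m
  proof (rule polar_PQ_converse[OF a])
    show "is_sing a (A *v n)" "is_sing a (A *v m)" using PQ_sing nm by (simp_all add: sing)
    show "A *v m \<noteq> c *s (A *v n)" for c using PQ_ne[OF nm] scale by blast
    show "\<exists>c. k = c *s (A *v n) \<or> k = c *s (A *v m)" if "is_sing a k" "polar a b (A *v n) (A *v m) k = 0" for k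
    proof -
      obtain z where z: "k = A *v z" using surj by metis
      have "is_sing a z" "polar a b n m z = 0" using that \<mu>(1) unfolding z sing pol by simp_all
      then have "\<exists>c. z = c *s n \<or> z = c *s m"
        by (rule polar_PQ[OF a _ nm, rotated]) (rule bpar)
      then show ?thesis unfolding z scale .
    qed
  qed
  have PQ': "is_P a n \<and> is_Q m \<or> is_Q n \<and> is_P a m" if nm: "is_P a (A *v n)" "is_Q (A *v m)" for n m
  proof (rule polar_PQ_converse[OF a])
    show "is_sing a n" "is_sing a m" using PQ_sing[of "A *v n"] PQ_sing[of "A *v m"] nm unfolding sing by simp_all
    show "m \<noteq> c *s n" for c using PQ_ne[OF nm] scale by blast
    show "\<exists>c. k = c *s n \<or> k = c *s m" if "is_sing a k" "polar a b n m k = 0" for k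
    proof -
      have "is_sing a (A *v k)" "polar a b (A *v n) (A *v m) (A *v k) = 0" using that unfolding sing pol by simp_all
      then have "\<exists>c. A *v k = c *s (A *v n) \<or> A *v k = c *s (A *v m)"
        by (rule polar_PQ[OF a _ nm, rotated]) (rule bpar)
      then show ?thesis unfolding scale .
    qed
  qed
  have AN: "is_N (A *v n)" if n: "is_N n" for n
  proof -
    have not: "\<not> is_P a n" "\<not> is_Q n" using n by (auto simp: is_N_def is_P_def is_Q_def)
    obtain p q where pq: "A *v p = vector [0,0,0,0,1]" "A *v q = vector [0,0,0,1,0]" using surj by metis
    have "is_P a (A *v p)" "is_Q (A *v q)" unfolding pq by (simp_all add: is_P_def is_Q_def)
    then have "\<not> is_P a (A *v n)" "\<not> is_Q (A *v n)" using PQ'[of n q] PQ'[of p n] not by blast+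
    moreover have "is_sing a n" using n by (simp add: is_sing_def)
    then have "is_sing a (A *v n)" by (simp only: sing)
    ultimately show ?thesis by (simp add: is_sing_def)
  qed
  define e1 e2 e3 e4 e5 :: "'k ^ 5" where e: "e1 = vector [1,0,0,0,0]" "e2 = vector [0,1,0,0,0]"
    "e3 = vector [0,0,1,0,0]" "e4 = vector [0,0,0,1,0]" "e5 = vector [0,0,0,0,1]"
  define p1 p2 q1 q2 where pq: "p1 = A *v e5" "p2 = A *v (a *s e1 + e5)" "q1 = A *v e4" "q2 = A *v (e2 + e4)"
  have ex: "A *v x = x$1 *s (A *v e1) + x$2 *s (A *v e2) + x$3 *s (A *v e3) + x$4 *s q1 + x$5 *s p1" for x
    unfolding e pq by (simp add: matrix_vector_mult_def vec_eq_iff sum_5 mult.commute)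
  have p2: "p2 = a *s (A *v e1) + p1" and q2: "q2 = A *v e2 + q1"
    unfolding pq by (simp_all add: matrix_vector_right_distrib vec.scale)
  have isP: "is_P a e5" "is_P a (a *s e1 + e5)" and isQ: "is_Q e4" "is_Q (e2 + e4)"
    by (simp_all add: e is_P_def is_Q_def)
  have N: "is_N (r *s (A *v e1) + s *s (A *v e2) + A *v e3)" if "r = 1 \<or> r = -1" "s = 1 \<or> s = -1" for r s
  proof -
    have "is_N (r *s e1 + s *s e2 + e3)" using that by (auto simp: e is_N_def)
    from AN[OF this] show ?thesis by (simp add: matrix_vector_right_distrib vec.scale)
  qed
  \<comment> \<open>Coordinates 4 and 5 of A(r e1 + s e2 + e3) vanish for all signs r, s; three sign
    choices already form an invertible system.\<close>
  have plane: "(A *v e1)$4 = 0" "(A *v e1)$5 = 0" "(A *v e2)$4 = 0" "(A *v e2)$5 = 0" "(A *v e3)$4 = 0" "(A *v e3)$5 = 0"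
  proof -
    have h: "u = 0 \<and> v = 0 \<and> w = 0" if "u + v + w = 0" "u - v + w = 0" "v - u + w = 0" for u v w :: 'k
    proof -
      have "2 * v = 0" "2 * u = 0" using that by algebra+
      then show ?thesis using that by simp
    qed
    have "(A *v e1)$i = 0 \<and> (A *v e2)$i = 0 \<and> (A *v e3)$i = 0" if "i = 4 \<or> i = 5" for i
    proof -
      have Ni: "r * (A *v e1)$i + s * (A *v e2)$i + (A *v e3)$i = 0" if "r = 1 \<or> r = -1" "s = 1 \<or> s = -1" for r s
        using N[OF that] \<open>i = 4 \<or> i = 5\<close> unfolding is_N_def vector_add_component vector_smult_component by blast
      show ?thesis
        by (rule h) (use Ni[of 1 1] Ni[of 1 "-1"] Ni[of "-1" 1] in simp_all)
    qed
    then show "(A *v e1)$4 = 0" "(A *v e1)$5 = 0" "(A *v e2)$4 = 0" "(A *v e2)$5 = 0" "(A *v e3)$4 = 0" "(A *v e3)$5 = 0"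
      by blast+
  qed
  have e12: "A *v e1 \<noteq> 0" "A *v e2 \<noteq> 0" by (rule A0, simp add: e vec_eq_5)+
  define c where "c = (A *v e3)$3"
  have sq: "x * x = y * y" if "x = y \<or> x = - y" for x y :: 'k using that by auto
  \<comment> \<open>All nodes A(r e1 + s e2 + e3) share the third coordinate c, so their coordinate
    \<open>i\<close> is c or -c. With v for coordinate \<open>i\<close> of A e3, comparing (v +
    \<alpha>)^2 = c^2 and (v - \<alpha>)^2 = c^2 gives v = 0 and \<alpha>^2 = c^2.\<close>
  have diag: "(A *v e3)$i = 0 \<and> \<alpha> * \<alpha> = c * c \<and> c \<noteq> 0"
    if i: "i = 1 \<or> i = 2" and j: "r0 = (A *v e1)$i \<and> s0 = (A *v e2)$i" "r0 = 0 \<and> s0 = \<alpha> \<or> r0 = \<alpha> \<and> s0 = 0"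
      and z: "(A *v e1)$3 = 0" "(A *v e2)$3 = 0" and \<alpha>: "\<alpha> \<noteq> 0" for i \<alpha> r0 s0
  proof -
    have c: "c \<noteq> 0" using N[of 1 1] z by (simp add: is_N_def c_def)
    have n: "(r * r0 + s * s0 + (A *v e3)$i) * (r * r0 + s * s0 + (A *v e3)$i) = c * c" if "r = 1 \<or> r = -1" "s = 1 \<or> s = -1" for r s
      using N[OF that] i j(1) z by (intro sq) (auto simp: is_N_def c_def)
    have h1: "r0 + s0 = \<alpha>" using j(2) by auto
    have h2: "(1 * r0 + 1 * s0 + (A *v e3)$i) * (1 * r0 + 1 * s0 + (A *v e3)$i) = c * c"
      "((-1) * r0 + (-1) * s0 + (A *v e3)$i) * ((-1) * r0 + (-1) * s0 + (A *v e3)$i) = c * c"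
      by (rule n; simp)+
    have n': "(\<alpha> + (A *v e3)$i) * (\<alpha> + (A *v e3)$i) = c * c" using h2(1) unfolding h1[symmetric] by simp
    have "((A *v e3)$i - \<alpha>) * ((A *v e3)$i - \<alpha>) = c * c" using h2(2) unfolding h1[symmetric] by (simp add: algebra_simps)
    moreover have "4 * (\<alpha> * (A *v e3)$i) = (\<alpha> + (A *v e3)$i) * (\<alpha> + (A *v e3)$i) - ((A *v e3)$i - \<alpha>) * ((A *v e3)$i - \<alpha>)"
      by (simp add: algebra_simps)
    ultimately have "4 * (\<alpha> * (A *v e3)$i) = 0" using n' by simp
    then have v0: "(A *v e3)$i = 0" using \<alpha> by simp
    moreover have "\<alpha> * \<alpha> = c * c" using n' v0 by simp
    ultimately show ?thesis using c by blast
  qed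
  have fin: ?thesis
    if c: "c \<noteq> 0" and A3: "A *v e3 = c *s e3" and A12: "A *v e1 = vector [if w then 0 else \<alpha>, if w then \<alpha> else 0, 0, 0, 0]"
      "A *v e2 = vector [if w then \<beta> else 0, if w then 0 else \<beta>, 0, 0, 0]" and \<alpha>\<beta>: "\<alpha> * \<alpha> = c * c" "\<beta> * \<beta> = c * c"
      and A45: "p1 = vector [if w then 0 else a * (m5 - \<alpha>) / 2, if w then (m5 - a * \<alpha>) / 2 else 0, 0, if w then m5 else 0, if w then 0 else m5]"
      "q1 = vector [if w then (m4 * a - \<beta>) / 2 else 0, if w then 0 else (m4 - \<beta>) / 2, 0, if w then 0 else m4, if w then m4 else 0]"
      and mm: "if w then m5 * m5 = a * a * (c * c) \<and> a * a * (m4 * m4) = c * c else m5 * m5 = c * c" for w \<alpha> \<beta> m4 m5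
  proof -
    define s t m where "s = \<alpha> / c" and "t = \<beta> / c" and "m = m4 / c"
    have st: "s * s = 1" "t * t = 1" using \<alpha>\<beta> c by (simp_all add: s_def t_def)
    have "\<alpha> = c * s" "\<beta> = c * t" "m4 = c * m" using c by (simp_all add: s_def t_def m_def)
    note subst = this
    \<comment> \<open>The cubic equals 1 at both (0,0,1,1,0) and (0,0,1,0,1), so its values at the
      images agree, which forces m4 = m5.\<close>
    have v4: "cub a b (A *v vector [0,0,1,1,0]) = c * c * m4"
      unfolding ex[of "vector [0,0,1,1,0]"] A3 A12 A45 by (simp add: e cub_def algebra_simps)
    have v5: "cub a b (A *v vector [0,0,1,0,1]) = c * c * m5"
      unfolding ex[of "vector [0,0,1,0,1]"] A3 A12 A45 by (simp add: e cub_def algebra_simps)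
    have "c * c * m4 = c * c * m5"
      unfolding v4[symmetric] v5[symmetric] \<mu>(2) by (simp add: cub_def)
    then have m5: "m5 = c * m" using c subst by simp
    have mu: "\<mu> = c * c * (c * m)" using v4 unfolding \<mu>(2) subst by (simp add: cub_def)
    have m: "if w then m * m = a * a \<and> a * a * (m * m) = 1 else m * m = 1"
    proof (cases w)
      case True
      then have "c * m * (c * m) = a * a * (c * c)" "a * a * (c * m * (c * m)) = c * c" using mm unfolding m5 subst by simp_all
      then have "c * c * (m * m - a * a) = 0" "c * c * (a * a * (m * m) - 1) = 0" by (algebra, algebra)
      then show ?thesis using True c by simp
    next
      case False
      then have "c * m * (c * m) = c * c" using mm unfolding m5 subst by simp
      then have "c * c * (m * m - 1) = 0" by algebra
      then show ?thesis using False c by simp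
    qed
    have monomial: "A *v x = c *s monomial_map a (w, s, t, m) x" for x
      unfolding ex[of x] A3 A12 A45 subst m5 by (cases w) (simp_all add: e monomial_map_def vec_eq_5 field_simps)
    \<comment> \<open>Evaluation at (0,0,1,1,1), where the term with b contributes and the cubic
      equals b + 2.\<close>
    have "b * (m * m - m) = 0"
    proof -
      define y where "y = monomial_map a (w, s, t, m) (vector [0,0,1,1,1])"
      have "c ^ 3 * cub a b y = \<mu> * cub a b (vector [0,0,1,1,1])"
        unfolding \<mu>(2)[symmetric] monomial y_def[symmetric] by (rule homogD[OF cub_homog c, symmetric])
      then have "c ^ 3 * (cub a b y - m * (b + 2)) = 0"
        unfolding mu by (simp add: cub_def algebra_simps power3_eq_cube)
      then have "4 * cub a b y = 4 * m * (b + 2)" using c by simp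
      moreover have "4 * cub a b y = 4 * b * (m * m) + 8 * m"
      proof (cases w)
        case True
        have "2 * y$1 - a * y$5 = - t" "2 * y$2 - y$4 = - (s * a)" "y$3 = 1" "y$4 = m" "y$5 = m"
          using True by (simp_all add: y_def monomial_map_def field_simps)
        then show ?thesis using m st True unfolding cub_diagonal by (simp, algebra)
      next
        case False
        have "2 * y$1 - a * y$5 = - (s * a)" "2 * y$2 - y$4 = - t" "y$3 = 1" "y$4 = m" "y$5 = m"
          using False by (simp_all add: y_def monomial_map_def field_simps)
        then show ?thesis using m st False unfolding cub_diagonal by (simp, algebra)
      qed
      ultimately have "4 * (b * (m * m - m)) = 0" by algebra
      then show ?thesis by simp
    qed
    then have "par_ok a b (w, s, t, m)" using m st by (simp add: par_ok_def)
    with result c monomial show ?thesis by blast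
  qed
  \<comment> \<open>The image of the node e5 is of type P or of type Q, which decides whether
    coordinates are swapped.\<close>
  show ?thesis
  proof (cases "is_P a p1")
    case True
    have Q1: "is_Q q1" and P2: "is_P a p2" and Q2: "is_Q q2"
      using PQ[OF isP(1) isQ(1)] PQ[OF isP(1) isQ(2)] PQ[OF isP(2) isQ(1)] True
      unfolding pq[symmetric] by (auto simp: is_P_def is_Q_def)
    define \<alpha> \<beta> where "\<alpha> = (A *v e1)$1" and "\<beta> = (A *v e2)$2"
    \<comment> \<open>a A e1 = p2 - p1 is a difference of two nodes of type P, so only coordinates 1
      and 5 can survive, and \<open>plane\<close> removes the latter.\<close>
    have A1: "A *v e1 = vector [\<alpha>, 0, 0, 0, 0]"
      using True P2 a plane unfolding is_P_def p2 \<alpha>_def by (simp add: vec_eq_5)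
    have A2: "A *v e2 = vector [0, \<beta>, 0, 0, 0]"
      using Q1 Q2 plane unfolding is_Q_def q2 \<beta>_def by (simp add: vec_eq_5)
    have nz: "\<alpha> \<noteq> 0" "\<beta> \<noteq> 0" using e12 unfolding A1 A2 by (auto simp: vec_eq_5)
    have d: "(A *v e3)$1 = 0" "\<alpha> * \<alpha> = c * c" "c \<noteq> 0" "(A *v e3)$2 = 0" "\<beta> * \<beta> = c * c"
      using diag[of 1 \<alpha> 0 \<alpha>] diag[of 2 0 \<beta> \<beta>] nz by (simp_all add: A1 A2)
    have A3: "A *v e3 = c *s e3" using d plane by (simp add: e vec_eq_5 c_def)
    define m5 m4 where "m5 = p1$5" and "m4 = q1$4"
    have p: "p1$1 = 0 \<and> \<alpha> = m5 \<or> p1$1 = a * m5 \<and> m5 = - \<alpha>"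
      using True P2 nz a unfolding is_P_def p2 A1 m5_def by (auto simp: eq_neg_iff_add_eq_0 add.commute simp flip: distrib_left)
    have q: "q1$2 = 0 \<and> \<beta> = m4 \<or> q1$2 = m4 \<and> m4 = - \<beta>"
      using Q1 Q2 nz unfolding is_Q_def q2 A2 m4_def by (auto simp: eq_neg_iff_add_eq_0 add.commute)
    show ?thesis
    proof (rule fin[of False \<alpha> \<beta> m5 m4])
      show "p1 = vector [if False then 0 else a * (m5 - \<alpha>) / 2, if False then (m5 - a * \<alpha>) / 2 else 0, 0, if False then m5 else 0, if False then 0 else m5]"
        using True p by (auto simp: is_P_def vec_eq_5 m5_def)
      show "q1 = vector [if False then (m4 * a - \<beta>) / 2 else 0, if False then 0 else (m4 - \<beta>) / 2, 0, if False then 0 else m4, if False then m4 else 0]"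
        using Q1 q by (auto simp: is_Q_def vec_eq_5 m4_def)
      show "if False then m5 * m5 = a * a * (c * c) \<and> a * a * (m4 * m4) = c * c else m5 * m5 = c * c"
        using p d by auto
    qed (simp_all add: A1 A2 A3 d(2,3,5))
  next
    case False
    have P1: "is_Q p1" and Q1: "is_P a q1" and P2: "is_Q p2" and Q2: "is_P a q2"
      using PQ[OF isP(1) isQ(1)] PQ[OF isP(1) isQ(2)] PQ[OF isP(2) isQ(1)] False
      unfolding pq[symmetric] by (auto simp: is_P_def is_Q_def)
    define \<alpha> \<beta> where "\<alpha> = (A *v e1)$2" and "\<beta> = (A *v e2)$1"
    have A1: "A *v e1 = vector [0, \<alpha>, 0, 0, 0]"
      using P1 P2 a plane unfolding is_Q_def p2 \<alpha>_def by (simp add: vec_eq_5)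
    have A2: "A *v e2 = vector [\<beta>, 0, 0, 0, 0]"
      using Q1 Q2 plane unfolding is_P_def q2 \<beta>_def by (simp add: vec_eq_5)
    have nz: "\<alpha> \<noteq> 0" "\<beta> \<noteq> 0" using e12 unfolding A1 A2 by (auto simp: vec_eq_5)
    have d: "(A *v e3)$2 = 0" "\<alpha> * \<alpha> = c * c" "c \<noteq> 0" "(A *v e3)$1 = 0" "\<beta> * \<beta> = c * c"
      using diag[of 2 \<alpha> 0 \<alpha>] diag[of 1 0 \<beta> \<beta>] nz by (simp_all add: A1 A2)
    have A3: "A *v e3 = c *s e3" using d plane by (simp add: e vec_eq_5 c_def)
    define m5 m4 where "m5 = p1$4" and "m4 = q1$5"
    have p: "p1$2 = 0 \<and> m5 = a * \<alpha> \<or> p1$2 = m5 \<and> m5 = - (a * \<alpha>)"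
      using P1 P2 nz a unfolding is_Q_def p2 A1 m5_def by (auto simp: eq_neg_iff_add_eq_0 add.commute)
    have q: "q1$1 = 0 \<and> m4 * a = \<beta> \<or> q1$1 = m4 * a \<and> m4 * a = - \<beta>"
      using Q1 Q2 nz unfolding is_P_def q2 A2 m4_def by (auto simp: eq_neg_iff_add_eq_0 add.commute mult.commute)
    show ?thesis
    proof (rule fin[of True \<alpha> \<beta> m5 m4])
      show "p1 = vector [if True then 0 else a * (m5 - \<alpha>) / 2, if True then (m5 - a * \<alpha>) / 2 else 0, 0, if True then m5 else 0, if True then 0 else m5]"
        using P1 p by (auto simp: is_Q_def vec_eq_5 m5_def)
      show "q1 = vector [if True then (m4 * a - \<beta>) / 2 else 0, if True then 0 else (m4 - \<beta>) / 2, 0, if True then 0 else m4, if True then m4 else 0]"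
        using Q1 q by (auto simp: is_P_def vec_eq_5 m4_def)
      have "m5 * m5 = (a * \<alpha>) * (a * \<alpha>)" using p by auto
      moreover have "(m4 * a) * (m4 * a) = \<beta> * \<beta>" using q by auto
      ultimately show "if True then m5 * m5 = a * a * (c * c) \<and> a * a * (m4 * m4) = c * c else m5 * m5 = c * c"
        using d by (simp add: mult_ac)
    qed (simp_all add: A1 A2 A3 d(2,3,5))
  qed
qed

section \<open>The automorphism group\<close>

definition linear_polyn :: "'k::comm_ring_1 ^ 'n::finite \<Rightarrow> ('n, 'k) polyn" where
  "linear_polyn r = (\<Sum>j\<in>UNIV. Poly_Mapping.single (Poly_Mapping.single j 1) (r $ j))"

lemma eval_linear_polyn: "eval_polyn (linear_polyn r) v = (\<Sum>j\<in>UNIV. r $ j * v $ j)"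
  unfolding linear_polyn_def eval_sum by (simp only: eval_polyn_lin_ext lin_ext_single monomial_single)

lemma homogeneous_linear_polyn: "homogeneous 1 (linear_polyn r)"
  unfolding homogeneous_def
proof
  fix m assume "m \<in> Poly_Mapping.keys (linear_polyn r)"
  then have "m \<in> (\<Union>j\<in>UNIV. Poly_Mapping.keys (Poly_Mapping.single (Poly_Mapping.single j (1::nat)) (r $ j)))"
    unfolding linear_polyn_def by (rule subsetD[OF Poly_Mapping.keys_sum])
  then obtain j where "m \<in> Poly_Mapping.keys (Poly_Mapping.single (Poly_Mapping.single j (1::nat)) (r $ j))"
    by (rule UN_E)
  then have m: "m = Poly_Mapping.single j 1" by (simp split: if_splits)
  have "(\<Sum>i\<in>UNIV. Poly_Mapping.lookup m i) = (\<Sum>i\<in>UNIV. if i = j then 1 else 0)"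
    unfolding m by (rule sum.cong) (auto simp: lookup_single when_def)
  then show "(\<Sum>i\<in>UNIV. Poly_Mapping.lookup m i) = 1" by simp
qed

lemma monomial_map_matrix:
  obtains M where "\<And>x. monomial_map a p x = M *v x"
proof (cases p)
  case (fields w s t m)
  show ?thesis
  proof (rule that)
    show "monomial_map a p x = (if w then
        matrix_of_columns (vector [0, s, 0, 0, 0]) (vector [t, 0, 0, 0, 0]) (vector [0, 0, 1, 0, 0])
          (vector [(m * a - t) / 2, 0, 0, 0, m]) (vector [0, (m - a * s) / 2, 0, m, 0])
      else matrix_of_columns (vector [s, 0, 0, 0, 0]) (vector [0, t, 0, 0, 0]) (vector [0, 0, 1, 0, 0])
          (vector [0, (m - t) / 2, 0, m, 0]) (vector [a * (m - s) / 2, 0, 0, 0, m])) *v x" for x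
      by (simp add: fields monomial_map_def matrix_of_columns_mult vec_eq_5 mult.commute)
  qed
qed

lemma regular_monomial_map:
  fixes a b :: "'k::field_char_0"
  assumes X: "X = hypersurface (cubic_form a b)" and p: "par_ok a b p"
    and f: "\<And>x. x \<noteq> 0 \<Longrightarrow> cub a b x = 0 \<Longrightarrow> f (proj_pt x) = proj_pt (monomial_map a p x)"
  shows "regular_map X X f"
  unfolding regular_map_def
proof (intro conjI ballI)
  obtain w s t m where pe: "p = (w, s, t, m)" by (cases p)
  show "f \<in> X \<rightarrow> X"
  proof
    fix q assume "q \<in> X"
    then obtain x where "q = proj_pt x" "x \<noteq> 0" "cub a b x = 0" unfolding X by (rule hypersurface_cases)
    then show "f q \<in> X" using f monomial_map_nz[OF p] cub_monomial_map[of a b w s t m x] p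
      unfolding X pe by (simp add: proj_pt_mem_hypersurface)
  qed
  obtain M where M: "\<And>x. monomial_map a p x = M *v x" using monomial_map_matrix by blast
  define Q where "Q i = linear_polyn (M $ i)" for i
  have Q: "(\<chi> i. eval_polyn (Q i) v) = monomial_map a p v" for v
    by (simp add: Q_def eval_linear_polyn M matrix_vector_mult_def)
  have one: "homogeneous 0 (Const (1::'k) :: (5, 'k) polyn)" by (auto simp: homogeneous_def Const_def)
  fix q0 assume "q0 \<in> X"
  show "\<exists>(g :: (5, 'k) polyn) e (Q :: 5 \<Rightarrow> (5, 'k) polyn) d.
      homogeneous e g \<and> (\<forall>i. homogeneous d (Q i)) \<and> (\<forall>v\<in>q0. eval_polyn g v \<noteq> 0) \<and>
      (\<forall>q\<in>X. \<forall>v\<in>q. eval_polyn g v \<noteq> 0 \<longrightarrow>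
         (\<chi> i. eval_polyn (Q i) v) \<noteq> 0 \<and> f q = proj_pt (\<chi> i. eval_polyn (Q i) v))"
  proof (intro exI conjI allI ballI impI)
    show "homogeneous 0 (Const (1::'k) :: (5, 'k) polyn)" by (rule one)
    show "homogeneous 1 (Q i)" for i unfolding Q_def by (rule homogeneous_linear_polyn)
    show "eval_polyn (Const (1::'k)) v \<noteq> 0" for v :: "'k ^ 5" by (simp add: eval_Const)
    fix q v assume "q \<in> X" and v: "v \<in> q"
    then obtain x where x: "q = proj_pt x" "x \<noteq> 0" "cub a b x = 0" unfolding X by (auto elim: hypersurface_cases)
    then obtain c where c: "c \<noteq> 0" "v = c *s x" using v unfolding proj_pt_def by blast
    show "(\<chi> i. eval_polyn (Q i) v) \<noteq> 0"
      unfolding Q by (rule monomial_map_nz[OF p]) (use c x in \<open>simp add: vec.scale_eq_0_iff\<close>)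
    show "f q = proj_pt (\<chi> i. eval_polyn (Q i) v)"
      unfolding Q c(2) x(1) monomial_map_scale f[OF x(2,3)] by (rule proj_pt_scale[OF c(1), symmetric])
  qed
qed

lemma proj_map_pt:
  assumes "proj_pt x \<in> X" "\<And>c x. T (c *s x) = c *s T x"
  shows "proj_map X T (proj_pt x) = proj_pt (T x)"
  using assms unfolding proj_map_def proj_pt_def by (auto simp: image_def)

lemma par_mult_inv:
  assumes "par_ok a b p"
  shows "par_mult p (par_inv p) = (False, 1, 1, 1)"
proof -
  interpret group "par_group a b" by (rule group_par_group)
  have "p \<in> carrier (par_group a b)" "par_inv p \<in> carrier (par_group a b)"
    "par_inv p \<otimes>\<^bsub>par_group a b\<^esub> p = \<one>\<^bsub>par_group a b\<^esub>"
    using assms par_inv_ok[OF assms] by (simp_all add: par_group_def)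
  then have "p \<otimes>\<^bsub>par_group a b\<^esub> par_inv p = \<one>\<^bsub>par_group a b\<^esub>" using inv_comm by blast
  then show ?thesis by (simp add: par_group_def)
qed

context
  fixes a b :: "'k::{alg_closed_field, field_char_0}" and X :: "('k ^ 5) set set"
  assumes X: "X = hypersurface (cubic_form a b)"
begin

abbreviation act :: "'k par \<Rightarrow> ('k ^ 5) set \<Rightarrow> ('k ^ 5) set" where
  "act p \<equiv> proj_map X (monomial_map a p)"

lemma mem_X: "proj_pt x \<in> X \<longleftrightarrow> x \<noteq> 0 \<and> cub a b x = 0"
  unfolding X by (rule proj_pt_mem_hypersurface)

lemma act_pt: "x \<noteq> 0 \<Longrightarrow> cub a b x = 0 \<Longrightarrow> act p (proj_pt x) = proj_pt (monomial_map a p x)"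
  by (rule proj_map_pt) (simp_all add: mem_X monomial_map_scale)

lemma monomial_map_X:
  assumes "par_ok a b p" "x \<noteq> 0" "cub a b x = 0"
  shows "monomial_map a p x \<noteq> 0" "cub a b (monomial_map a p x) = 0"
proof -
  obtain w s t m where p: "p = (w, s, t, m)" by (cases p)
  show "monomial_map a p x \<noteq> 0" by (rule monomial_map_nz[OF assms(1,2)])
  show "cub a b (monomial_map a p x) = 0"
    using assms cub_monomial_map[of a b w s t m x] unfolding p by simp
qed

lemma act_inverse:
  assumes p: "par_ok a b p" and q: "q \<in> X"
  shows "act p q \<in> X" "act (par_inv p) (act p q) = q" "act p (act (par_inv p) q) = q" "act (par_inv p) q \<in> X"
proof -
  obtain x where x: "q = proj_pt x" "x \<noteq> 0" "cub a b x = 0" using q unfolding X by (rule hypersurface_cases)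
  have i: "par_ok a b (par_inv p)" by (rule par_inv_ok(1)[OF p])
  note mp = monomial_map_X[OF p x(2,3)] and mi = monomial_map_X[OF i x(2,3)]
  show "act p q \<in> X" "act (par_inv p) q \<in> X" using mp mi by (simp_all add: x act_pt mem_X)
  show "act (par_inv p) (act p q) = q" using mp by (simp add: x act_pt monomial_map_inv[OF p])
  show "act p (act (par_inv p) q) = q"
    using mi by (simp add: x act_pt monomial_map_mult par_mult_inv[OF p] monomial_map_one)
qed

lemma act_bij:
  assumes p: "par_ok a b p"
  shows "act p \<in> Bij X"
proof -
  have "bij_betw (act p) X X"
    by (rule bij_betw_byWitness[where f' = "act (par_inv p)"]) (use act_inverse[OF p] in auto)
  then show ?thesis by (simp add: Bij_def proj_map_def)
qed

lemma act_aut: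
  assumes p: "par_ok a b p"
  shows "act p \<in> carrier (aut_group X)"
proof -
  have "inv_into X (act p) q = act (par_inv p) q" if "q \<in> X" for q
    using act_bij[OF p] act_inverse[OF p that] by (intro inv_into_f_eq) (auto simp: Bij_def bij_betw_def)
  then have "regular_map X X (inv_into X (act p))"
    by (intro regular_monomial_map[OF X par_inv_ok(1)[OF p]]) (simp add: mem_X act_pt)
  moreover have "regular_map X X (act p)"
    by (rule regular_monomial_map[OF X p]) (rule act_pt)
  ultimately show ?thesis using act_bij[OF p] by (simp add: aut_group_def)
qed

lemma act_mult:
  assumes p: "par_ok a b p" and q: "par_ok a b q"
  shows "act (par_mult p q) = act p \<otimes>\<^bsub>aut_group X\<^esub> act q"
proof -
  have "act (par_mult p q) = compose X (act p) (act q)"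
  proof
    fix z
    show "act (par_mult p q) z = compose X (act p) (act q) z"
    proof (cases "z \<in> X")
      case True
      then obtain x where x: "z = proj_pt x" "x \<noteq> 0" "cub a b x = 0" unfolding X by (rule hypersurface_cases)
      then show ?thesis
        using True monomial_map_X[OF q x(2,3)] by (simp add: compose_def act_pt monomial_map_mult)
    qed (simp add: compose_def proj_map_def)
  qed
  then show ?thesis using act_bij p q by (simp add: aut_group_def BijGroup_def)
qed

text \<open>The third coordinate is left unchanged, so where x3 = 1 equal image points have equal
  vectors. The point (1,0,1,1,0) detects \<open>w\<close> and \<open>m\<close>, and (1,1,1,0,0)
  detects \<open>s\<close> and \<open>t\<close>.\<close>

lemma act_inj:
  assumes p: "par_ok a b p" and q: "par_ok a b q" and eq: "act p = act q"
  shows "p = q"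
proof -
  obtain w s t m where pe: "p = (w, s, t, m)" by (cases p)
  obtain w' s' t' m' where qe: "q = (w', s', t', m')" by (cases q)
  have *: "monomial_map a p x = monomial_map a q x" if x: "cub a b x = 0" "x$3 = 1" for x
  proof -
    have "x \<noteq> 0" using x by auto
    then have "proj_pt (monomial_map a p x) = proj_pt (monomial_map a q x)"
      using fun_cong[OF eq, of "proj_pt x"] act_pt x by simp
    then obtain c where c: "monomial_map a q x = c *s monomial_map a p x" unfolding proj_pt_eq_iff by blast
    have "(monomial_map a p x)$3 = 1" "(monomial_map a q x)$3 = 1" using x by (simp_all add: pe qe monomial_map_def)
    with c show ?thesis by simp
  qed
  have nz: "m \<noteq> 0" "m' \<noteq> 0" using par_ok_nz p q pe qe by blast+
  have "monomial_map a p (vector [1, 0, 1, 1, 0]) = monomial_map a q (vector [1, 0, 1, 1, 0])"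
    by (rule *) (simp_all add: cub_def)
  then have wm: "w = w'" "m = m'" using nz by (auto simp: pe qe monomial_map_def vec_eq_5 split: if_splits)
  have "monomial_map a p (vector [1, 1, 1, 0, 0]) = monomial_map a q (vector [1, 1, 1, 0, 0])"
    by (rule *) (simp_all add: cub_def)
  then show ?thesis using wm by (auto simp: pe qe monomial_map_def vec_eq_5 split: if_splits)
qed

lemma act_surj:
  assumes a: "a \<noteq> 0" and nodal: "nodal_with (cubic_form a b) 8" and f: "f \<in> carrier (aut_group X)"
  obtains p where "par_ok a b p" "f = act p"
proof -
  have "finite (singular_points (cubic_form a b))" using nodal unfolding nodal_with_def by blast
  then have "cubic_threefold (cub a b) (dcub a b)" by (rule cubic_threefold_cub[OF a])
  then have aut: "cubic_automorphism (cub a b) (dcub a b) f (inv_into X f)" by (rule aut_cubic_automorphism[OF _ X f])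
  obtain A where A: "det A \<noteq> 0" "\<And>x. cub a b x = 0 \<Longrightarrow> cub a b (A *v x) = 0"
    "\<And>x. cub a b x = 0 \<Longrightarrow> x \<noteq> 0 \<Longrightarrow> f (proj_pt x) = proj_pt (A *v x)"
    using automorphism_linear[OF a aut] by metis
  obtain p c where p: "c \<noteq> 0" "par_ok a b p" "\<And>x. A *v x = c *s monomial_map a p x"
    using normal_form[OF a nodal A(1,2)] by metis
  have "f \<in> extensional X" using f by (simp add: aut_group_def Bij_def)
  moreover have "act p \<in> extensional X" by (simp add: proj_map_def)
  moreover have "f z = act p z" if z: "z \<in> X" for z
  proof -
    obtain x where x: "z = proj_pt x" "x \<noteq> 0" "cub a b x = 0" using z unfolding X by (rule hypersurface_cases)
    then show ?thesis using A(3)[OF x(3,2)] by (simp add: act_pt p proj_pt_scale)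
  qed
  ultimately have "f = act p" by (rule extensionalityI)
  with p(2) that show ?thesis by blast
qed

lemma act_iso:
  assumes "a \<noteq> 0" "nodal_with (cubic_form a b) 8"
  shows "act \<in> iso (par_group a b) (aut_group X)"
proof -
  have "act \<in> hom (par_group a b) (aut_group X)"
    by (rule homI) (simp_all add: par_group_def act_aut act_mult)
  moreover have "inj_on act (carrier (par_group a b))"
    by (rule inj_onI) (simp add: par_group_def act_inj)
  moreover have "act ` carrier (par_group a b) = carrier (aut_group X)"
    using act_aut act_surj[OF assms] by (auto simp: par_group_def) (metis image_eqI mem_Collect_eq)
  ultimately show ?thesis by (simp add: iso_def bij_betw_def)
qed

text \<open>The group axioms are transported along the surjective homomorphism \<open>act\<close>;
  composites of regular maps need no separate treatment.\<close>

lemma group_aut_group: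
  assumes "a \<noteq> 0" "nodal_with (cubic_form a b) 8"
  shows "group (aut_group X)"
proof -
  interpret group "par_group a b" by (rule group_par_group)
  have hom: "act \<in> hom (par_group a b) (aut_group X)" and im: "act ` carrier (par_group a b) = carrier (aut_group X)"
    using act_iso[OF assms] by (auto simp: iso_def bij_betw_def)
  have "act \<one>\<^bsub>par_group a b\<^esub> = \<one>\<^bsub>aut_group X\<^esub>"
  proof
    fix z show "act \<one>\<^bsub>par_group a b\<^esub> z = \<one>\<^bsub>aut_group X\<^esub> z"
      by (cases "z \<in> X") (auto simp: proj_map_def par_group_def aut_group_def BijGroup_def monomial_map_one image_def)
  qed
  then show ?thesis using hom_imp_img_group[OF hom] unfolding im by (simp add: aut_group_def)
qed

end

section \<open>Isomorphism types\<close>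

lemma cyclic_two: "x \<in> carrier (cyclic_grp 2) \<longleftrightarrow> x = 0 \<or> x = 1"
  by (auto simp: carrier_integer_mod_group)

lemma cyclic_four: "x \<in> carrier (cyclic_grp 4) \<longleftrightarrow> x = 0 \<or> x = 1 \<or> x = 2 \<or> x = 3"
  by (auto simp: carrier_integer_mod_group)

definition sg :: "int \<Rightarrow> 'k::field_char_0" where
  "sg x = (if x = 0 then 1 else -1)"

lemma sg_simps [simp]: "sg 0 = 1" "sg 1 = -1"
  by (simp_all add: sg_def)

lemma sg_mult: "x = 0 \<or> x = 1 \<Longrightarrow> y = 0 \<or> y = 1 \<Longrightarrow> sg ((x + y) mod 2) = sg x * sg y"
  by (auto simp: sg_def)

lemma sg_square: "sg x * sg x = 1"
  by (simp add: sg_def)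

lemma sg_eq_iff: "x = 0 \<or> x = 1 \<Longrightarrow> y = 0 \<or> y = 1 \<Longrightarrow> sg x = sg y \<longleftrightarrow> x = y"
  by auto

lemma sg_cases: "s * s = 1 \<Longrightarrow> \<exists>x. (x = 0 \<or> x = 1) \<and> s = sg x"
  by (cases "s = 1") (auto simp: sg_def square_eq_1_iff intro: exI[of _ 0] exI[of _ 1])

lemma group_dihedral_four: "group (dihedral_grp 4)"
proof (rule groupI)
  fix p q r assume pqr: "p \<in> carrier (dihedral_grp 4)" "q \<in> carrier (dihedral_grp 4)" "r \<in> carrier (dihedral_grp 4)"
  show "p \<otimes>\<^bsub>dihedral_grp 4\<^esub> q \<in> carrier (dihedral_grp 4)"
    by (cases p; cases q) (auto simp: dihedral_grp_def)
  show "p \<otimes>\<^bsub>dihedral_grp 4\<^esub> q \<otimes>\<^bsub>dihedral_grp 4\<^esub> r = p \<otimes>\<^bsub>dihedral_grp 4\<^esub> (q \<otimes>\<^bsub>dihedral_grp 4\<^esub> r)"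
    by (cases p; cases q; cases r) (auto simp: dihedral_grp_def mod_simps algebra_simps)
next
  show "\<one>\<^bsub>dihedral_grp 4\<^esub> \<in> carrier (dihedral_grp 4)" by (simp add: dihedral_grp_def)
next
  fix p assume p: "p \<in> carrier (dihedral_grp 4)"
  show "\<one>\<^bsub>dihedral_grp 4\<^esub> \<otimes>\<^bsub>dihedral_grp 4\<^esub> p = p"
    using p by (cases p) (auto simp: dihedral_grp_def)
  obtain x s where ps: "p = (x, s)" by (cases p)
  show "\<exists>q \<in> carrier (dihedral_grp 4). q \<otimes>\<^bsub>dihedral_grp 4\<^esub> p = \<one>\<^bsub>dihedral_grp 4\<^esub>"
    by (rule bexI[of _ "(if s then x mod 4 else (- x) mod 4, s)"]) (auto simp: ps dihedral_grp_def mod_simps)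
qed

text \<open>Forgetting \<open>m\<close> leaves the signed permutations of the first two coordinates, a dihedral group.\<close>

definition to_dihedral :: "'k::field par \<Rightarrow> int \<times> bool" where
  "to_dihedral = (\<lambda>(w, s, t, m). ((if s = 1 then 0 else 2) + (if w then 1 else 0), (s = t) = w))"

lemma to_dihedral_hom:
  fixes a b :: "'k::field_char_0"
  shows "to_dihedral \<in> hom (par_group a b) (dihedral_grp 4)"
proof (rule homI)
  fix p q :: "'k par"
  obtain w s t m where p: "p = (w, s, t, m)" by (cases p)
  obtain w' s' t' m' where q: "q = (w', s', t', m')" by (cases q)
  show "to_dihedral p \<in> carrier (dihedral_grp 4)" by (simp add: p to_dihedral_def dihedral_grp_def)
  assume "p \<in> carrier (par_group a b)" "q \<in> carrier (par_group a b)"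
  then have "s = 1 \<or> s = -1" "t = 1 \<or> t = -1" "s' = 1 \<or> s' = -1" "t' = 1 \<or> t' = -1"
    by (auto simp: par_group_def par_ok_def p q square_eq_1_iff)
  then show "to_dihedral (p \<otimes>\<^bsub>par_group a b\<^esub> q) = to_dihedral p \<otimes>\<^bsub>dihedral_grp 4\<^esub> to_dihedral q"
    by (elim disjE; cases w; cases w'; simp add: p q to_dihedral_def par_group_def par_mult_def dihedral_grp_def)
qed

text \<open>The fourth parameter stays free because the groups of order eight and sixteen fill it in
  differently.\<close>

lemma to_dihedral_cases:
  fixes y :: "int \<times> bool"
  assumes "y \<in> carrier (dihedral_grp 4)"
  obtains w and s t :: "'k::field_char_0" where "s * s = 1" "t * t = 1" "\<And>m. to_dihedral (w, s, t, m) = y"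
proof -
  obtain x r where y: "y = (x, r)" by (cases y)
  have "x = 0 \<or> x = 1 \<or> x = 2 \<or> x = 3" using assms by (auto simp: y dihedral_grp_def)
  then show ?thesis
  proof (elim disjE)
    assume "x = 0" then show ?thesis by (intro that[of 1 "if r then -1 else 1" False]) (auto simp: to_dihedral_def y)
  next
    assume "x = 1" then show ?thesis by (intro that[of 1 "if r then 1 else -1" True]) (auto simp: to_dihedral_def y)
  next
    assume "x = 2" then show ?thesis by (intro that[of "-1" "if r then 1 else -1" False]) (auto simp: to_dihedral_def y)
  next
    assume "x = 3" then show ?thesis by (intro that[of "-1" "if r then -1 else 1" True]) (auto simp: to_dihedral_def y)
  qed
qed

text \<open>The normal subgroup is the kernel of \<psi> composed with the inverse of
  \<open>h\<close>: the first isomorphism theorem gives the quotient, and \<open>h\<close> carries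
  the kernel of \<psi> onto this subgroup.\<close>

lemma extension_of_hom:
  assumes "group P" "group G" "group Q" and h: "h \<in> iso P G"
    and \<psi>: "\<psi> \<in> hom P Q" "\<psi> ` carrier P = carrier Q" and N: "P\<lparr>carrier := kernel P Q \<psi>\<rparr> \<cong> N"
  shows "is_extension G N Q"
proof -
  interpret P: group P by fact
  interpret G: group G by fact
  define k where "k = inv_into (carrier P) h"
  have k: "k \<in> iso G P" unfolding k_def by (rule P.iso_set_sym[OF h])
  have bij: "bij_betw h (carrier P) (carrier G)" using h by (simp add: iso_def)
  interpret \<psi>: group_hom P Q \<psi> by (intro group_hom.intro group_hom_axioms.intro assms)
  have hom: "\<psi> \<circ> k \<in> hom G Q" using k \<psi>(1) unfolding iso_def by (intro Group.hom_compose) auto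
  interpret \<phi>: group_hom G Q "\<psi> \<circ> k" by (intro group_hom.intro group_hom_axioms.intro assms hom)
  have kim: "k ` carrier G = carrier P" using k by (simp add: iso_def bij_betw_def)
  have ker: "kernel G Q (\<psi> \<circ> k) = h ` kernel P Q \<psi>"
  proof (intro equalityI subsetI)
    fix x assume "x \<in> kernel G Q (\<psi> \<circ> k)"
    then have x: "x \<in> carrier G" "\<psi> (k x) = \<one>\<^bsub>Q\<^esub>" by (simp_all add: kernel_def)
    then have "k x \<in> kernel P Q \<psi>" using kim by (auto simp: kernel_def)
    moreover have "x = h (k x)" unfolding k_def using bij_betw_inv_into_right[OF bij x(1)] by simp
    ultimately show "x \<in> h ` kernel P Q \<psi>" by blast
  next
    fix x assume "x \<in> h ` kernel P Q \<psi>"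
    then obtain p where p: "x = h p" "p \<in> carrier P" "\<psi> p = \<one>\<^bsub>Q\<^esub>" by (auto simp: kernel_def)
    then have "k x = p" unfolding k_def using bij_betw_inv_into_left[OF bij p(2)] by simp
    then show "x \<in> kernel G Q (\<psi> \<circ> k)" using p bij_betw_apply[OF bij p(2)] by (simp add: kernel_def)
  qed
  have "G Mod kernel G Q (\<psi> \<circ> k) \<cong> Q"
    by (rule \<phi>.FactGroup_iso) (simp only: image_comp[symmetric] kim \<psi>(2))
  moreover have "restrict h (kernel P Q \<psi>) \<in> iso (P\<lparr>carrier := kernel P Q \<psi>\<rparr>) (G\<lparr>carrier := h ` kernel P Q \<psi>\<rparr>)"
    by (rule iso_restrict[OF h assms(1,2) \<psi>.subgroup_kernel])
  then have "P\<lparr>carrier := kernel P Q \<psi>\<rparr> \<cong> G\<lparr>carrier := h ` kernel P Q \<psi>\<rparr>" by (rule is_isoI)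
  then have "G\<lparr>carrier := h ` kernel P Q \<psi>\<rparr> \<cong> P\<lparr>carrier := kernel P Q \<psi>\<rparr>"
    by (rule group.iso_sym[OF P.subgroup_imp_group[OF \<psi>.subgroup_kernel]])
  then have "G\<lparr>carrier := h ` kernel P Q \<psi>\<rparr> \<cong> N" using N by (rule iso_trans)
  ultimately show ?thesis unfolding is_extension_def using \<phi>.normal_kernel unfolding ker by blast
qed

lemma semidirect_product_iso:
  assumes "group P" "group G" and h: "h \<in> iso P G" and P: "is_semidirect_product P N H"
  shows "is_semidirect_product G N H"
proof -
  interpret P: group P by fact
  interpret G: group G by fact
  have hom: "h \<in> hom P G" and bij: "bij_betw h (carrier P) (carrier G)" using h by (auto simp: iso_def)
  interpret h: group_hom P G h by (intro group_hom.intro group_hom_axioms.intro assms hom)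
  obtain K L where KL: "K \<lhd> P" "subgroup L P" "K \<inter> L = {\<one>\<^bsub>P\<^esub>}" "K <#>\<^bsub>P\<^esub> L = carrier P"
    "P\<lparr>carrier := K\<rparr> \<cong> N" "P\<lparr>carrier := L\<rparr> \<cong> H"
    using P unfolding is_semidirect_product_def by blast
  have K: "subgroup K P" by (rule normal_imp_subgroup[OF KL(1)])
  have sub: "K \<subseteq> carrier P" "L \<subseteq> carrier P" using K KL(2) by (auto dest: subgroup.subset)
  have tr: "G\<lparr>carrier := h ` S\<rparr> \<cong> M" if "subgroup S P" "P\<lparr>carrier := S\<rparr> \<cong> M" for S M
  proof -
    have "P\<lparr>carrier := S\<rparr> \<cong> G\<lparr>carrier := h ` S\<rparr>" by (rule is_isoI[OF iso_restrict[OF h assms(1,2) that(1)]])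
    then have "G\<lparr>carrier := h ` S\<rparr> \<cong> P\<lparr>carrier := S\<rparr>" by (rule group.iso_sym[OF P.subgroup_imp_group[OF that(1)]])
    then show ?thesis using that(2) by (rule iso_trans)
  qed
  have "h ` K \<inter> h ` L = h ` (K \<inter> L)"
    using inj_on_image_Int[of h "carrier P" K L] bij sub by (simp add: bij_betw_def)
  then have "h ` K \<inter> h ` L = {\<one>\<^bsub>G\<^esub>}" using KL(3) by simp
  moreover have "h ` K <#>\<^bsub>G\<^esub> h ` L = h ` (K <#>\<^bsub>P\<^esub> L)"
  proof -
    have hm: "h (x \<otimes>\<^bsub>P\<^esub> y) = h x \<otimes>\<^bsub>G\<^esub> h y" if "x \<in> K" "y \<in> L" for x y
      using that sub by (intro h.hom_mult) auto
    then have "h ` (K <#>\<^bsub>P\<^esub> L) = (\<Union>x\<in>K. \<Union>y\<in>L. {h x \<otimes>\<^bsub>G\<^esub> h y})"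
      unfolding set_mult_def image_UN by (intro SUP_cong refl) simp
    then show ?thesis unfolding set_mult_def by simp
  qed
  then have "h ` K <#>\<^bsub>G\<^esub> h ` L = carrier G" using KL(4) bij by (simp add: bij_betw_def)
  moreover have "h ` K \<lhd> G" by (rule iso_normal_subgroup[OF h assms(1,2) KL(1)])
  moreover have "subgroup (h ` L) G" by (rule h.subgroup_img_is_subgroup[OF KL(2)])
  ultimately show ?thesis unfolding is_semidirect_product_def using tr[OF K KL(5)] tr[OF KL(2,6)] by blast
qed

lemma generate_iso:
  assumes "group P" "group G" and h: "h \<in> iso P G" and S: "S \<subseteq> carrier P"
    and gen: "\<And>p. p \<in> carrier P \<Longrightarrow> p \<in> generate P S"
  shows "carrier G = generate G (h ` S)"
proof -
  have hom: "h \<in> hom P G" and bij: "bij_betw h (carrier P) (carrier G)" using h by (auto simp: iso_def)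
  interpret group_hom P G h by (intro group_hom.intro group_hom_axioms.intro assms hom)
  have "generate P S = carrier P" using gen G.generate_incl[OF S] by blast
  then show ?thesis using generate_img[OF S] bij by (simp add: bij_betw_def)
qed

lemma par_group_mult: "x \<otimes>\<^bsub>par_group a b\<^esub> y = par_mult x y"
  by (simp add: par_group_def)

lemma generate_par_mult:
  "p \<in> generate (par_group a b) S \<Longrightarrow> q \<in> generate (par_group a b) S \<Longrightarrow> par_mult p q \<in> generate (par_group a b) S"
  using generate.eng[of p "par_group a b" S q] by (simp add: par_group_def)

lemma klein_iso:
  assumes P: "\<And>x y. x \<otimes>\<^bsub>P\<^esub> y = par_mult x y" and C: "carrier P = {(False, s, t, 1) |s t. s * s = (1 :: 'k::field_char_0) \<and> t * t = 1}"
  shows "cyclic_grp 2 \<times>\<times> cyclic_grp 2 \<cong> P"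
proof -
  let ?f = "\<lambda>(x, y). (False, sg x, sg y, 1 :: 'k)"
  have "?f \<in> iso (cyclic_grp 2 \<times>\<times> cyclic_grp 2) P"
    unfolding iso_def bij_betw_def
  proof (intro CollectI conjI homI inj_onI)
    show "?f ` carrier (cyclic_grp 2 \<times>\<times> cyclic_grp 2) = carrier P"
    proof (intro equalityI subsetI)
      fix p assume "p \<in> carrier P"
      then obtain s t where st: "p = (False, s, t, 1)" "s * s = 1" "t * t = 1" unfolding C by blast
      obtain x y where "x = 0 \<or> x = 1" "s = sg x" "y = 0 \<or> y = 1" "t = sg y" using sg_cases st(2,3) by metis
      then have "p = ?f (x, y)" "(x, y) \<in> carrier (cyclic_grp 2 \<times>\<times> cyclic_grp 2)"
        by (simp_all add: st(1) DirProd_def cyclic_two)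
      then show "p \<in> ?f ` carrier (cyclic_grp 2 \<times>\<times> cyclic_grp 2)" by blast
    qed (auto simp: C DirProd_def sg_square)
    fix u v assume uv: "u \<in> carrier (cyclic_grp 2 \<times>\<times> cyclic_grp 2)" "v \<in> carrier (cyclic_grp 2 \<times>\<times> cyclic_grp 2)"
    show "?f u \<in> carrier P" by (cases u) (simp add: C sg_square)
    show "?f (u \<otimes>\<^bsub>cyclic_grp 2 \<times>\<times> cyclic_grp 2\<^esub> v) = ?f u \<otimes>\<^bsub>P\<^esub> ?f v"
      using uv by (cases u; cases v) (simp add: DirProd_def cyclic_two P par_mult_def sg_mult)
    show "u = v" if "?f u = ?f v"
      using uv that by (cases u; cases v) (simp add: DirProd_def cyclic_two sg_eq_iff)
  qed
  then show ?thesis by (rule is_isoI)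
qed

lemma elementary_eight_iso:
  assumes P: "\<And>x y. x \<otimes>\<^bsub>P\<^esub> y = par_mult x y"
    and C: "carrier P = {(False, s, t, m) |s t m. s * s = (1 :: 'k::field_char_0) \<and> t * t = 1 \<and> m * m = 1}"
  shows "cyclic_grp 2 \<times>\<times> cyclic_grp 2 \<times>\<times> cyclic_grp 2 \<cong> P"
proof -
  let ?D = "cyclic_grp 2 \<times>\<times> cyclic_grp 2 \<times>\<times> cyclic_grp 2"
  let ?f = "\<lambda>(x, y, z). (False, sg x, sg y, sg z :: 'k)"
  have "?f \<in> iso ?D P"
    unfolding iso_def bij_betw_def
  proof (intro CollectI conjI homI inj_onI)
    show "?f ` carrier ?D = carrier P"
    proof (intro equalityI subsetI)
      fix p assume "p \<in> carrier P"
      then obtain s t m where st: "p = (False, s, t, m)" "s * s = 1" "t * t = 1" "m * m = 1" unfolding C by blast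
      obtain x y z where "x = 0 \<or> x = 1" "s = sg x" "y = 0 \<or> y = 1" "t = sg y" "z = 0 \<or> z = 1" "m = sg z"
        using sg_cases st(2-4) by metis
      then have "p = ?f (x, y, z)" "(x, y, z) \<in> carrier ?D"
        by (simp_all add: st(1) DirProd_def cyclic_two)
      then show "p \<in> ?f ` carrier ?D" by blast
    qed (auto simp: C DirProd_def sg_square)
    fix u v assume uv: "u \<in> carrier ?D" "v \<in> carrier ?D"
    show "?f u \<in> carrier P" by (cases u) (simp add: C sg_square)
    show "?f (u \<otimes>\<^bsub>?D\<^esub> v) = ?f u \<otimes>\<^bsub>P\<^esub> ?f v"
      using uv by (cases u; cases v) (simp add: DirProd_def cyclic_two P par_mult_def sg_mult)
    show "u = v" if "?f u = ?f v"
      using uv that by (cases u; cases v) (simp add: DirProd_def cyclic_two sg_eq_iff)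
  qed
  then show ?thesis by (rule is_isoI)
qed

lemma dihedral_iso:
  assumes C: "carrier (par_group a b) = {(w, s, t, 1) |w s t. s * s = (1 :: 'k::field_char_0) \<and> t * t = 1}"
  shows "par_group a b \<cong> dihedral_grp 4"
proof -
  have "inj_on to_dihedral (carrier (par_group a b))"
  proof (rule inj_onI)
    fix p q assume pq: "p \<in> carrier (par_group a b)" "q \<in> carrier (par_group a b)" "to_dihedral p = to_dihedral q"
    obtain w s t where p: "p = (w, s, t, 1)" "s = 1 \<or> s = -1" "t = 1 \<or> t = -1"
      using pq(1) unfolding C by (auto simp: square_eq_1_iff)
    obtain w' s' t' where q: "q = (w', s', t', 1)" "s' = 1 \<or> s' = -1" "t' = 1 \<or> t' = -1"
      using pq(2) unfolding C by (auto simp: square_eq_1_iff)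
    show "p = q"
      using p(2,3) q(2,3) pq(3) unfolding p(1) q(1) to_dihedral_def by (elim disjE; cases w; cases w'; simp)
  qed
  moreover have "to_dihedral ` carrier (par_group a b) = carrier (dihedral_grp 4)"
  proof (intro equalityI subsetI)
    fix y assume "y \<in> carrier (dihedral_grp 4)"
    then obtain w and s t :: 'k where "s * s = 1" "t * t = 1" "\<And>m. to_dihedral (w, s, t, m) = y" by (rule to_dihedral_cases) blast
    then show "y \<in> to_dihedral ` carrier (par_group a b)" unfolding C by (intro image_eqI[of _ _ "(w, s, t, 1)"]) auto
  qed (use hom_in_carrier[OF to_dihedral_hom] in auto)
  ultimately have "to_dihedral \<in> iso (par_group a b) (dihedral_grp 4)"
    using to_dihedral_hom by (simp add: iso_def bij_betw_def)
  then show ?thesis by (rule is_isoI)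
qed

context
  fixes a i :: "'k::field_char_0"
  assumes i: "i * i = -1" and a: "a * a = -1"
begin

lemma sixteen_carrier:
  "carrier (par_group a 0) = {(w, s, t, m) |w s t m. s * s = 1 \<and> t * t = 1 \<and> (if w then m = i \<or> m = -i else m = 1 \<or> m = -1)}"
proof -
  have "m * m = -1 \<longleftrightarrow> m = i \<or> m = -i" for m
    using i square_eq_iff[of m i] by (simp add: power2_eq_square)
  then show ?thesis
    by (auto simp: par_group_def par_ok_def a i square_eq_1_iff split: if_splits)
qed

lemma i_distinct: "i \<noteq> 1" "i \<noteq> -1" "i \<noteq> - i" "i \<noteq> 0" "- i \<noteq> 1" "- i \<noteq> -1"
proof -
  show 0: "i \<noteq> 0" and 1: "i \<noteq> 1" and 2: "i \<noteq> -1" using i by auto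
  show "i \<noteq> - i"
  proof
    assume "i = - i"
    then have "2 * i = 0" by (metis add.right_inverse mult_2)
    with 0 show False by simp
  qed
  show "- i \<noteq> 1" using 2 by (metis minus_minus)
  show "- i \<noteq> -1" using 1 by simp
qed

text \<open>Here \<open>to_dihedral\<close> forgets only a sign: its kernel is generated by
  \<open>(False, 1, 1, -1)\<close>, the parameter of \<open>tau\<close>.\<close>

lemma sixteen_extension:
  "to_dihedral ` carrier (par_group a 0) = carrier (dihedral_grp 4)"
  "(par_group a 0)\<lparr>carrier := kernel (par_group a 0) (dihedral_grp 4) to_dihedral\<rparr> \<cong> cyclic_grp 2"
proof -
  show "to_dihedral ` carrier (par_group a 0) = carrier (dihedral_grp 4)"
  proof (intro equalityI subsetI)
    fix y assume "y \<in> carrier (dihedral_grp 4)"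
    then obtain w and s t :: 'k where "s * s = 1" "t * t = 1" "\<And>m. to_dihedral (w, s, t, m) = y" by (rule to_dihedral_cases) blast
    then show "y \<in> to_dihedral ` carrier (par_group a 0)"
      unfolding sixteen_carrier by (intro image_eqI[of _ _ "(w, s, t, if w then i else 1)"]) auto
  qed (use hom_in_carrier[OF to_dihedral_hom] in auto)
  let ?P = "(par_group a 0)\<lparr>carrier := kernel (par_group a 0) (dihedral_grp 4) to_dihedral\<rparr>"
  have C: "carrier ?P = {(False, 1, 1, m) |m. m = 1 \<or> m = -1}"
    by (auto simp: kernel_def sixteen_carrier to_dihedral_def dihedral_grp_def square_eq_1_iff split: if_splits)
  interpret group "par_group a 0" by (rule group_par_group)
  interpret group_hom "par_group a 0" "dihedral_grp 4" to_dihedral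
    by (intro group_hom.intro group_hom_axioms.intro group_par_group group_dihedral_four to_dihedral_hom)
  let ?f = "\<lambda>x. (False, 1, 1, sg x :: 'k)"
  have "?f \<in> iso (cyclic_grp 2) ?P"
    unfolding iso_def bij_betw_def
  proof (intro CollectI conjI homI inj_onI)
    show "?f ` carrier (cyclic_grp 2) = carrier ?P"
    proof -
      have "carrier (cyclic_grp 2) = {0, 1}" using cyclic_two by blast
      then show ?thesis unfolding C by auto
    qed
    fix u v assume uv: "u \<in> carrier (cyclic_grp 2)" "v \<in> carrier (cyclic_grp 2)"
    show "?f u \<in> carrier ?P" unfolding C using uv by (auto simp: cyclic_two)
    show "?f (u \<otimes>\<^bsub>cyclic_grp 2\<^esub> v) = ?f u \<otimes>\<^bsub>?P\<^esub> ?f v"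
      using uv by (simp add: cyclic_two par_group_mult par_mult_def sg_mult)
    show "u = v" if "?f u = ?f v" using uv that by (simp add: cyclic_two sg_eq_iff)
  qed
  then have "cyclic_grp 2 \<cong> ?P" by (rule is_isoI)
  then show "?P \<cong> cyclic_grp 2" by (rule group.iso_sym[OF group_integer_mod_group])
qed

text \<open>The entry \<open>m\<close> is a fourth root of unity and multiplicative; this is its
  logarithm to base \<open>i\<close>. It is split by the powers of \<open>(True, 1, 1, i)\<close>,
  which \<open>exp_i\<close> lists.\<close>

definition log_i :: "'k par \<Rightarrow> int" where
  "log_i = (\<lambda>(w, s, t, m). if m = 1 then 0 else if m = i then 1 else if m = -1 then 2 else 3)"

definition exp_i :: "int \<Rightarrow> 'k par" where
  "exp_i x = (odd x, 1, 1, i ^ nat x)"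

lemma log_i_hom: "log_i \<in> hom (par_group a 0) (cyclic_grp 4)"
proof (rule homI)
  fix p q :: "'k par"
  obtain w s t m where p: "p = (w, s, t, m)" by (cases p)
  obtain w' s' t' m' where q: "q = (w', s', t', m')" by (cases q)
  show "log_i p \<in> carrier (cyclic_grp 4)" by (simp add: p log_i_def cyclic_four)
  assume "p \<in> carrier (par_group a 0)" "q \<in> carrier (par_group a 0)"
  then have "m = 1 \<or> m = i \<or> m = -1 \<or> m = -i" "m' = 1 \<or> m' = i \<or> m' = -1 \<or> m' = -i"
    unfolding sixteen_carrier p q by (auto split: if_splits)
  then show "log_i (p \<otimes>\<^bsub>par_group a 0\<^esub> q) = log_i p \<otimes>\<^bsub>cyclic_grp 4\<^esub> log_i q"
    by (elim disjE; simp add: p q log_i_def par_group_def par_mult_def i i_distinct i_distinct[symmetric])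
qed

lemma exp_i_simps: "exp_i 0 = (False, 1, 1, 1)" "exp_i 1 = (True, 1, 1, i)" "exp_i 2 = (False, 1, 1, -1)" "exp_i 3 = (True, 1, 1, -i)"
  by (simp_all add: exp_i_def power2_eq_square power3_eq_cube i)

text \<open>K is the part with m = 1, which excludes a swap and leaves two signs; L is generated by
  \<open>(True, 1, 1, i)\<close>. Every element is a sign change times the element of L with the
  same \<open>m\<close>.\<close>

lemma sixteen_semidirect: "is_semidirect_product (par_group a 0) (cyclic_grp 2 \<times>\<times> cyclic_grp 2) (cyclic_grp 4)"
proof -
  interpret P: group "par_group a 0" by (rule group_par_group)
  interpret l: group_hom "par_group a 0" "cyclic_grp 4" log_i
    by (intro group_hom.intro group_hom_axioms.intro group_par_group group_integer_mod_group log_i_hom)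
  have exp_hom: "exp_i \<in> hom (cyclic_grp 4) (par_group a 0)"
  proof (rule homI)
    show "exp_i x \<in> carrier (par_group a 0)" if "x \<in> carrier (cyclic_grp 4)" for x
      using that unfolding cyclic_four by (elim disjE) (auto simp: exp_i_simps sixteen_carrier)
    show "exp_i (x \<otimes>\<^bsub>cyclic_grp 4\<^esub> y) = exp_i x \<otimes>\<^bsub>par_group a 0\<^esub> exp_i y"
      if "x \<in> carrier (cyclic_grp 4)" "y \<in> carrier (cyclic_grp 4)" for x y
      using that unfolding cyclic_four by (elim disjE) (simp_all add: exp_i_simps par_group_def par_mult_def i)
  qed
  interpret e: group_hom "cyclic_grp 4" "par_group a 0" exp_i
    by (intro group_hom.intro group_hom_axioms.intro group_par_group group_integer_mod_group exp_hom)
  define K where "K = kernel (par_group a 0) (cyclic_grp 4) log_i"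
  define L where "L = exp_i ` carrier (cyclic_grp 4)"
  have K: "K = {(False, s, t, 1) |s t. s * s = 1 \<and> t * t = 1}"
    unfolding K_def kernel_def sixteen_carrier using i_distinct by (auto simp: log_i_def split: if_splits)
  have L: "L = {(False, 1, 1, 1), (True, 1, 1, i), (False, 1, 1, -1), (True, 1, 1, -i)}"
  proof -
    have "carrier (cyclic_grp 4) = {0, 1, 2, 3}" using cyclic_four by blast
    then show ?thesis unfolding L_def by (simp add: exp_i_simps)
  qed
  have "K \<lhd> par_group a 0" unfolding K_def by (rule l.normal_kernel)
  moreover have "subgroup L (par_group a 0)" unfolding L_def by (rule e.img_is_subgroup)
  moreover have "K \<inter> L = {\<one>\<^bsub>par_group a 0\<^esub>}" unfolding K L by (auto simp: par_group_def)
  moreover have "K <#>\<^bsub>par_group a 0\<^esub> L = carrier (par_group a 0)"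
  proof (intro equalityI subsetI)
    fix p assume "p \<in> K <#>\<^bsub>par_group a 0\<^esub> L"
    then obtain x y where "x \<in> K" "y \<in> L" "p = x \<otimes>\<^bsub>par_group a 0\<^esub> y" unfolding set_mult_def by blast
    then show "p \<in> carrier (par_group a 0)"
      using subgroup.mem_carrier[OF normal_imp_subgroup[OF \<open>K \<lhd> par_group a 0\<close>]]
        subgroup.mem_carrier[OF \<open>subgroup L (par_group a 0)\<close>] by (simp add: P.m_closed)
  next
    fix p assume "p \<in> carrier (par_group a 0)"
    then obtain w s t m where p: "p = (w, s, t, m)" "s * s = 1" "t * t = 1" "if w then m = i \<or> m = -i else m = 1 \<or> m = -1"
      unfolding sixteen_carrier by blast
    have "(False, if w then t else s, if w then s else t, 1) \<in> K" using p by (simp add: K)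
    moreover have "(w, 1, 1, m) \<in> L" using p(4) by (auto simp: L split: if_splits)
    moreover have "p = (False, if w then t else s, if w then s else t, 1) \<otimes>\<^bsub>par_group a 0\<^esub> (w, 1, 1, m)"
      by (simp add: p(1) par_group_def par_mult_def)
    ultimately show "p \<in> K <#>\<^bsub>par_group a 0\<^esub> L" unfolding set_mult_def by blast
  qed
  moreover have "(par_group a 0)\<lparr>carrier := K\<rparr> \<cong> cyclic_grp 2 \<times>\<times> cyclic_grp 2"
    by (rule group.iso_sym[OF DirProd_group klein_iso]) (simp_all add: K par_group_def)
  moreover have "(par_group a 0)\<lparr>carrier := L\<rparr> \<cong> cyclic_grp 4"
  proof -
    have "inj_on exp_i (carrier (cyclic_grp 4))"
      by (rule inj_onI) (use i_distinct in \<open>auto simp: cyclic_four exp_i_simps\<close>)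
    then have "exp_i \<in> iso (cyclic_grp 4) ((par_group a 0)\<lparr>carrier := L\<rparr>)"
      using exp_hom by (auto simp: iso_def bij_betw_def hom_def L_def)
    then show ?thesis by (rule group.iso_sym[OF group_integer_mod_group is_isoI])
  qed
  ultimately show ?thesis unfolding is_semidirect_product_def by blast
qed

end

section \<open>The given generators as parameters, and the four cases\<close>

lemma iota1_par: "iota1 a = (monomial_map a (False, -1, 1, 1) :: 'k::field_char_0 ^ 5 \<Rightarrow> 'k ^ 5)"
  and iota2_par: "iota2 = (monomial_map a (False, 1, -1, 1) :: 'k::field_char_0 ^ 5 \<Rightarrow> 'k ^ 5)"
  and tau_par: "tau a = (monomial_map a (False, 1, 1, -1) :: 'k::field_char_0 ^ 5 \<Rightarrow> 'k ^ 5)"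
  by (auto simp: fun_eq_iff iota1_def iota2_def tau_def monomial_map_def vec_eq_5)

lemma sigma1_par:
  assumes "s * s = 1"
  shows "sigma1 s = (monomial_map s (True, - s, s, 1) :: 'k::field_char_0 ^ 5 \<Rightarrow> 'k ^ 5)"
  using assms by (auto simp: fun_eq_iff sigma1_def monomial_map_def vec_eq_5)

lemma sigma2_par:
  assumes "s * s = 1" "i * i = -1"
  shows "sigma2 i s = (monomial_map (s * i) (True, s, - s, i) :: 'k::field_char_0 ^ 5 \<Rightarrow> 'k ^ 5)"
proof -
  have "i * (s * i) = - s" "s * i * s = i" using assms by algebra+
  then show ?thesis by (auto simp: fun_eq_iff sigma2_def monomial_map_def vec_eq_5)
qed

lemma generate_four:
  fixes a b :: "'k::field_char_0"
  assumes S: "(False, -1, 1, 1) \<in> generate (par_group a b) S" "(False, 1, -1, 1) \<in> generate (par_group a b) S"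
    and st: "s * s = 1" "t * t = 1"
  shows "(False, s, t, 1) \<in> generate (par_group a b) S"
proof -
  have "(False, 1, 1, 1) \<in> generate (par_group a b) S"
    using generate.one[of "par_group a b" S] by (simp add: par_group_def)
  moreover have "(False, -1, -1, 1) \<in> generate (par_group a b) S"
    using generate_par_mult[OF S] by (simp add: par_mult_def)
  moreover have "s = 1 \<or> s = -1" "t = 1 \<or> t = -1" using st by (simp_all add: square_eq_1_iff)
  ultimately show ?thesis using S by auto
qed

theorem proposition8p2:
  fixes a b i :: "'k :: {alg_closed_field, field_char_0}"
    and X :: "('k ^ 5) set set"
    and G :: "(('k ^ 5) set \<Rightarrow> ('k ^ 5) set) monoid"
  assumes i: "i\<^sup>2 = -1"
    and a: "a \<noteq> 0"
    and nodes: "nodal_with (cubic_form a b) 8"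
    and X_def: "X = hypersurface (cubic_form a b)"
    and G_def: "G = aut_group X"
  shows
    "(b \<noteq> 0 \<and> a \<noteq> 1 \<and> a \<noteq> -1 \<and>
        carrier G = generate G {proj_map X (iota1 a), proj_map X iota2} \<and>
        G \<cong> cyclic_grp 2 \<times>\<times> cyclic_grp 2) \<or>
     (b \<noteq> 0 \<and> (\<exists>s \<in> {1, -1}. a = s \<and>
        carrier G = generate G {proj_map X iota2, proj_map X (sigma1 s)}) \<and>
        G \<cong> dihedral_grp 4) \<or>
     (b = 0 \<and> a \<noteq> i \<and> a \<noteq> -i \<and>
        carrier G = generate G {proj_map X (iota1 a), proj_map X iota2, proj_map X (tau a)} \<and>
        G \<cong> cyclic_grp 2 \<times>\<times> cyclic_grp 2 \<times>\<times> cyclic_grp 2) \<or>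
     (b = 0 \<and> (\<exists>s \<in> {1, -1}. a = s * i \<and>
        carrier G = generate G {proj_map X (tau a), proj_map X iota2, proj_map X (sigma2 i s)}) \<and>
        is_extension G (cyclic_grp 2) (dihedral_grp 4) \<and>
        is_semidirect_product G (cyclic_grp 2 \<times>\<times> cyclic_grp 2) (cyclic_grp 4))"
proof -
  define P where "P = par_group a b"
  define h where "h p = proj_map X (monomial_map a p)" for p
  have iso: "h \<in> iso P G" using act_iso[OF X_def a nodes] unfolding P_def h_def G_def by simp
  have P: "group P" unfolding P_def by (rule group_par_group)
  have G: "group G" unfolding G_def by (rule group_aut_group[OF X_def a nodes])
  have C: "carrier P = {p. par_ok a b p}" by (simp add: P_def par_group_def)
  have PG: "P \<cong> G" using iso by (rule is_isoI)
  have GN: "G \<cong> N" if "P \<cong> N" for N :: "'z monoid"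
    using group.iso_sym[OF P PG] that by (rule iso_trans)
  have gen: "carrier G = generate G (h ` S)" if "S \<subseteq> carrier P" "\<And>p. p \<in> carrier P \<Longrightarrow> p \<in> generate P S" for S
    by (rule generate_iso[OF P G iso that])
  have mult: "x \<otimes>\<^bsub>P\<^esub> y = par_mult x y" for x y by (simp add: P_def par_group_def)
  have i2: "i * i = -1" using i by (simp add: power2_eq_square)
  have four: "(False, s, t, 1) \<in> generate P S"
    if "(False, -1, 1, 1) \<in> generate P S" "(False, 1, -1, 1) \<in> generate P S" "s * s = 1" "t * t = 1" for s t S
    using generate_four[of a b S s t] that unfolding P_def by blast
  have gm: "par_mult p q \<in> generate P S" if "p \<in> generate P S" "q \<in> generate P S" for p q S
    using generate_par_mult[of p a b S q] that unfolding P_def by blast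
  have a2: "a * a = 1 \<longleftrightarrow> a = 1 \<or> a = -1" by (rule square_eq_1_iff)
  show ?thesis
  proof (cases "b = 0")
    case False
    have m1: "m = 1" if "par_ok a b (w, s, t, m)" for w s t m using par_ok_one[OF that False] .
    show ?thesis
    proof (cases "a = 1 \<or> a = -1")
      case True
      then have aa: "a * a = 1" by auto
      have C2: "carrier P = {(w, s, t, 1) |w s t. s * s = 1 \<and> t * t = 1}"
      proof (intro equalityI subsetI)
        fix p assume "p \<in> carrier P"
        then have ok: "par_ok a b p" by (simp add: C)
        obtain w s t m where p: "p = (w, s, t, m)" by (cases p)
        have "m = 1" using ok m1 unfolding p by blast
        moreover have "s * s = 1" "t * t = 1" using ok unfolding p by (simp_all add: par_ok_def)
        ultimately show "p \<in> {(w, s, t, 1) |w s t. s * s = 1 \<and> t * t = 1}" using p by blast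
      qed (auto simp: C par_ok_def aa)
      have "P \<cong> dihedral_grp 4" unfolding P_def by (rule dihedral_iso[OF C2[unfolded P_def]])
      then have "G \<cong> dihedral_grp 4" by (rule GN)
      let ?S = "{(False, 1, -1, 1), (True, - a, a, 1)}"
      have "carrier G = generate G (h ` ?S)"
      proof (rule gen)
        show "?S \<subseteq> carrier P" unfolding C2 using aa by auto
        fix p assume "p \<in> carrier P"
        then obtain w s t where p: "p = (w, s, t, 1)" "s * s = 1" "t * t = 1" unfolding C2 by blast
        have g: "(False, 1, -1, 1) \<in> generate P ?S" "(True, - a, a, 1) \<in> generate P ?S" by (auto intro: generate.incl)
        \<comment> \<open>The square of \<open>sigma1\<close> changes both signs; composed with
          \<open>iota2\<close> it gives \<open>iota1\<close>, so all sign changes are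
          available.\<close>
        have "(False, -1, -1, 1) \<in> generate P ?S" using gm[OF g(2) g(2)] aa by (simp add: par_mult_def)
        from gm[OF this g(1)] have "(False, -1, 1, 1) \<in> generate P ?S" by (simp add: par_mult_def)
        note N = four[OF this g(1)]
        show "p \<in> generate P ?S"
        proof (cases w)
          case True
          have 1: "(- a * s) * (- a * s) = 1" using p(2) aa by algebra
          have 2: "(a * t) * (a * t) = 1" using p(3) aa by algebra
          from gm[OF g(2) N[OF 1 2]] show ?thesis
            using True aa by (simp add: p(1) par_mult_def mult.assoc[symmetric])
        qed (use N p in auto)
      qed
      then have "carrier G = generate G {proj_map X iota2, proj_map X (sigma1 a)}"
        unfolding iota2_par[of a] sigma1_par[OF aa] by (simp add: h_def)
      with \<open>G \<cong> dihedral_grp 4\<close> True False show ?thesis by auto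
    next
      case nsq: False
      have C2: "carrier P = {(False, s, t, 1) |s t. s * s = 1 \<and> t * t = 1}"
      proof (intro equalityI subsetI)
        fix p assume "p \<in> carrier P"
        then have ok: "par_ok a b p" by (simp add: C)
        obtain w s t m where p: "p = (w, s, t, m)" by (cases p)
        have m: "m = 1" using ok m1 unfolding p by blast
        have "s * s = 1" "t * t = 1" using ok unfolding p by (simp_all add: par_ok_def)
        moreover have "\<not> w" using ok nsq a2 unfolding p m by (auto simp: par_ok_def)
        ultimately show "p \<in> {(False, s, t, 1) |s t. s * s = 1 \<and> t * t = 1}" using p m by blast
      qed (auto simp: C par_ok_def)
      have "cyclic_grp 2 \<times>\<times> cyclic_grp 2 \<cong> P" by (rule klein_iso[OF mult C2])
      then have "P \<cong> cyclic_grp 2 \<times>\<times> cyclic_grp 2" by (rule group.iso_sym[OF DirProd_group, rotated 2]) auto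
      then have "G \<cong> cyclic_grp 2 \<times>\<times> cyclic_grp 2" by (rule GN)
      let ?S = "{(False, -1, 1, 1), (False, 1, -1, 1)}"
      have "carrier G = generate G (h ` ?S)"
      proof (rule gen)
        show "?S \<subseteq> carrier P" unfolding C2 by auto
        show "p \<in> generate P ?S" if "p \<in> carrier P" for p
          using that four[of ?S] unfolding C2 by (auto intro: generate.incl)
      qed
      then have "carrier G = generate G {proj_map X (iota1 a), proj_map X iota2}"
        unfolding iota1_par iota2_par[of a] by (simp add: h_def)
      with \<open>G \<cong> cyclic_grp 2 \<times>\<times> cyclic_grp 2\<close> nsq False show ?thesis by blast
    qed
  next
    case b: True
    \<comment> \<open>For b = 0 the excluded values b = +-(1 +- a) contain a = +-1.\<close>
    have na: "a * a \<noteq> 1"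
      using nodal_parameters[OF a nodes, of 1 1] nodal_parameters[OF a nodes, of 1 "-1"] unfolding a2 b by auto
    show ?thesis
    proof (cases "a = i \<or> a = - i")
      case True
      then obtain s0 where s0: "s0 = 1 \<or> s0 = -1" "a = s0 * i" by (metis mult_1 mult_minus1)
      then have ss: "s0 * s0 = 1" by auto
      have aa: "a * a = -1" using s0 i2 by auto
      have C2: "carrier P = {(w, s, t, m) |w s t m. s * s = 1 \<and> t * t = 1 \<and> (if w then m = i \<or> m = -i else m = 1 \<or> m = -1)}"
        unfolding P_def b by (rule sixteen_carrier[OF i2 aa])
      have ext: "is_extension G (cyclic_grp 2) (dihedral_grp 4)"
        by (rule extension_of_hom[OF P G group_dihedral_four iso])
          (use to_dihedral_hom sixteen_extension[OF i2 aa] in \<open>simp_all add: P_def b\<close>)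
      have semi: "is_semidirect_product G (cyclic_grp 2 \<times>\<times> cyclic_grp 2) (cyclic_grp 4)"
        by (rule semidirect_product_iso[OF P G iso]) (use sixteen_semidirect[OF i2 aa] in \<open>simp add: P_def b\<close>)
      let ?S = "{(False, 1, 1, -1), (False, 1, -1, 1), (True, s0, - s0, i)}"
      have "carrier G = generate G (h ` ?S)"
      proof (rule gen)
        show "?S \<subseteq> carrier P" unfolding C2 using ss by auto
        fix p assume "p \<in> carrier P"
        then obtain w s t m where p: "p = (w, s, t, m)" "s * s = 1" "t * t = 1" "if w then m = i \<or> m = -i else m = 1 \<or> m = -1"
          unfolding C2 by blast
        have g: "(False, 1, 1, -1) \<in> generate P ?S" "(False, 1, -1, 1) \<in> generate P ?S" "(True, s0, - s0, i) \<in> generate P ?S"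
          by (auto intro: generate.incl)
        \<comment> \<open>The square of \<open>sigma2\<close> changes both signs and has m = -1;
          multiplication by \<open>iota2\<close> and \<open>tau\<close> isolates
          \<open>iota1\<close>.\<close>
        have "(False, -1, -1, -1) \<in> generate P ?S" using gm[OF g(3) g(3)] ss i2 by (simp add: par_mult_def)
        from gm[OF gm[OF this g(2)] g(1)] have "(False, -1, 1, 1) \<in> generate P ?S" by (simp add: par_mult_def)
        note N1 = four[OF this g(2)]
        have N: "(False, x, y, z) \<in> generate P ?S" if "x * x = 1" "y * y = 1" "z = 1 \<or> z = -1" for x y z
          using N1[OF that(1,2)] gm[OF N1[OF that(1,2)] g(1)] that(3) by (auto simp: par_mult_def)
        show "p \<in> generate P ?S"
        proof (cases w)
          case True
          have "(s0 * s) * (s0 * s) = 1" using p(2) ss by algebra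
          moreover have "(- s0 * t) * (- s0 * t) = 1" using p(3) ss by algebra
          \<comment> \<open>As -i is the inverse of i, dividing by \<open>sigma2\<close> leaves an
            element without a swap whose \<open>m\<close> is a sign.\<close>
          moreover have "- i * m = 1 \<or> - i * m = -1" using p(4) True i2 by auto
          ultimately have "par_mult (True, s0, - s0, i) (False, s0 * s, - s0 * t, - i * m) \<in> generate P ?S"
            by (intro gm[OF g(3)] N)
          then show ?thesis
            using True ss i2 by (simp add: p(1) par_mult_def mult.assoc[symmetric])
        qed (use N p in auto)
      qed
      then have "carrier G = generate G {proj_map X (tau a), proj_map X iota2, proj_map X (sigma2 i s0)}"
        unfolding tau_par iota2_par[of a] sigma2_par[OF ss i2] s0(2)[symmetric] by (simp add: h_def)
      with ext semi b s0 show ?thesis by auto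
    next
      case ni: False
      \<comment> \<open>A swap needs m^2 = a^2 and a^2 m^2 = 1, so a^4 = 1, which is impossible when
        a^2 is neither 1 nor -1.\<close>
      have no_swap: False if "m * m = a * a" "a * a * (m * m) = 1" for m
      proof -
        have "(a * a - 1) * ((a - i) * (a + i)) = 0" using that i2 by algebra
        then show False using na ni by (simp add: eq_neg_iff_add_eq_0)
      qed
      have C2: "carrier P = {(False, s, t, m) |s t m. s * s = 1 \<and> t * t = 1 \<and> m * m = 1}"
        unfolding C using no_swap by (auto simp: par_ok_def b split: if_splits)
      have "cyclic_grp 2 \<times>\<times> cyclic_grp 2 \<times>\<times> cyclic_grp 2 \<cong> P" by (rule elementary_eight_iso[OF mult C2])
      then have "P \<cong> cyclic_grp 2 \<times>\<times> cyclic_grp 2 \<times>\<times> cyclic_grp 2"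
        by (rule group.iso_sym[OF DirProd_group[OF _ DirProd_group], rotated 3]) auto
      then have e8: "G \<cong> cyclic_grp 2 \<times>\<times> cyclic_grp 2 \<times>\<times> cyclic_grp 2" by (rule GN)
      let ?S = "{(False, -1, 1, 1), (False, 1, -1, 1), (False, 1, 1, -1)}"
      have "carrier G = generate G (h ` ?S)"
      proof (rule gen)
        show "?S \<subseteq> carrier P" unfolding C2 by auto
        fix p assume "p \<in> carrier P"
        then obtain s t m where p: "p = (False, s, t, m)" "s * s = 1" "t * t = 1" "m * m = 1" unfolding C2 by blast
        have g: "(False, -1, 1, 1) \<in> generate P ?S" "(False, 1, -1, 1) \<in> generate P ?S" "(False, 1, 1, -1) \<in> generate P ?S"
          by (auto intro: generate.incl)
        note N = four[OF g(1,2) p(2,3)]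
        have "m = 1 \<or> m = -1" using p(4) by (simp add: square_eq_1_iff)
        then show "p \<in> generate P ?S" using N gm[OF N g(3)] by (auto simp: p(1) par_mult_def)
      qed
      then have "carrier G = generate G {proj_map X (iota1 a), proj_map X iota2, proj_map X (tau a)}"
        unfolding iota1_par iota2_par[of a] tau_par by (simp add: h_def)
      with e8 ni b show ?thesis by blast
    qed
  qed
qed

end
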